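(* There is a constant $C>0$ such that for any $f_0,g_0\in L^2_{x,v}(\mathbb{R}^2\times\mathbb{R}^2)$, $$\big\Vert Q^+\big(T(t)f_0,T(t)g_0\big)\big\Vert_{L^1_tL^2_{x,v}(\mathbb{R}\times\mathbb{R}^2\times\mathbb{R}^2)}\le C\,\Vert f_0\Vert_{L^2_{x,v}(\mathbb{R}^2\times\mathbb{R}^2)}\,\Vert g_0\Vert_{L^2_{x,v}(\mathbb{R}^2\times\mathbb{R}^2)} .$$
   Context: Here $x,v\in\mathbb{R}^2$, and $T(t)=e^{-tv\cdot\nabla_x}$ is the free transport group, $(T(t)h)(x,v)=h(x-tv,v)$. The gain operator (constant collision kernel, $d=2$) is $$Q^+(f,g)(x,v)=\int_{\mathbb{S}^1}d\omega\int_{\mathbb{R}^2}du\,f(x,v^* )g(x,u^* ),$$ with $u^*=u+(\omega\cdot(v-u))\omega$ and $v^*=v-(\omega\cdot(v-u))\omega$. *)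

theory Defs
  imports "HOL-Analysis.Analysis"
begin

text \<open>
  Functions on phase space take a pair \<open>(x, v)\<close>. Elements of Lebesgue spaces are represented by
  arbitrary Lebesgue measurable functions, so statements about them range over all representatives.
\<close>

type_synonym phase = "(real^2) \<times> (real^2)"

definition in_L2 :: "('a::euclidean_space \<Rightarrow> complex) \<Rightarrow> bool" where
  "in_L2 f \<longleftrightarrow> f \<in> borel_measurable lebesgue \<and> integrable lebesgue (\<lambda>z. (cmod (f z))\<^sup>2)"

definition L2_norm :: "('a::euclidean_space \<Rightarrow> complex) \<Rightarrow> real" where
  "L2_norm f = sqrt (\<integral>z. (cmod (f z))\<^sup>2 \<partial>lebesgue)"

definition in_L1L2 :: "(real \<Rightarrow> 'a::euclidean_space \<Rightarrow> complex) \<Rightarrow> bool" where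
  "in_L1L2 F \<longleftrightarrow>
     (\<lambda>(t, z). F t z) \<in> borel_measurable lebesgue \<and>
     (AE t in lebesgue. in_L2 (F t)) \<and>
     integrable lebesgue (\<lambda>t. L2_norm (F t))"

definition L1L2_norm :: "(real \<Rightarrow> 'a::euclidean_space \<Rightarrow> complex) \<Rightarrow> real" where
  "L1L2_norm F = (\<integral>t. L2_norm (F t) \<partial>lebesgue)"

definition transport :: "real \<Rightarrow> (phase \<Rightarrow> complex) \<Rightarrow> (phase \<Rightarrow> complex)" where
  "transport t h = (\<lambda>(x, v). h (x - t *\<^sub>R v, v))"

definition u_star :: "real^2 \<Rightarrow> real^2 \<Rightarrow> real^2 \<Rightarrow> real^2" where
  "u_star \<omega> v u = u + (\<omega> \<bullet> (v - u)) *\<^sub>R \<omega>"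

definition v_star :: "real^2 \<Rightarrow> real^2 \<Rightarrow> real^2 \<Rightarrow> real^2" where
  "v_star \<omega> v u = v - (\<omega> \<bullet> (v - u)) *\<^sub>R \<omega>"

definition circle_point :: "real \<Rightarrow> real^2" where
  "circle_point \<theta> = vector [cos \<theta>, sin \<theta>]"

definition gain_integrand ::
    "(phase \<Rightarrow> complex) \<Rightarrow> (phase \<Rightarrow> complex) \<Rightarrow> phase \<Rightarrow> real^2 \<Rightarrow> real^2 \<Rightarrow> complex" where
  "gain_integrand f g = (\<lambda>(x, v) \<omega> u. f (x, v_star \<omega> v u) * g (x, u_star \<omega> v u))"

text \<open>
  The measure on the unit circle is arc length, written in the angle \<open>\<theta> \<in> [0, 2\<pi>]\<close>. The Bochner
  integral is 0 by convention where it diverges; \<open>gain_converges\<close> says that the double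
  integral defining the gain operator at a point of phase space converges absolutely.
\<close>

definition gain ::
    "(phase \<Rightarrow> complex) \<Rightarrow> (phase \<Rightarrow> complex) \<Rightarrow> phase \<Rightarrow> complex" where
  "gain f g z =
     (\<integral>\<theta>. (\<integral>u. gain_integrand f g z (circle_point \<theta>) u \<partial>lebesgue) \<partial>lebesgue_on {0..2 * pi})"

definition gain_converges ::
    "(phase \<Rightarrow> complex) \<Rightarrow> (phase \<Rightarrow> complex) \<Rightarrow> phase \<Rightarrow> bool" where
  "gain_converges f g z \<longleftrightarrow>
     integrable (lebesgue_on ({0..2 * pi} \<times> UNIV))
       (\<lambda>(\<theta>, u). gain_integrand f g z (circle_point \<theta>) u)"

end

theory Submission
  imports Defs "HOL-Probability.Characteristic_Functions"
begin

text \<open>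
  By taking absolute values it suffices to treat nonnegative densities. At a fixed time the gain operator is, after
  measuring the collision angle \<open>\<theta>\<close> from the relative velocity \<open>w\<close>, an average over \<open>\<theta>\<close> of the bilinear operators
  \<open>\<integral> f (v - c w) g (v - (1 - c) w) dw\<close> with \<open>c = cos \<theta> e\<^sup>i\<^sup>\<theta>\<close>. Expanding the square and using \<open>\<bar>1 - 2 c\<bar> = 1\<close>, the squared
  \<open>L\<^sup>2\<close> norm of such an operator is \<open>\<integral> A\<^sub>f (- c s) A\<^sub>g (- (1 - c) s) ds\<close>, where \<open>A\<^sub>f\<close> is the autocorrelation of \<open>f\<close> in the velocity.
  Hence the squared norm of the gain term is controlled by \<open>\<parallel>A\<^sub>f\<parallel>\<^sub>2 \<parallel>A\<^sub>g\<parallel>\<^sub>2\<close>, since \<open>\<bar>cos \<theta> sin \<theta>\<bar> powr (- 1 / 2)\<close> is integrable over the circle.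

  The Fourier transform \<open>u\<close> of the transported density in the velocity variable satisfies \<open>\<parallel>A\<^sub>f\<parallel>\<^sub>2 \<le> \<parallel>u\<parallel>\<^sub>4\<^sup>2\<close> and solves a Schroedinger
  equation on the phase space, of dimension 4, with decay \<open>\<bar>t\<bar>\<^sup>-\<^sup>2\<close>. The bound \<open>\<integral> \<parallel>u\<parallel>\<^sub>4\<^sup>2 dt \<le> C \<parallel>f\<parallel>\<^sub>2\<^sup>2\<close> is the Strichartz estimate at the endpoint, which
  follows from the bilinear interpolation argument of Keel and Tao, applied to the octaves of \<open>\<bar>u\<bar>\<close>.
\<close>

section \<open>Nonnegative extended reals and Lebesgue measure\<close>

text \<open>The exponent is critical. After Cauchy-Schwarz in time, an L^1_t bound for the gain term
  asks for exactly L^2_t of \<open>u\<close> in L^4. With decay |t|^-2 the solution map composed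
  with its adjoint acts from L^{4/3} to L^4 with norm |t - s|^-1, so interpolating the two basic
  bounds at each pair of times diverges logarithmically; decay between distinct octaves has to
  supply the convergence.

  The argument is arranged to stay in \<open>ennreal\<close>. The solution map is dualised back to
  the phase space of initial data, where the evolution is a transport and the decay is the Jacobian
  of a linear change of variables. There both bilinear bounds survive when the dual functions are
  replaced by their moduli, so Tonelli and Fatou suffice. The Fourier transform enters only through
  two one-sided forms of Plancherel with lossy constants, both read off from one Gaussian-weighted
  identity.\<close>

abbreviation (input) nn_integral_lborel :: "('a::euclidean_space \<Rightarrow> ennreal) \<Rightarrow> ennreal" (binder \<open>\<integral>+\<close> 10)
  where "nn_integral_lborel \<equiv> nn_integral lborel"

text \<open>Infinity needs its own case because \<open>enn2real top = 0\<close>. With it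
  \<open>esqrt\<close> inverts squaring on all of \<open>ennreal\<close>, so norms can be
  manipulated before they are known to be finite.\<close>

definition esqrt :: "ennreal \<Rightarrow> ennreal" where
  "esqrt x = (if x = top then top else ennreal (sqrt (enn2real x)))"

lemma esqrt_ennreal: "0 \<le> r \<Longrightarrow> esqrt (ennreal r) = ennreal (sqrt r)"
  by (simp add: esqrt_def)

lemma esqrt_power2 [simp]: "(esqrt x)\<^sup>2 = x"
proof (cases x)
  case (real r)
  then show ?thesis by (simp add: esqrt_ennreal ennreal_power)
next
  case top
  then show ?thesis by (simp add: esqrt_def power2_eq_square)
qed

lemma power2_le_ennreal_iff: "x\<^sup>2 \<le> y\<^sup>2 \<longleftrightarrow> x \<le> (y::ennreal)"
proof
  assume *: "x\<^sup>2 \<le> y\<^sup>2"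
  show "x \<le> y"
  proof (rule ccontr)
    assume "\<not> x \<le> y"
    then have "y < x" by simp
    then obtain r where r: "y = ennreal r" "0 \<le> r" by (cases y) auto
    show False
    proof (cases x)
      case (real s)
      with * r \<open>y < x\<close> show False
        by (simp add: ennreal_power ennreal_less_iff power_mono_iff)
    next
      case top
      with * r show False by (simp add: ennreal_power top_unique)
    qed
  qed
qed (intro power_mono, auto)

lemma power2_eq_ennreal_iff: "x\<^sup>2 = y\<^sup>2 \<longleftrightarrow> x = (y::ennreal)"
  using power2_le_ennreal_iff[of x y] power2_le_ennreal_iff[of y x] by (auto intro: order_antisym)

lemma esqrt_of_power2 [simp]: "esqrt (x\<^sup>2) = x"
  using power2_eq_ennreal_iff[of "esqrt (x\<^sup>2)" x] by simp

lemma esqrt_mono: "x \<le> y \<Longrightarrow> esqrt x \<le> esqrt y"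
  using power2_le_ennreal_iff[of "esqrt x" "esqrt y"] by simp

lemma esqrt_le_iff: "esqrt x \<le> y \<longleftrightarrow> x \<le> y\<^sup>2"
  using power2_le_ennreal_iff[of "esqrt x" y] by simp

lemma esqrt_mult: "esqrt (x * y) = esqrt x * esqrt y"
  using power2_eq_ennreal_iff[of "esqrt (x * y)" "esqrt x * esqrt y"] by (simp add: power_mult_distrib)

lemma measurable_esqrt [measurable]: "esqrt \<in> borel_measurable borel"
  unfolding esqrt_def by measurable

lemma Liminf_power2_ennreal:
  fixes a :: "nat \<Rightarrow> ennreal"
  shows "liminf (\<lambda>k. (a k)\<^sup>2) = (liminf a)\<^sup>2"
proof -
  have "continuous_on UNIV (\<lambda>x::ennreal. x\<^sup>2)"
    unfolding continuous_on_def power2_eq_square by (auto intro!: tendsto_mult_ennreal tendsto_ident_at)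
  moreover have "mono (\<lambda>x::ennreal. x\<^sup>2)"
    by (intro monoI power_mono) auto
  ultimately show ?thesis
    by (subst Liminf_compose_continuous_mono[symmetric]) auto
qed

lemma esqrt_liminf: "esqrt (liminf a) = liminf (\<lambda>k. esqrt (a k))"
proof -
  have "(liminf (\<lambda>k. esqrt (a k)))\<^sup>2 = liminf a"
    using Liminf_power2_ennreal[of "\<lambda>k. esqrt (a k)"] by simp
  then show ?thesis by (metis esqrt_of_power2)
qed

text \<open>Expands \<open>(l * r - s)^2 >= 0\<close>. The free weight \<open>l\<close> is what
  later balances two octaves of different size and makes the absorption of half of the left-hand
  side possible.\<close>

lemma ennreal_mult_le_weighted:
  fixes a b :: ennreal
  assumes "0 < l"
  shows "a * b \<le> ennreal l * a\<^sup>2 + ennreal (1 / l) * b\<^sup>2"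
proof (cases "a = top \<or> b = top")
  case True
  then show ?thesis using assms by (auto simp: ennreal_mult_top ennreal_mult_eq_top_iff power2_eq_square)
next
  case False
  then obtain r s where rs: "a = ennreal r" "b = ennreal s" "0 \<le> r" "0 \<le> s"
    by (cases a; cases b) auto
  have "0 \<le> (l * r - s)\<^sup>2" by simp
  also have "\<dots> = (l * r\<^sup>2 + 1 / l * s\<^sup>2) * l - 2 * (r * s) * l"
    using assms by (simp add: power2_eq_square field_simps)
  finally have "2 * (r * s) * l \<le> (l * r\<^sup>2 + 1 / l * s\<^sup>2) * l" by simp
  then have "2 * (r * s) \<le> l * r\<^sup>2 + 1 / l * s\<^sup>2"
    using assms by (rule mult_right_le_imp_le)
  moreover have "0 \<le> r * s" using rs by simp
  ultimately have "r * s \<le> l * r\<^sup>2 + 1 / l * s\<^sup>2" by linarith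
  then show ?thesis using rs assms
    by (simp add: ennreal_mult[symmetric] ennreal_plus[symmetric] ennreal_power del: ennreal_plus)
qed

lemma ennreal_mult_le_squares: "a * b \<le> a\<^sup>2 + (b\<^sup>2 :: ennreal)"
  using ennreal_mult_le_weighted[of 1 a b] by simp

lemma nn_integral_lborel_translate:
  fixes f :: "'a::euclidean_space \<Rightarrow> ennreal"
  assumes [measurable]: "f \<in> borel_measurable borel"
  shows "(\<integral>+x. f (c + x)) = (\<integral>+x. f x)"
proof -
  have "(\<integral>+x. f x) = (\<integral>\<^sup>+x. f x \<partial>distr lborel borel ((+) c))"
    by (simp add: lborel_distr_plus)
  also have "\<dots> = (\<integral>+x. f (c + x))"
    by (subst nn_integral_distr) auto
  finally show ?thesis by simp
qed

lemma nn_integral_lborel_scale: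
  fixes f :: "'a::euclidean_space \<Rightarrow> ennreal"
  assumes [measurable]: "f \<in> borel_measurable borel" and "c \<noteq> 0"
  shows "(\<integral>+x. f x) = ennreal (\<bar>c\<bar> ^ DIM('a)) * (\<integral>+x. f (c *\<^sub>R x))"
  by (subst lborel_affine[OF \<open>c \<noteq> 0\<close>, of 0])
    (simp add: nn_integral_density nn_integral_distr nn_integral_cmult)

lemma nn_integral_lborel_reflect:
  fixes f :: "'a::euclidean_space \<Rightarrow> ennreal"
  assumes [measurable]: "f \<in> borel_measurable borel"
  shows "(\<integral>+x. f (c - x)) = (\<integral>+x. f x)"
  using nn_integral_lborel_scale[of "\<lambda>x. f (c + x)" "-1"] nn_integral_lborel_translate[of f c]
  by simp

section \<open>An abstract bilinear summation lemma\<close>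

lemma nn_integral_inverse_square_tail:
  assumes "0 < a" "0 \<le> c"
  shows "(\<integral>+s. ennreal (c / s\<^sup>2) * indicator {s. a < \<bar>s\<bar>} s) \<le> ennreal (2 * c / a)"
proof -
  have half: "(\<integral>+s. ennreal (c / s\<^sup>2) * indicator {a..} s) = ennreal (c / a)"
  proof -
    have "(\<integral>+s. ennreal (c / s\<^sup>2) * indicator {a..} s) = ennreal (0 - (- c / a))"
    proof (rule nn_integral_FTC_atLeast)
      show "(\<lambda>s. c / s\<^sup>2) \<in> borel_measurable borel" by measurable
      show "((\<lambda>s. - c / s) has_real_derivative c / x\<^sup>2) (at x)" if "a \<le> x" for x
        using that assms by (auto intro!: derivative_eq_intros simp: power2_eq_square)
      show "((\<lambda>s. - c / s) \<longlongrightarrow> 0) at_top"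
        by (intro tendsto_divide_0[OF tendsto_const] filterlim_at_top_imp_at_infinity filterlim_ident)
    qed (use assms in auto)
    then show ?thesis by simp
  qed
  have "(\<integral>+s. ennreal (c / s\<^sup>2) * indicator {s. a < \<bar>s\<bar>} s)
     \<le> (\<integral>+s. ennreal (c / s\<^sup>2) * indicator {a..} s + ennreal (c / (0 - s)\<^sup>2) * indicator {a..} (0 - s))"
    by (intro nn_integral_mono) (auto split: split_indicator simp: abs_if split: if_splits)
  also have "\<dots> = ennreal (c / a) + (\<integral>+s. ennreal (c / (0 - s)\<^sup>2) * indicator {a..} (0 - s))"
    by (subst nn_integral_add) (auto simp: half)
  also have "(\<integral>+s. ennreal (c / (0 - s)\<^sup>2) * indicator {a..} (0 - s)) = ennreal (c / a)"
    using nn_integral_lborel_reflect[of "\<lambda>s. ennreal (c / s\<^sup>2) * indicator {a..} s" "0::real"] half by simp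
  finally show ?thesis using assms by (simp add: ennreal_plus[symmetric] del: ennreal_plus)
qed

text \<open>Schur's test for an even kernel, in additive form: \<open>M t * N s\<close> is split
  into squares and the kernel is then integrated in the remaining variable.\<close>

lemma nn_integral_convolution_form_le:
  fixes M N :: "real \<Rightarrow> ennreal" and k :: "real \<Rightarrow> ennreal"
  assumes [measurable]: "M \<in> borel_measurable borel" "N \<in> borel_measurable borel" "k \<in> borel_measurable borel"
    and sym: "\<And>s. k (- s) = k s" and k: "(\<integral>+s. k s) \<le> B"
  shows "(\<integral>+t. \<integral>+s. M t * N s * k (t - s))
    \<le> B * ((\<integral>+t. (M t)\<^sup>2) + (\<integral>+t. (N t)\<^sup>2))"
proof -
  have kt: "(\<integral>+s. k (t - s)) \<le> B" for t
    using nn_integral_lborel_reflect[of k t] k by simp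
  have ks: "(\<integral>+t. k (t - s)) \<le> B" for s
  proof -
    have "k (t - s) = k (s - t)" for t
      using sym[of "s - t"] by simp
    then show ?thesis using kt[of s] by simp
  qed
  have "(\<integral>+t. \<integral>+s. M t * N s * k (t - s))
     \<le> (\<integral>+t. \<integral>+s. (M t)\<^sup>2 * k (t - s) + (N s)\<^sup>2 * k (t - s))"
    unfolding distrib_right[symmetric]
    by (intro nn_integral_mono mult_right_mono ennreal_mult_le_squares) auto
  also have "\<dots> = (\<integral>+t. (M t)\<^sup>2 * (\<integral>+s. k (t - s))) + (\<integral>+t. \<integral>+s. (N s)\<^sup>2 * k (t - s))"
    by (simp add: nn_integral_add nn_integral_cmult)
  also have "(\<integral>+t. \<integral>+s. (N s)\<^sup>2 * k (t - s)) = (\<integral>+s. (N s)\<^sup>2 * (\<integral>+t. k (t - s)))"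
    by (subst lborel_pair.Fubini') (simp_all add: nn_integral_cmult)
  also have "(\<integral>+t. (M t)\<^sup>2 * (\<integral>+s. k (t - s))) + (\<integral>+s. (N s)\<^sup>2 * (\<integral>+t. k (t - s)))
     \<le> (\<integral>+t. (M t)\<^sup>2 * B) + (\<integral>+s. (N s)\<^sup>2 * B)"
    by (intro add_mono nn_integral_mono mult_left_mono kt ks) auto
  also have "\<dots> = B * ((\<integral>+t. (M t)\<^sup>2) + (\<integral>+t. (N t)\<^sup>2))"
    by (simp add: nn_integral_cmult distrib_left mult.commute[of _ B])
  finally show ?thesis .
qed

lemma nn_integral_rotate:
  fixes G :: "'a::euclidean_space \<times> 'b::euclidean_space \<times> 'c::euclidean_space \<Rightarrow> ennreal"
  assumes [measurable]: "G \<in> borel_measurable (borel \<Otimes>\<^sub>M borel \<Otimes>\<^sub>M borel)"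
  shows "(\<integral>+z. \<integral>+t. \<integral>+s. G (z, t, s)) = (\<integral>+t. \<integral>+s. \<integral>+z. G (z, t, s))"
proof -
  have "(\<integral>+z. \<integral>+t. \<integral>+s. G (z, t, s)) = (\<integral>+t. \<integral>+z. \<integral>+s. G (z, t, s))"
    by (rule lborel_pair.Fubini') measurable
  also have "\<dots> = (\<integral>+t. \<integral>+s. \<integral>+z. G (z, t, s))"
    by (intro nn_integral_cong lborel_pair.Fubini') measurable
  finally show ?thesis .
qed

lemma nn_integral_mult_nn_integral:
  assumes [measurable]: "f \<in> borel_measurable M" "g \<in> borel_measurable N"
  shows "(\<integral>\<^sup>+t. f t \<partial>M) * (\<integral>\<^sup>+s. g s \<partial>N) = (\<integral>\<^sup>+t. \<integral>\<^sup>+s. f t * g s \<partial>N \<partial>M)"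
  by (simp add: nn_integral_cmult nn_integral_multc)

lemma nn_integral_window_overlap:
  fixes t s h :: real
  assumes "0 < h"
  shows "(\<integral>+r. indicator {t..t + h} r * indicator {s..s + h} r) = ennreal (h - \<bar>t - s\<bar>)"
proof -
  have "(\<integral>+r. indicator {t..t + h} r * indicator {s..s + h} r) = (\<integral>+r. indicator {max t s..min t s + h} r)"
    by (intro nn_integral_cong) (auto split: split_indicator)
  also have "\<dots> = ennreal (h - \<bar>t - s\<bar>)"
    by (auto simp: emeasure_lborel_Icc_eq max_def min_def abs_if ennreal_neg intro!: arg_cong[where f=ennreal])
  finally show ?thesis .
qed

text \<open>The triangle \<open>h - |t - s|\<close>, cut off at 0 by \<open>ennreal\<close>, is the
  overlap of two windows of length \<open>h\<close>. A form localised to \<open>|t - s| < h\<close>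
  is thereby a superposition over \<open>r\<close> of products of one factor in \<open>E\<close> and
  one in \<open>F\<close>, to which Cauchy-Schwarz applies.\<close>

lemma nn_integral_window_pairing:
  fixes E F :: "real \<times> 'z::euclidean_space \<Rightarrow> ennreal" and h :: real
  assumes [measurable]: "E \<in> borel_measurable borel" "F \<in> borel_measurable borel" and h: "0 < h"
  shows "(\<integral>+r. \<integral>+z. (\<integral>+t. E (t, z) * indicator {t..t + h} r) * (\<integral>+s. F (s, z) * indicator {s..s + h} r))
    = (\<integral>+t. \<integral>+s. (\<integral>+z. E (t, z) * F (s, z)) * ennreal (h - \<bar>t - s\<bar>))"
    (is "?L = ?R")
proof -
  define W :: "real \<Rightarrow> real \<Rightarrow> ennreal" where "W = (\<lambda>t r. indicator {t..t + h} r)"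
  have W_ind: "indicator {t..t + h} r = W t r" for t r
    by (simp add: W_def)
  have W_eq: "W = (\<lambda>t r. if t \<le> r \<and> r \<le> t + h then 1 else 0)"
    unfolding W_def by (auto simp: fun_eq_iff split: split_indicator)
  have [measurable]: "(\<lambda>x. W (f x) (g x)) \<in> borel_measurable N" if [measurable]: "f \<in> borel_measurable N" "g \<in> borel_measurable N" for f g and N :: "'n measure"
    unfolding W_eq by measurable
  have "?L = (\<integral>+r. \<integral>+z. \<integral>+t. \<integral>+s. (E (t, z) * W t r) * (F (s, z) * W s r))"
    unfolding W_ind by (intro nn_integral_cong nn_integral_mult_nn_integral) measurable
  also have "\<dots> = (\<integral>+r. \<integral>+t. \<integral>+s. \<integral>+z. (E (t, z) * W t r) * (F (s, z) * W s r))"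
    by (intro nn_integral_cong nn_integral_rotate[where G="\<lambda>(z, t, s). (E (t, z) * W t _) * (F (s, z) * W s _)", simplified]) measurable
  also have "\<dots> = (\<integral>+r. \<integral>+t. \<integral>+s. (\<integral>+z. E (t, z) * F (s, z)) * (W t r * W s r))"
    by (intro nn_integral_cong, subst nn_integral_multc[symmetric]) (auto intro!: nn_integral_cong simp: mult_ac)
  also have "\<dots> = (\<integral>+t. \<integral>+s. \<integral>+r. (\<integral>+z. E (t, z) * F (s, z)) * (W t r * W s r))"
    by (rule nn_integral_rotate[where G="\<lambda>(r, t, s). (\<integral>+z. E (t, z) * F (s, z)) * (W t r * W s r)", simplified]) measurable
  also have "\<dots> = ?R"
    by (intro nn_integral_cong, subst nn_integral_cmult) (auto simp: W_def nn_integral_window_overlap[OF h])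
  finally show ?thesis .
qed

text \<open>Times with \<open>|t - s| > h / 2\<close> are left to dispersion, whose kernel has tail
  mass of order \<open>p * q / h\<close>. The other times are averaged over windows of length
  \<open>h\<close>, where \<open>E\<close> and \<open>F\<close> are separated: the kernel for
  \<open>E\<close> has bounded mass whatever \<open>p\<close> is, while that for \<open>F\<close> is
  confined to a window and has mass of order \<open>h / q^2\<close>. For \<open>h\<close> well
  between \<open>p * q\<close> and \<open>q^2\<close> both contributions are small; \<open>l\<close>
  weighs the two squares against each other.\<close>

lemma bilinear_pair_le:
  fixes E F :: "real \<times> 'z::euclidean_space \<Rightarrow> ennreal" and N M :: "real \<Rightarrow> ennreal" and h p q l :: real
  assumes [measurable]: "E \<in> borel_measurable borel" "F \<in> borel_measurable borel" "N \<in> borel_measurable borel" "M \<in> borel_measurable borel"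
    and pos: "0 < h" "0 < p" "0 < q" "0 < l"
    and EE_near: "\<And>t s. (\<integral>+z. E (t, z) * E (s, z)) \<le> N t * N s * ennreal (1 / p\<^sup>2)"
    and EE_far: "\<And>t s. t \<noteq> s \<Longrightarrow> (\<integral>+z. E (t, z) * E (s, z)) \<le> N t * N s * ennreal (p\<^sup>2 / (t - s)\<^sup>2)"
    and FF_near: "\<And>t s. (\<integral>+z. F (t, z) * F (s, z)) \<le> M t * M s * ennreal (1 / q\<^sup>2)"
    and EF_far: "\<And>t s. t \<noteq> s \<Longrightarrow> (\<integral>+z. E (t, z) * F (s, z)) \<le> N t * M s * ennreal (p * q / (t - s)\<^sup>2)"
  defines "a \<equiv> (\<integral>+t. (N t)\<^sup>2)" and "b \<equiv> (\<integral>+t. (M t)\<^sup>2)"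
  shows "(\<integral>+z. (\<integral>+t. E (t, z)) * (\<integral>+s. F (s, z)))
    \<le> ennreal (4 * p * q / h) * (a + b) + 2 * (ennreal (8 * l) * a + ennreal (4 * h / (l * q\<^sup>2)) * b)"
    (is "?I \<le> _")
proof -
  define bEF bEE bFF :: "real \<Rightarrow> real \<Rightarrow> ennreal"
    where "bEF = (\<lambda>t s. \<integral>+z. E (t, z) * F (s, z))"
      and "bEE = (\<lambda>t s. \<integral>+z. E (t, z) * E (s, z))"
      and "bFF = (\<lambda>t s. \<integral>+z. F (t, z) * F (s, z))"
  define X Y :: "real \<Rightarrow> 'z \<Rightarrow> ennreal"
    where "X = (\<lambda>r z. \<integral>+t. E (t, z) * indicator {t..t + h} r)"
      and "Y = (\<lambda>r z. \<integral>+t. F (t, z) * indicator {t..t + h} r)"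
  have ind: "indicator {t..t + h} r = (if t \<le> r \<and> r \<le> t + h then 1 else 0 :: ennreal)" for t r
    by (auto split: split_indicator)
  have [measurable]: "(\<lambda>x. X (f x) (g x)) \<in> borel_measurable K" "(\<lambda>x. Y (f x) (g x)) \<in> borel_measurable K"
    if [measurable]: "f \<in> borel_measurable K" "g \<in> borel_measurable K" for f g and K :: "'n measure"
    unfolding X_def Y_def ind by measurable
  have [measurable]: "(\<lambda>x. bEF (f x) (g x)) \<in> borel_measurable K" "(\<lambda>x. bEE (f x) (g x)) \<in> borel_measurable K" "(\<lambda>x. bFF (f x) (g x)) \<in> borel_measurable K"
    if [measurable]: "f \<in> borel_measurable K" "g \<in> borel_measurable K" for f g and K :: "'n measure"
    unfolding bEF_def bEE_def bFF_def by measurable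
  define far :: "real \<Rightarrow> ennreal" where "far = (\<lambda>s. ennreal (p * q / s\<^sup>2) * indicator {s. h / 2 < \<bar>s\<bar>} s)"
  \<comment> \<open>The better of the two bounds for \<open>E\<close> at each time difference; they
    cross at \<open>|t - s| = p^2\<close>, and each side contributes mass 2.\<close>
  define kE :: "real \<Rightarrow> ennreal" where "kE = (\<lambda>s. ennreal (1 / p\<^sup>2) * indicator {- p\<^sup>2..p\<^sup>2} s + ennreal (p\<^sup>2 / s\<^sup>2) * indicator {s. p\<^sup>2 < \<bar>s\<bar>} s)"
  define kF :: "real \<Rightarrow> ennreal" where "kF = (\<lambda>s. ennreal (1 / q\<^sup>2) * indicator {- h..h} s)"
  have [measurable]: "far \<in> borel_measurable borel" "kE \<in> borel_measurable borel" "kF \<in> borel_measurable borel"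
    unfolding far_def kE_def kF_def by measurable
  have far_mass: "(\<integral>+s. far s) \<le> ennreal (4 * p * q / h)"
    using nn_integral_inverse_square_tail[of "h / 2" "p * q"] pos unfolding far_def by (simp add: algebra_simps)
  have kE_mass: "(\<integral>+s. kE s) \<le> ennreal 4"
  proof -
    have "(\<integral>+s. kE s) = ennreal (1 / p\<^sup>2) * ennreal (2 * p\<^sup>2) + (\<integral>+s. ennreal (p\<^sup>2 / s\<^sup>2) * indicator {s. p\<^sup>2 < \<bar>s\<bar>} s)"
      unfolding kE_def using pos by (subst nn_integral_add) (auto simp: nn_integral_cmult)
    also have "\<dots> \<le> ennreal 2 + ennreal (2 * p\<^sup>2 / p\<^sup>2)"
      using pos by (intro add_mono nn_integral_inverse_square_tail) (auto simp: ennreal_mult[symmetric])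
    also have "\<dots> = ennreal 4" using pos by (simp add: ennreal_plus[symmetric] del: ennreal_plus)
    finally show ?thesis .
  qed
  have kF_mass: "(\<integral>+s. kF s) \<le> ennreal (2 * h / q\<^sup>2)"
    unfolding kF_def using pos by (simp add: nn_integral_cmult ennreal_mult[symmetric])
  have near_E: "bEE t s * ennreal (h - \<bar>t - s\<bar>) \<le> ennreal h * (N t * N s * kE (t - s))" for t s
  proof -
    have "bEE t s \<le> N t * N s * kE (t - s)"
    proof (cases "\<bar>t - s\<bar> \<le> p\<^sup>2")
      case True
      then show ?thesis using EE_near[of t s] unfolding bEE_def kE_def by (auto split: split_indicator)
    next
      case False
      then have "t \<noteq> s" using pos by auto
      from EE_far[OF this] False show ?thesis unfolding bEE_def kE_def by (auto split: split_indicator)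
    qed
    then show ?thesis
      by (subst mult.commute) (intro mult_mono ennreal_leI, auto)
  qed
  \<comment> \<open>Outside \<open>|t - s| <= h\<close> the triangle vanishes, so the bound without
    decay is only ever integrated over an interval of length \<open>2 * h\<close>.\<close>
  have near_F: "bFF t s * ennreal (h - \<bar>t - s\<bar>) \<le> ennreal h * (M t * M s * kF (t - s))" for t s
  proof (cases "\<bar>t - s\<bar> \<le> h")
    case True
    then have "bFF t s \<le> M t * M s * kF (t - s)"
      using FF_near[of t s] unfolding bFF_def kF_def by (auto split: split_indicator)
    then show ?thesis
      by (subst mult.commute) (intro mult_mono ennreal_leI, auto)
  qed (simp add: ennreal_neg)
  have sq_E: "(\<integral>+r. \<integral>+z. (X r z)\<^sup>2) \<le> ennreal h * (ennreal 8 * a)"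
  proof -
    have "(\<integral>+r. \<integral>+z. (X r z)\<^sup>2) = (\<integral>+t. \<integral>+s. bEE t s * ennreal (h - \<bar>t - s\<bar>))"
      unfolding power2_eq_square X_def bEE_def using pos by (intro nn_integral_window_pairing) auto
    also have "\<dots> \<le> (\<integral>+t. \<integral>+s. ennreal h * (N t * N s * kE (t - s)))"
      by (intro nn_integral_mono near_E)
    also have "\<dots> = ennreal h * (\<integral>+t. \<integral>+s. N t * N s * kE (t - s))"
      by (simp add: nn_integral_cmult)
    also have "\<dots> \<le> ennreal h * (ennreal 4 * (a + a))"
      unfolding a_def by (intro mult_left_mono nn_integral_convolution_form_le kE_mass) (auto simp: kE_def split: split_indicator)
    also have "\<dots> = ennreal h * (ennreal 8 * a)"
      by (simp add: mult_2[symmetric] mult.assoc[symmetric])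
    finally show ?thesis .
  qed
  have sq_F: "(\<integral>+r. \<integral>+z. (Y r z)\<^sup>2) \<le> ennreal h * (ennreal (4 * h / q\<^sup>2) * b)"
  proof -
    have "(\<integral>+r. \<integral>+z. (Y r z)\<^sup>2) = (\<integral>+t. \<integral>+s. bFF t s * ennreal (h - \<bar>t - s\<bar>))"
      unfolding power2_eq_square Y_def bFF_def using pos by (intro nn_integral_window_pairing) auto
    also have "\<dots> \<le> (\<integral>+t. \<integral>+s. ennreal h * (M t * M s * kF (t - s)))"
      by (intro nn_integral_mono near_F)
    also have "\<dots> = ennreal h * (\<integral>+t. \<integral>+s. M t * M s * kF (t - s))"
      by (simp add: nn_integral_cmult)
    also have "\<dots> \<le> ennreal h * (ennreal (2 * h / q\<^sup>2) * (b + b))"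
      unfolding b_def by (intro mult_left_mono nn_integral_convolution_form_le kF_mass) (auto simp: kF_def split: split_indicator)
    also have "ennreal (2 * h / q\<^sup>2) * (b + b) = (ennreal (2 * h / q\<^sup>2) + ennreal (2 * h / q\<^sup>2)) * b"
      by (simp add: distrib_left distrib_right)
    also have "ennreal (2 * h / q\<^sup>2) + ennreal (2 * h / q\<^sup>2) = ennreal (4 * h / q\<^sup>2)"
      using pos by (subst ennreal_plus[symmetric]) auto
    finally show ?thesis .
  qed
  have near: "(\<integral>+t. \<integral>+s. bEF t s * ennreal (h - \<bar>t - s\<bar>))
     \<le> ennreal h * (ennreal (8 * l) * a + ennreal (4 * h / (l * q\<^sup>2)) * b)"
  proof -
    have "(\<integral>+t. \<integral>+s. bEF t s * ennreal (h - \<bar>t - s\<bar>)) = (\<integral>+r. \<integral>+z. X r z * Y r z)"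
      unfolding X_def Y_def bEF_def using pos by (intro nn_integral_window_pairing[symmetric]) auto
    also have "\<dots> \<le> (\<integral>+r. \<integral>+z. ennreal l * (X r z)\<^sup>2 + ennreal (1 / l) * (Y r z)\<^sup>2)"
      using pos by (intro nn_integral_mono ennreal_mult_le_weighted)
    also have "\<dots> = ennreal l * (\<integral>+r. \<integral>+z. (X r z)\<^sup>2) + ennreal (1 / l) * (\<integral>+r. \<integral>+z. (Y r z)\<^sup>2)"
      by (simp add: nn_integral_add nn_integral_cmult)
    also have "\<dots> \<le> ennreal l * (ennreal h * (ennreal 8 * a)) + ennreal (1 / l) * (ennreal h * (ennreal (4 * h / q\<^sup>2) * b))"
      by (intro add_mono mult_left_mono sq_E sq_F) auto
    also have "\<dots> = ennreal h * ((ennreal 8 * ennreal l) * a + (ennreal (1 / l) * ennreal (4 * h / q\<^sup>2)) * b)"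
      by (simp add: distrib_left mult_ac)
    also have "ennreal 8 * ennreal l = ennreal (8 * l)" using pos by (subst ennreal_mult) auto
    also have "ennreal (1 / l) * ennreal (4 * h / q\<^sup>2) = ennreal (4 * h / (l * q\<^sup>2))"
      using pos by (subst ennreal_mult[symmetric]) (auto simp: field_simps)
    finally show ?thesis .
  qed
  have far_le: "(\<integral>+t. \<integral>+s. N t * M s * far (t - s)) \<le> ennreal (4 * p * q / h) * (a + b)"
    unfolding a_def b_def by (intro nn_integral_convolution_form_le far_mass) (auto simp: far_def split: split_indicator)
  \<comment> \<open>The triangle is at least \<open>h / 2\<close> for
    \<open>|t - s| <= h / 2\<close>, hence the factor 2; the remaining times fall under
    \<open>far\<close>.\<close>
  have split: "ennreal h * bEF t s \<le> 2 * (bEF t s * ennreal (h - \<bar>t - s\<bar>)) + ennreal h * (N t * M s * far (t - s))" for t s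
  proof (cases "\<bar>t - s\<bar> \<le> h / 2")
    case True
    then have "ennreal h \<le> 2 * ennreal (h - \<bar>t - s\<bar>)"
      by (simp add: ennreal_mult'[symmetric] ennreal_numeral[symmetric] ennreal_leI del: ennreal_numeral)
    then have "ennreal h * bEF t s \<le> (2 * ennreal (h - \<bar>t - s\<bar>)) * bEF t s" by (rule mult_right_mono) simp
    also have "\<dots> = 2 * (bEF t s * ennreal (h - \<bar>t - s\<bar>))" by (simp add: mult_ac)
    finally show ?thesis by (rule order_trans) simp
  next
    case False
    then have "t \<noteq> s" using pos by auto
    from EF_far[OF this] False have "bEF t s \<le> N t * M s * far (t - s)"
      unfolding bEF_def far_def by (auto split: split_indicator)
    then have "ennreal h * bEF t s \<le> ennreal h * (N t * M s * far (t - s))" by (rule mult_left_mono) simp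
    then show ?thesis by (rule order_trans) simp
  qed
  have I: "?I = (\<integral>+t. \<integral>+s. bEF t s)"
  proof -
    have "?I = (\<integral>+z. \<integral>+t. \<integral>+s. E (t, z) * F (s, z))"
      by (intro nn_integral_cong nn_integral_mult_nn_integral) measurable
    also have "\<dots> = (\<integral>+t. \<integral>+s. bEF t s)" unfolding bEF_def
      by (rule nn_integral_rotate[where G="\<lambda>(z, t, s). E (t, z) * F (s, z)", simplified]) measurable
    finally show ?thesis .
  qed
  let ?near = "\<integral>+t. \<integral>+s. bEF t s * ennreal (h - \<bar>t - s\<bar>)"
  let ?far = "\<integral>+t. \<integral>+s. N t * M s * far (t - s)"
  have "ennreal h * ?I = (\<integral>+t. \<integral>+s. ennreal h * bEF t s)"
    unfolding I by (simp add: nn_integral_cmult)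
  also have "\<dots> \<le> (\<integral>+t. \<integral>+s. 2 * (bEF t s * ennreal (h - \<bar>t - s\<bar>)) + ennreal h * (N t * M s * far (t - s)))"
    by (intro nn_integral_mono split)
  also have "\<dots> = 2 * ?near + ennreal h * ?far"
    by (simp add: nn_integral_add nn_integral_cmult)
  also have "\<dots> \<le> 2 * (ennreal h * (ennreal (8 * l) * a + ennreal (4 * h / (l * q\<^sup>2)) * b)) + ennreal h * (ennreal (4 * p * q / h) * (a + b))"
    by (intro add_mono mult_left_mono near far_le) auto
  also have "\<dots> = ennreal h * (ennreal (4 * p * q / h) * (a + b) + 2 * (ennreal (8 * l) * a + ennreal (4 * h / (l * q\<^sup>2)) * b))"
    by (simp add: distrib_left mult_ac add_ac)
  finally show ?thesis
    using pos by (subst (asm) ennreal_mult_le_mult_iff) auto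
qed

lemma sum_half_power_abs_diff_le:
  fixes I :: "int set"
  assumes "finite I"
  shows "(\<Sum>m\<in>I. (1 / 2 :: real) ^ nat \<bar>n - m\<bar>) \<le> 4"
proof -
  have half: "(\<Sum>m\<in>J. (1 / 2 :: real) ^ nat \<bar>n - m\<bar>) \<le> 2"
    if J: "finite J" "inj_on (\<lambda>m. nat \<bar>n - m\<bar>) J" for J :: "int set"
  proof -
    have "(\<Sum>m\<in>J. (1 / 2 :: real) ^ nat \<bar>n - m\<bar>) = (\<Sum>k\<in>(\<lambda>m. nat \<bar>n - m\<bar>) ` J. (1 / 2) ^ k)"
      by (simp add: sum.reindex[OF J(2)])
    also have "\<dots> \<le> (\<Sum>k. (1 / 2) ^ k)"
      by (rule sum_le_suminf) (use J in \<open>auto intro: summable_geometric\<close>)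
    also have "\<dots> = 2" by (subst suminf_geometric) auto
    finally show ?thesis .
  qed
  have "(\<Sum>m\<in>I. (1 / 2 :: real) ^ nat \<bar>n - m\<bar>) = (\<Sum>m\<in>I \<inter> {..n}. (1 / 2) ^ nat \<bar>n - m\<bar>) + (\<Sum>m\<in>I \<inter> {n<..}. (1 / 2) ^ nat \<bar>n - m\<bar>)"
    using assms by (subst sum.union_disjoint[symmetric]) (auto intro!: sum.cong)
  also have "\<dots> \<le> 2 + 2"
    using assms by (intro add_mono half) (auto simp: inj_on_def)
  finally show ?thesis by simp
qed

text \<open>
  The bilinear interpolation step of Keel and Tao at the endpoint: the two bounds alone give a kernel without decay in
  \<open>\<bar>n - m\<bar>\<close>; the decay comes from localising in time, for \<open>n \<le> m\<close>, at the scale \<open>4 ^ (n + 2 * m)\<close>,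
  which lies between the critical scales \<open>8 ^ (n + m)\<close> and \<open>8 ^ (2 * m)\<close>.
\<close>

lemma bilinear_sum_le:
  fixes E :: "int \<Rightarrow> real \<times> 'z::euclidean_space \<Rightarrow> ennreal" and N :: "int \<Rightarrow> real \<Rightarrow> ennreal" and w :: "int \<Rightarrow> real"
  assumes [measurable]: "\<And>n. E n \<in> borel_measurable borel" "\<And>n. N n \<in> borel_measurable borel" and I: "finite I"
    and w: "\<And>n. w n = (2 powi n) ^ 3"
    and near: "\<And>n m t s. (\<integral>+z. E n (t, z) * E m (s, z)) \<le> N n t * N m s * ennreal (1 / (w n * w m))"
    and far: "\<And>n m t s. t \<noteq> s \<Longrightarrow> (\<integral>+z. E n (t, z) * E m (s, z)) \<le> N n t * N m s * ennreal (w n * w m / (t - s)\<^sup>2)"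
  shows "(\<integral>+z. (\<Sum>n\<in>I. \<integral>+t. E n (t, z))\<^sup>2) \<le> 224 * (\<Sum>n\<in>I. \<integral>+t. (N n t)\<^sup>2)"
proof -
  define a where "a = (\<lambda>n. \<integral>+t. (N n t)\<^sup>2)"
  define J where "J = (\<lambda>n m. \<integral>+z. (\<integral>+t. E n (t, z)) * (\<integral>+s. E m (s, z)))"
  define g where "g = (\<lambda>n m :: int. ennreal (28 * (1 / 2) ^ nat \<bar>n - m\<bar>))"
  have le: "J n m \<le> g n m * (a n + a m)" if "n \<le> m" for n m
  proof -
    define x y :: real where "x = 2 powi n" and "y = 2 powi m"
    have xy: "0 < x" "0 < y" by (auto simp: x_def y_def)
    have wx: "w n = x ^ 3" "w m = y ^ 3" by (auto simp: w x_def y_def)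
    have quot: "x / y = (1 / 2) ^ nat \<bar>n - m\<bar>"
    proof -
      have "x / y = 2 powi (n - m)" by (simp add: x_def y_def power_int_diff)
      also have "\<dots> = (1 / 2) ^ nat \<bar>n - m\<bar>"
        using that by (simp add: power_int_def power_inverse field_simps)
      finally show ?thesis .
    qed
    have e1: "4 * x ^ 3 * y ^ 3 / (x\<^sup>2 * y ^ 4) = 4 * (x / y)"
      using xy by (simp add: field_simps power_numeral_reduce)
    have e2: "4 * (x\<^sup>2 * y ^ 4) / (x / y * (y ^ 3)\<^sup>2) = 4 * (x / y)"
      using xy by (simp add: field_simps power_numeral_reduce)
    \<comment> \<open>Here \<open>p = x^3\<close>, \<open>q = y^3\<close>,
      \<open>h = x^2 * y^4\<close> and \<open>l = x / y\<close>. Balancing \<open>p * q / h\<close>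
      against the square root of \<open>h / q^2\<close> gives \<open>h = p^(2/3) * q^(4/3)\<close>;
      levels spaced by the factor 8 make this a monomial in \<open>x\<close> and \<open>y\<close>,
      and every term is then a multiple of \<open>x / y\<close>.\<close>
    have "J n m \<le> ennreal (4 * x ^ 3 * y ^ 3 / (x\<^sup>2 * y ^ 4)) * (a n + a m)
       + 2 * (ennreal (8 * (x / y)) * a n + ennreal (4 * (x\<^sup>2 * y ^ 4) / (x / y * (y ^ 3)\<^sup>2)) * a m)"
      unfolding J_def a_def
    proof (rule bilinear_pair_le)
      show "(\<integral>+z. E n (t, z) * E n (s, z)) \<le> N n t * N n s * ennreal (1 / (x ^ 3)\<^sup>2)" for t s
        using near[of n t n s] by (simp add: wx power2_eq_square)
      show "(\<integral>+z. E m (t, z) * E m (s, z)) \<le> N m t * N m s * ennreal (1 / (y ^ 3)\<^sup>2)" for t s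
        using near[of m t m s] by (simp add: wx power2_eq_square)
      show "(\<integral>+z. E n (t, z) * E n (s, z)) \<le> N n t * N n s * ennreal ((x ^ 3)\<^sup>2 / (t - s)\<^sup>2)" if "t \<noteq> s" for t s
        using far[of t s n n] that by (simp add: wx power2_eq_square)
      show "(\<integral>+z. E n (t, z) * E m (s, z)) \<le> N n t * N m s * ennreal (x ^ 3 * y ^ 3 / (t - s)\<^sup>2)" if "t \<noteq> s" for t s
        using far[of t s n m] that by (simp add: wx)
    qed (use xy in auto)
    also have "\<dots> \<le> ennreal (4 * (x / y)) * (a n + a m) + 2 * (ennreal (8 * (x / y)) * a n + ennreal (8 * (x / y)) * a m)"
      unfolding e1 e2 using xy by (intro add_mono mult_left_mono mult_right_mono ennreal_leI) auto
    also have "\<dots> = (ennreal (4 * (x / y)) + 2 * ennreal (8 * (x / y))) * (a n + a m)"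
      by (simp add: distrib_left distrib_right mult.assoc)
    \<comment> \<open>The left-hand side is \<open>20 * (x / y)\<close>, so 28 leaves some
      room.\<close>
    also have "ennreal (4 * (x / y)) + 2 * ennreal (8 * (x / y)) \<le> g n m"
      unfolding g_def quot[symmetric] mult_2 using xy by (subst ennreal_plus[symmetric], simp, simp)+ (auto intro!: ennreal_leI divide_right_mono)
    finally show ?thesis by (simp add: mult_right_mono)
  qed
  have Jg: "J n m \<le> g n m * (a n + a m)" for n m
  proof (cases "n \<le> m")
    case False
    then have "J m n \<le> g m n * (a m + a n)" by (intro le) simp
    moreover have "J m n = J n m" by (simp add: J_def mult.commute)
    moreover have "g m n = g n m" by (simp add: g_def abs_minus_commute)
    ultimately show ?thesis by (simp add: add.commute)
  qed (rule le)
  have "(\<integral>+z. (\<Sum>n\<in>I. \<integral>+t. E n (t, z))\<^sup>2) = (\<Sum>n\<in>I. \<Sum>m\<in>I. J n m)"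
    unfolding J_def power2_eq_square sum_product by (simp add: nn_integral_sum)
  also have "\<dots> \<le> (\<Sum>n\<in>I. \<Sum>m\<in>I. g n m * a n + g n m * a m)"
    using Jg by (intro sum_mono) (simp add: distrib_left)
  also have "\<dots> = (\<Sum>n\<in>I. \<Sum>m\<in>I. g n m * a n) + (\<Sum>n\<in>I. \<Sum>m\<in>I. g n m * a m)"
    by (simp add: sum.distrib)
  also have "(\<Sum>n\<in>I. \<Sum>m\<in>I. g n m * a m) = (\<Sum>n\<in>I. \<Sum>m\<in>I. g n m * a n)"
    by (subst sum.swap) (simp add: g_def abs_minus_commute)
  also have "(\<Sum>n\<in>I. \<Sum>m\<in>I. g n m * a n) = (\<Sum>n\<in>I. (\<Sum>m\<in>I. g n m) * a n)"
    by (simp add: sum_distrib_right)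
  \<comment> \<open>Each row of \<open>g\<close> sums to at most \<open>28 * 4 = 112\<close>; the
    symmetric halves with \<open>a n\<close> and \<open>a m\<close> double this to 224.\<close>
  also have "(\<Sum>n\<in>I. (\<Sum>m\<in>I. g n m) * a n) + (\<Sum>n\<in>I. (\<Sum>m\<in>I. g n m) * a n) \<le> (\<Sum>n\<in>I. ennreal 112 * a n) + (\<Sum>n\<in>I. ennreal 112 * a n)"
  proof -
    have "(\<Sum>m\<in>I. g n m) \<le> ennreal 112" for n
      using sum_half_power_abs_diff_le[OF I, of n] unfolding g_def
      by (subst sum_ennreal, simp, intro ennreal_leI) (simp add: sum_distrib_left[symmetric])
    then show ?thesis by (intro add_mono sum_mono mult_right_mono) auto
  qed
  also have "\<dots> = (ennreal 112 + ennreal 112) * (\<Sum>n\<in>I. a n)"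
    by (simp only: sum_distrib_left distrib_right sum.distrib)
  also have "ennreal 112 + ennreal 112 = 224" by simp
  finally show ?thesis unfolding a_def .
qed

section \<open>The Fourier transform of integrable functions\<close>

definition gauss :: "'a::euclidean_space \<Rightarrow> real" where
  "gauss v = exp (- (norm v)\<^sup>2 / 2)"

text \<open>The integral of \<open>gauss\<close>, that is (2 pi)^(d/2). Its square is the sharp
  Plancherel constant for the unnormalised transform \<open>ft\<close>.\<close>

definition gauss_mass :: "'a::euclidean_space itself \<Rightarrow> real" where
  "gauss_mass _ = sqrt (2 * pi) ^ DIM('a)"

definition ft :: "('a::euclidean_space \<Rightarrow> complex) \<Rightarrow> 'a \<Rightarrow> complex" where
  "ft F v = (\<integral>y. cis (v \<bullet> y) * F y \<partial>lborel)"

lemma gauss_bounds: "0 \<le> gauss v" "0 < gauss v" "gauss v \<le> 1"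
  by (auto simp: gauss_def)

lemma gauss_mass_ge_1: "1 \<le> gauss_mass TYPE('a::euclidean_space)"
  unfolding gauss_mass_def using pi_gt3 by (intro one_le_power real_le_rsqrt) simp

lemma measurable_gauss [measurable]: "(gauss :: 'a::euclidean_space \<Rightarrow> real) \<in> borel_measurable borel"
  unfolding gauss_def[abs_def] by measurable

lemma measurable_cis [measurable]: "cis \<in> borel_measurable borel"
  by (intro borel_measurable_continuous_onI continuous_intros)

lemma measurable_cnj [measurable]: "cnj \<in> borel_measurable borel"
  by (intro borel_measurable_continuous_onI continuous_intros)

lemma measurable_fst_borel [measurable]: "fst \<in> borel_measurable (borel :: ('a::topological_space \<times> 'b::topological_space) measure)"
  and measurable_snd_borel [measurable]: "snd \<in> borel_measurable (borel :: ('a \<times> 'b) measure)"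
  by (intro borel_measurable_continuous_onI continuous_intros)+

lemma gauss_fourier_real:
  "has_bochner_integral lborel (\<lambda>x. complex_of_real (exp (- x\<^sup>2 / 2)) * cis (x * w)) (complex_of_real (sqrt (2 * pi) * exp (- w\<^sup>2 / 2)))"
proof -
  have eq: "complex_of_real (exp (- x\<^sup>2 / 2)) * cis (x * w) = complex_of_real (sqrt (2 * pi)) * (std_normal_density x *\<^sub>R iexp (w * x))" for x
    by (simp add: std_normal_density_def cis_conv_exp scaleR_conv_of_real mult_ac del: of_real_mult)
  have "integrable lborel (\<lambda>x. std_normal_density x *\<^sub>R iexp (w * x))"
  proof (rule Bochner_Integration.integrable_bound)
    show "integrable lborel std_normal_density" by simp
  qed (auto simp: normal_density_nonneg norm_mult)
  moreover have "(\<integral>x. std_normal_density x *\<^sub>R iexp (w * x) \<partial>lborel) = complex_of_real (exp (- w\<^sup>2 / 2))"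
    using fun_cong[OF char_std_normal_distribution, of w] unfolding char_def
    by (subst (asm) integral_density) (auto simp: normal_density_nonneg)
  ultimately have "has_bochner_integral lborel (\<lambda>x. std_normal_density x *\<^sub>R iexp (w * x)) (complex_of_real (exp (- w\<^sup>2 / 2)))"
    by (simp add: has_bochner_integral_iff)
  from has_bochner_integral_mult_right[where c="complex_of_real (sqrt (2 * pi))", OF this] show ?thesis
    unfolding eq by simp
qed

text \<open>Gaussian and character both factor over the coordinates, so the one-dimensional
  characteristic function of the normal law suffices.\<close>

lemma gauss_fourier:
  fixes w :: "'a::euclidean_space"
  shows "has_bochner_integral lborel (\<lambda>v. complex_of_real (gauss v) * cis (v \<bullet> w)) (complex_of_real (gauss_mass TYPE('a) * gauss w))"
proof -
  interpret product_sigma_finite "\<lambda>b::'a. lborel :: real measure" ..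
  let ?f = "\<lambda>b x. complex_of_real (exp (- x\<^sup>2 / 2)) * cis (x * (w \<bullet> b))"
  have prod: "complex_of_real (gauss v) * cis (v \<bullet> w) = (\<Prod>b\<in>Basis. ?f b (v \<bullet> b))" for v :: 'a
  proof -
    have "complex_of_real (gauss v) * cis (v \<bullet> w) = exp (\<Sum>b\<in>Basis. complex_of_real (- (v \<bullet> b)\<^sup>2 / 2) + \<i> * complex_of_real ((v \<bullet> b) * (w \<bullet> b)))"
      by (simp add: gauss_def cis_conv_exp exp_add[symmetric] euclidean_inner[of v w] norm_eq_sqrt_inner euclidean_inner[of v v] sum.distrib
        sum_distrib_left sum_negf sum_divide_distrib power2_eq_square exp_of_real[symmetric] inner_ge_zero sum_nonneg sum_subtractf)
    also have "\<dots> = (\<Prod>b\<in>Basis. ?f b (v \<bullet> b))"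
      by (simp add: exp_sum cis_conv_exp exp_of_real[symmetric] mult_exp_exp)
    finally show ?thesis .
  qed
  have int: "integrable lborel (?f b)" "(\<integral>x. ?f b x \<partial>lborel) = complex_of_real (sqrt (2 * pi) * exp (- (w \<bullet> b)\<^sup>2 / 2))" for b
    using gauss_fourier_real[of "w \<bullet> b"] by (auto simp: has_bochner_integral_iff)
  have 1: "integrable lborel (\<lambda>v::'a. \<Prod>b\<in>Basis. ?f b (v \<bullet> b))"
    by (subst lborel_eq, subst integrable_distr_eq) (auto intro!: product_integrable_prod simp: int(1)[simplified])
  have 2: "(\<integral>v. (\<Prod>b\<in>Basis. ?f b ((v::'a) \<bullet> b)) \<partial>lborel) = (\<Prod>b\<in>Basis. complex_of_real (sqrt (2 * pi) * exp (- (w \<bullet> b)\<^sup>2 / 2)))"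
  proof -
    have "(\<integral>v. (\<Prod>b\<in>Basis. ?f b ((v::'a) \<bullet> b)) \<partial>lborel) = (\<integral>x. (\<Prod>b\<in>Basis. ?f b (x b)) \<partial>(\<Pi>\<^sub>M b\<in>(Basis::'a set). lborel))"
      by (subst lborel_eq, subst integral_distr) auto
    also have "\<dots> = (\<Prod>b\<in>Basis. (\<integral>x. ?f b x \<partial>lborel))"
      by (rule product_integral_prod) (use int(1) in auto)
    finally show ?thesis unfolding int(2) .
  qed
  have "(\<Prod>b\<in>Basis. sqrt (2 * pi) * exp (- (w \<bullet> b)\<^sup>2 / 2)) = gauss_mass TYPE('a) * gauss w"
    by (simp add: prod.distrib gauss_mass_def gauss_def exp_sum[symmetric] norm_eq_sqrt_inner euclidean_inner[of w w] sum_nonneg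
      sum_negf sum_divide_distrib power2_eq_square)
  then have "(\<Prod>b\<in>Basis. complex_of_real (sqrt (2 * pi) * exp (- (w \<bullet> b)\<^sup>2 / 2))) = complex_of_real (gauss_mass TYPE('a) * gauss w)"
    by (simp only: of_real_prod[symmetric])
  with 1 2 show ?thesis unfolding prod has_bochner_integral_iff by simp
qed

lemma integrable_gauss: "integrable lborel (gauss :: 'a::euclidean_space \<Rightarrow> real)"
proof -
  have "integrable lborel (\<lambda>v::'a. complex_of_real (gauss v))"
    using gauss_fourier[of "0::'a"] by (simp add: has_bochner_integral_iff)
  from integrable_Re[OF this] show ?thesis by simp
qed

lemma nn_integral_gauss: "(\<integral>+v. ennreal (gauss (v::'a::euclidean_space))) = ennreal (gauss_mass TYPE('a))"
proof -
  have "complex_of_real (\<integral>v. gauss (v::'a) \<partial>lborel) = complex_of_real (gauss_mass TYPE('a))"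
    using gauss_fourier[of "0::'a"] by (simp add: has_bochner_integral_iff gauss_def)
  then have "(\<integral>v. gauss (v::'a) \<partial>lborel) = gauss_mass TYPE('a)" using of_real_eq_iff by blast
  then show ?thesis
    by (subst nn_integral_eq_integral) (auto simp: integrable_gauss gauss_bounds)
qed

lemma norm_integral_le_nn_integral:
  fixes f :: "'a \<Rightarrow> 'b::{banach, second_countable_topology}"
  shows "ennreal (norm (integral\<^sup>L M f)) \<le> (\<integral>\<^sup>+x. ennreal (norm (f x)) \<partial>M)"
  by (cases "integrable M f") (auto simp: not_integrable_integral_eq intro: integral_norm_bound_ennreal)

lemma integrable_prod_mult:
  fixes f :: "'a::euclidean_space \<Rightarrow> complex" and g :: "'b::euclidean_space \<Rightarrow> complex"
  assumes "integrable lborel f" "integrable lborel g"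
  shows "integrable (lborel \<Otimes>\<^sub>M lborel) (\<lambda>(x, y). f x * g y)"
proof (rule lborel_pair.Fubini_integrable)
  have [measurable]: "f \<in> borel_measurable borel" "g \<in> borel_measurable borel" using assms by auto
  show "(\<lambda>(x, y). f x * g y) \<in> borel_measurable (lborel \<Otimes>\<^sub>M lborel)" by measurable
qed (use assms in \<open>auto simp: norm_mult\<close>)

text \<open>Write the squared modulus as a double integral and carry out the Gaussian integral in
  \<open>s\<close> first; the weight makes Fubini legitimate for any integrable \<open>F\<close>. As
  the weight flattens, the kernel on the right concentrates on the diagonal, so this one identity
  serves for both directions of Plancherel.\<close>

lemma gauss_weighted_ft:
  fixes F :: "'a::euclidean_space \<Rightarrow> complex"
  assumes F: "integrable lborel F"
  shows "complex_of_real (\<integral>s. gauss s * (cmod (ft F (e *\<^sub>R s)))\<^sup>2 \<partial>lborel)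
    = complex_of_real (gauss_mass TYPE('a)) * (\<integral>(y, y'). F y * cnj (F y') * complex_of_real (gauss (e *\<^sub>R (y - y'))) \<partial>(lborel \<Otimes>\<^sub>M lborel))"
    and "integrable lborel (\<lambda>s. gauss s * (cmod (ft F (e *\<^sub>R s)))\<^sup>2)"
proof -
  have [measurable]: "F \<in> borel_measurable borel" using F by auto
  define P where "P = (\<lambda>p::'a \<times> 'a. F (fst p) * cnj (F (snd p)))"
  have [measurable]: "P \<in> borel_measurable borel" unfolding P_def borel_prod[symmetric] by measurable
  have P: "integrable lborel P"
    using integrable_prod_mult[OF F, of "\<lambda>y. cnj (F y)"] F unfolding P_def lborel_prod by (simp add: case_prod_beta')
  have sq: "complex_of_real ((cmod (ft F v))\<^sup>2) = (\<integral>p. cis (v \<bullet> (fst p - snd p)) * P p \<partial>lborel)" for v :: 'a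
  proof -
    have cis_diff: "cis (v \<bullet> (y - y')) = cis (v \<bullet> y) * cnj (cis (v \<bullet> y'))" for y y'
      by (simp add: cis_cnj cis_mult inner_diff_right)
    have i1: "integrable lborel (\<lambda>y. cis (v \<bullet> y) * F y)"
      by (rule Bochner_Integration.integrable_bound[OF F]) (auto simp: norm_mult)
    have i2: "integrable lborel (\<lambda>y. cnj (cis (v \<bullet> y) * F y))"
      using i1 by (rule integrable_cnj)
    have "complex_of_real ((cmod (ft F v))\<^sup>2) = ft F v * cnj (ft F v)"
      by (rule complex_norm_square)
    also have "\<dots> = (\<integral>y. \<integral>y'. (cis (v \<bullet> y) * F y) * cnj (cis (v \<bullet> y') * F y') \<partial>lborel \<partial>lborel)"
      using i1 i2 unfolding ft_def by (simp add: integral_cnj del: complex_cnj_mult cis_cnj)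
    also have "\<dots> = (\<integral>p. (\<lambda>(y, y'). (cis (v \<bullet> y) * F y) * cnj (cis (v \<bullet> y') * F y')) p \<partial>(lborel \<Otimes>\<^sub>M lborel))"
      by (subst lborel_pair.integral_fst'[symmetric, OF integrable_prod_mult[OF i1 i2]]) simp
    also have "\<dots> = (\<integral>p. cis (v \<bullet> (fst p - snd p)) * P p \<partial>lborel)"
      unfolding lborel_prod
by (intro Bochner_Integration.integral_cong) (auto simp: P_def cis_diff)
    finally show ?thesis .
  qed
  have G: "integrable lborel (\<lambda>s::'a. complex_of_real (gauss s))"
    by (rule integrable_of_real[OF integrable_gauss])
  let ?H = "\<lambda>s p. complex_of_real (gauss s) * (cis ((e *\<^sub>R s) \<bullet> (fst p - snd p)) * P p)"
  have int: "integrable (lborel \<Otimes>\<^sub>M lborel) (\<lambda>(s, p). ?H s p)"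
    by (rule Bochner_Integration.integrable_bound[OF integrable_prod_mult[OF G P]]) (auto simp: norm_mult)
  have eq: "complex_of_real (gauss s * (cmod (ft F (e *\<^sub>R s)))\<^sup>2) = (\<integral>p. ?H s p \<partial>lborel)" for s
    by (simp only: of_real_mult sq) simp
  have "integrable lborel (\<lambda>s. complex_of_real (gauss s * (cmod (ft F (e *\<^sub>R s)))\<^sup>2))"
    unfolding eq using lborel_pair.integrable_fst'[OF int] by simp
  from integrable_Re[OF this] show "integrable lborel (\<lambda>s. gauss s * (cmod (ft F (e *\<^sub>R s)))\<^sup>2)" by simp
  have "complex_of_real (\<integral>s. gauss s * (cmod (ft F (e *\<^sub>R s)))\<^sup>2 \<partial>lborel) = (\<integral>s. \<integral>p. ?H s p \<partial>lborel \<partial>lborel)"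
    unfolding integral_complex_of_real[symmetric] eq ..
  also have "\<dots> = (\<integral>p. \<integral>s. ?H s p \<partial>lborel \<partial>lborel)"
    using lborel_pair.Fubini_integral[OF int] by simp
  also have "\<dots> = (\<integral>p. complex_of_real (gauss_mass TYPE('a)) * (P p * complex_of_real (gauss (e *\<^sub>R (fst p - snd p)))) \<partial>lborel)"
  proof (rule Bochner_Integration.integral_cong[OF refl])
    fix p :: "'a \<times> 'a"
    have "(\<integral>s. ?H s p \<partial>lborel) = (\<integral>s. P p * (complex_of_real (gauss s) * cis (s \<bullet> (e *\<^sub>R (fst p - snd p)))) \<partial>lborel)"
      by (intro Bochner_Integration.integral_cong) (auto simp: mult_ac)
    also have "\<dots> = P p * complex_of_real (gauss_mass TYPE('a) * gauss (e *\<^sub>R (fst p - snd p)))"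
      using gauss_fourier[of "e *\<^sub>R (fst p - snd p)"] by (simp only: integral_mult_right_zero has_bochner_integral_iff)
    finally show "(\<integral>s. ?H s p \<partial>lborel) = complex_of_real (gauss_mass TYPE('a)) * (P p * complex_of_real (gauss (e *\<^sub>R (fst p - snd p))))"
      by (simp add: mult_ac)
  qed
  also have "\<dots> = complex_of_real (gauss_mass TYPE('a)) * (\<integral>p. P p * complex_of_real (gauss (e *\<^sub>R (fst p - snd p))) \<partial>lborel)"
    by simp
  finally show "complex_of_real (\<integral>s. gauss s * (cmod (ft F (e *\<^sub>R s)))\<^sup>2 \<partial>lborel)
    = complex_of_real (gauss_mass TYPE('a)) * (\<integral>(y, y'). F y * cnj (F y') * complex_of_real (gauss (e *\<^sub>R (y - y'))) \<partial>(lborel \<Otimes>\<^sub>M lborel))"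
    unfolding lborel_prod P_def by (simp add: case_prod_beta')
qed

lemma nn_integral_gauss_weighted_ft_le:
  fixes F :: "'a::euclidean_space \<Rightarrow> complex"
  assumes F: "integrable lborel F"
  shows "(\<integral>+s. ennreal (gauss s * (cmod (ft F (e *\<^sub>R s)))\<^sup>2))
    \<le> ennreal (gauss_mass TYPE('a)) * (\<integral>+y. \<integral>+y'. ennreal (cmod (F y)) * ennreal (cmod (F y')) * ennreal (gauss (e *\<^sub>R (y - y'))))"
proof -
  have [measurable]: "F \<in> borel_measurable borel" using F by auto
  let ?P = "\<lambda>(y, y'). F y * cnj (F y') * complex_of_real (gauss (e *\<^sub>R (y - y')))"
  have m: "0 \<le> gauss_mass TYPE('a)" using gauss_mass_ge_1[where 'a='a] by simp
  have "(\<integral>+s. ennreal (gauss s * (cmod (ft F (e *\<^sub>R s)))\<^sup>2)) = ennreal (\<integral>s. gauss s * (cmod (ft F (e *\<^sub>R s)))\<^sup>2 \<partial>lborel)"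
    by (intro nn_integral_eq_integral gauss_weighted_ft(2)[OF F]) (auto simp: gauss_bounds)
  also have "\<dots> \<le> ennreal (cmod (complex_of_real (\<integral>s. gauss s * (cmod (ft F (e *\<^sub>R s)))\<^sup>2 \<partial>lborel)))"
    by (intro ennreal_leI) simp
  also have "\<dots> = ennreal (gauss_mass TYPE('a)) * ennreal (cmod (integral\<^sup>L (lborel \<Otimes>\<^sub>M lborel) ?P))"
    unfolding gauss_weighted_ft(1)[OF F] using m by (simp add: norm_mult ennreal_mult)
  also have "ennreal (cmod (integral\<^sup>L (lborel \<Otimes>\<^sub>M lborel) ?P)) \<le> (\<integral>\<^sup>+p. ennreal (cmod (?P p)) \<partial>(lborel \<Otimes>\<^sub>M lborel))"
    by (rule norm_integral_le_nn_integral)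
  also have "(\<integral>\<^sup>+p. ennreal (cmod (?P p)) \<partial>(lborel \<Otimes>\<^sub>M lborel)) = (\<integral>+y. \<integral>+y'. ennreal (cmod (F y)) * ennreal (cmod (F y')) * ennreal (gauss (e *\<^sub>R (y - y'))))"
    by (subst lborel.nn_integral_fst[symmetric]) (auto simp: norm_mult ennreal_mult gauss_bounds)
  finally show ?thesis by (simp add: mult_left_mono)
qed

lemma gauss_scaled_tendsto: "(\<lambda>k. ennreal (gauss ((1 / real (Suc k)) *\<^sub>R v))) \<longlonglongrightarrow> 1"
proof -
  have "(\<lambda>k. 1 / real (Suc k)) \<longlonglongrightarrow> 0"
    using LIMSEQ_inverse_real_of_nat by (simp add: inverse_eq_divide)
  then have "(\<lambda>k. gauss ((1 / real (Suc k)) *\<^sub>R v)) \<longlonglongrightarrow> exp (- (norm (0 *\<^sub>R v))\<^sup>2 / 2)"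
    unfolding gauss_def by (intro tendsto_intros) auto
  then have "(\<lambda>k. ennreal (gauss ((1 / real (Suc k)) *\<^sub>R v))) \<longlonglongrightarrow> ennreal 1"
    by (intro tendsto_ennrealI) simp
  then show ?thesis by simp
qed

lemma borel_measurable_ft [measurable]:
  assumes [measurable]: "F \<in> borel_measurable borel"
  shows "ft F \<in> borel_measurable borel"
  unfolding ft_def[abs_def] by measurable

lemma nn_integral_ft_Fatou:
  fixes F :: "'a::euclidean_space \<Rightarrow> complex"
  assumes [measurable]: "F \<in> borel_measurable borel"
  shows "(\<integral>+v. ennreal ((cmod (ft F v))\<^sup>2)) \<le> liminf (\<lambda>k. \<integral>+v. ennreal (gauss ((1 / real (Suc k)) *\<^sub>R v) * (cmod (ft F v))\<^sup>2))"
proof -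
  have lim: "(\<lambda>k. ennreal (gauss ((1 / real (Suc k)) *\<^sub>R v) * (cmod (ft F v))\<^sup>2)) \<longlonglongrightarrow> ennreal ((cmod (ft F v))\<^sup>2)" for v
    using tendsto_mult_ennreal[OF gauss_scaled_tendsto[of v] tendsto_const[of "ennreal ((cmod (ft F v))\<^sup>2)"]]
    by (simp add: ennreal_mult gauss_bounds)
  have "(\<integral>+v. ennreal ((cmod (ft F v))\<^sup>2)) = (\<integral>+v. liminf (\<lambda>k. ennreal (gauss ((1 / real (Suc k)) *\<^sub>R v) * (cmod (ft F v))\<^sup>2)))"
    by (intro nn_integral_cong lim_imp_Liminf[symmetric] lim) simp
  also have "\<dots> \<le> liminf (\<lambda>k. \<integral>+v. ennreal (gauss ((1 / real (Suc k)) *\<^sub>R v) * (cmod (ft F v))\<^sup>2))"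
    by (rule nn_integral_liminf) measurable
  finally show ?thesis .
qed

text \<open>The upper half of Plancherel. In the Gaussian identity \<open>F y\<close> and
  \<open>F y'\<close> are separated by squares and the kernel is integrated out, uniformly in the
  width \<open>d\<close>; then the weight is removed by Fatou. The factor 2 is the loss of the crude
  inequality between product and squares.\<close>

lemma ft_bessel:
  fixes F :: "'a::euclidean_space \<Rightarrow> complex"
  assumes F: "integrable lborel F"
  shows "(\<integral>+v. ennreal ((cmod (ft F v))\<^sup>2)) \<le> ennreal (2 * (gauss_mass TYPE('a))\<^sup>2) * (\<integral>+y. ennreal ((cmod (F y))\<^sup>2))"
proof -
  have [measurable]: "F \<in> borel_measurable borel" using F by auto
  define m where "m = gauss_mass TYPE('a)"
  have m: "1 \<le> m" unfolding m_def by (rule gauss_mass_ge_1)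
  define L where "L = (\<integral>+y. ennreal ((cmod (F y))\<^sup>2))"
  have *: "(\<integral>+v. ennreal (gauss (d *\<^sub>R v) * (cmod (ft F v))\<^sup>2)) \<le> ennreal (2 * m\<^sup>2) * L" if d: "0 < d" for d
  proof -
    let ?dd = "ennreal (\<bar>d\<bar> ^ DIM('a))"
    have mass: "(\<integral>+y. ennreal (gauss ((1 / d) *\<^sub>R (y::'a)))) = ?dd * ennreal m"
      using d nn_integral_lborel_scale[of "\<lambda>y::'a. ennreal (gauss ((1 / d) *\<^sub>R y))" d]
      by (simp add: nn_integral_gauss m_def)
    have mass1: "(\<integral>+y'. ennreal (gauss ((1 / d) *\<^sub>R (y - y')))) = ?dd * ennreal m" for y :: 'a
      using nn_integral_lborel_reflect[of "\<lambda>y::'a. ennreal (gauss ((1 / d) *\<^sub>R y))" y] mass by simp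
    have mass2: "(\<integral>+y. ennreal (gauss ((1 / d) *\<^sub>R (y - y')))) = ?dd * ennreal m" for y' :: 'a
      using nn_integral_lborel_translate[of "\<lambda>y::'a. ennreal (gauss ((1 / d) *\<^sub>R y))" "- y'"] mass by simp
    have "?dd * (\<integral>+v. ennreal (gauss (d *\<^sub>R v) * (cmod (ft F v))\<^sup>2)) = (\<integral>+s. ennreal (gauss s * (cmod (ft F ((1 / d) *\<^sub>R s)))\<^sup>2))"
      using d by (subst nn_integral_lborel_scale[of _ d]) simp_all
    also have "\<dots> \<le> ennreal m * (\<integral>+y. \<integral>+y'. ennreal (cmod (F y)) * ennreal (cmod (F y')) * ennreal (gauss ((1 / d) *\<^sub>R (y - y'))))"
      unfolding m_def by (rule nn_integral_gauss_weighted_ft_le[OF F])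
    also have "\<dots> \<le> ennreal m * (\<integral>+y. \<integral>+y'. ennreal ((cmod (F y))\<^sup>2) * ennreal (gauss ((1 / d) *\<^sub>R (y - y'))) + ennreal ((cmod (F y'))\<^sup>2) * ennreal (gauss ((1 / d) *\<^sub>R (y - y'))))"
      unfolding distrib_right[symmetric] ennreal_power[OF norm_ge_zero, symmetric]
      by (intro mult_left_mono nn_integral_mono mult_right_mono ennreal_mult_le_squares) auto
    also have "(\<integral>+y. \<integral>+y'. ennreal ((cmod (F y))\<^sup>2) * ennreal (gauss ((1 / d) *\<^sub>R (y - y'))) + ennreal ((cmod (F y'))\<^sup>2) * ennreal (gauss ((1 / d) *\<^sub>R (y - y'))))
       = (\<integral>+y. \<integral>+y'. ennreal ((cmod (F y))\<^sup>2) * ennreal (gauss ((1 / d) *\<^sub>R (y - y')))) + (\<integral>+y. \<integral>+y'. ennreal ((cmod (F y'))\<^sup>2) * ennreal (gauss ((1 / d) *\<^sub>R (y - y'))))"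
      by (simp add: nn_integral_add)
    also have "(\<integral>+y. \<integral>+y'. ennreal ((cmod (F y'))\<^sup>2) * ennreal (gauss ((1 / d) *\<^sub>R (y - y')))) = (\<integral>+y'. \<integral>+y. ennreal ((cmod (F y'))\<^sup>2) * ennreal (gauss ((1 / d) *\<^sub>R (y - y'))))"
      by (rule lborel_pair.Fubini') measurable
    also have "\<dots> = L * (?dd * ennreal m)"
      by (simp add: nn_integral_cmult mass2 nn_integral_multc L_def)
    also have "(\<integral>+y. \<integral>+y'. ennreal ((cmod (F y))\<^sup>2) * ennreal (gauss ((1 / d) *\<^sub>R (y - y')))) = L * (?dd * ennreal m)"
      by (simp add: nn_integral_cmult mass1 nn_integral_multc L_def)
    also have "ennreal m * (L * (?dd * ennreal m) + L * (?dd * ennreal m)) = ?dd * ((2 * (ennreal m * ennreal m)) * L)"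
      unfolding mult_2[symmetric] by (simp only: mult_ac)
    also have "2 * (ennreal m * ennreal m) = ennreal (2 * m\<^sup>2)"
      using m by (simp add: power2_eq_square ennreal_mult)
    finally show ?thesis
      using d by (subst (asm) ennreal_mult_le_mult_iff) auto
  qed
  have "(\<integral>+v. ennreal ((cmod (ft F v))\<^sup>2)) \<le> liminf (\<lambda>k. \<integral>+v. ennreal (gauss ((1 / real (Suc k)) *\<^sub>R v) * (cmod (ft F v))\<^sup>2))"
    by (rule nn_integral_ft_Fatou) measurable
  also have "\<dots> \<le> liminf (\<lambda>k. ennreal (2 * m\<^sup>2) * L)"
    by (intro Liminf_mono always_eventually allI *) simp
  also have "\<dots> = ennreal (2 * m\<^sup>2) * L" by (simp add: Liminf_const)
  finally show ?thesis unfolding m_def L_def .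
qed

text \<open>The lower half of Plancherel, for functions to which Fatou applies on the other side:
  \<open>A\<close> nonnegative makes the double integral an \<open>ennreal\<close>, and continuity
  gives pointwise convergence of \<open>A (w - d * s)\<close> as \<open>d\<close> tends to 0. Both
  factors \<open>m >= 1\<close> that arise are discarded.\<close>

lemma nn_integral_square_le_ft:
  fixes A :: "'a::euclidean_space \<Rightarrow> real"
  assumes A: "integrable lborel A" "continuous_on UNIV A" "\<And>w. 0 \<le> A w"
  shows "(\<integral>+w. ennreal ((A w)\<^sup>2)) \<le> (\<integral>+v. ennreal ((cmod (ft (\<lambda>w. complex_of_real (A w)) v))\<^sup>2))"
proof -
  have [measurable]: "A \<in> borel_measurable borel" using A by auto
  define m where "m = gauss_mass TYPE('a)"
  have m: "1 \<le> m" unfolding m_def by (rule gauss_mass_ge_1)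
  let ?F = "\<lambda>w. complex_of_real (A w)"
  have F: "integrable lborel ?F" using A by simp
  define Q where "Q = (\<lambda>d. \<integral>+w. \<integral>+s. ennreal (A w * A (w - d *\<^sub>R s) * gauss s))"
  have le: "Q d \<le> (\<integral>+v. ennreal ((cmod (ft ?F v))\<^sup>2))" if d: "0 < d" for d
  proof -
    let ?dd = "ennreal (\<bar>d\<bar> ^ DIM('a))"
    let ?P = "\<lambda>(y, y'). ?F y * cnj (?F y') * complex_of_real (gauss ((1 / d) *\<^sub>R (y - y')))"
    let ?R = "\<lambda>(y, y'). A y * A y' * gauss ((1 / d) *\<^sub>R (y - y'))"
    have PR: "?P = (\<lambda>p. complex_of_real (?R p))" by (auto simp: fun_eq_iff)
    have int_R: "integrable (lborel \<Otimes>\<^sub>M lborel) ?R"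
    proof -
      have "integrable (lborel \<Otimes>\<^sub>M lborel) (\<lambda>(y, y'). ?F y * ?F y')" by (rule integrable_prod_mult[OF F F])
      then show ?thesis
        by (rule Bochner_Integration.integrable_bound)
          (auto simp: abs_mult norm_mult gauss_bounds A(3) mult_right_le_one_le)
    qed
    have "complex_of_real (\<integral>s. gauss s * (cmod (ft ?F ((1 / d) *\<^sub>R s)))\<^sup>2 \<partial>lborel) = complex_of_real (m * (\<integral>p. ?R p \<partial>(lborel \<Otimes>\<^sub>M lborel)))"
      unfolding gauss_weighted_ft(1)[OF F] PR integral_complex_of_real m_def by simp
    then have eq: "(\<integral>s. gauss s * (cmod (ft ?F ((1 / d) *\<^sub>R s)))\<^sup>2 \<partial>lborel) = m * (\<integral>p. ?R p \<partial>(lborel \<Otimes>\<^sub>M lborel))"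
      using of_real_eq_iff by blast
    have "?dd * (\<integral>+v. ennreal (gauss (d *\<^sub>R v) * (cmod (ft ?F v))\<^sup>2)) = (\<integral>+s. ennreal (gauss s * (cmod (ft ?F ((1 / d) *\<^sub>R s)))\<^sup>2))"
      using d by (subst nn_integral_lborel_scale[of _ d]) simp_all
    also have "\<dots> = ennreal (m * (\<integral>p. ?R p \<partial>(lborel \<Otimes>\<^sub>M lborel)))"
      unfolding eq[symmetric] by (intro nn_integral_eq_integral gauss_weighted_ft(2)[OF F]) (auto simp: gauss_bounds)
    also have "\<dots> = ennreal m * (\<integral>\<^sup>+p. ennreal (?R p) \<partial>(lborel \<Otimes>\<^sub>M lborel))"
      using m by (subst nn_integral_eq_integral[OF int_R]) (auto simp: ennreal_mult' A(3) gauss_bounds)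
    also have "(\<integral>\<^sup>+p. ennreal (?R p) \<partial>(lborel \<Otimes>\<^sub>M lborel)) = (\<integral>+y. \<integral>+y'. ennreal (A y * A y' * gauss ((1 / d) *\<^sub>R (y - y'))))"
      by (subst lborel.nn_integral_fst[symmetric]) auto
    also have "\<dots> = (\<integral>+y. \<integral>+y'. ennreal (A y * A (y - y') * gauss ((1 / d) *\<^sub>R y')))"
    proof (rule nn_integral_cong)
      fix y :: 'a
      show "(\<integral>+y'. ennreal (A y * A y' * gauss ((1 / d) *\<^sub>R (y - y')))) = (\<integral>+y'. ennreal (A y * A (y - y') * gauss ((1 / d) *\<^sub>R y')))"
        using nn_integral_lborel_reflect[of "\<lambda>y'. ennreal (A y * A y' * gauss ((1 / d) *\<^sub>R (y - y')))" y] by simp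
    qed
    also have "\<dots> = (\<integral>+y. ?dd * (\<integral>+s. ennreal (A y * A (y - d *\<^sub>R s) * gauss s)))"
    proof (rule nn_integral_cong)
      fix y :: 'a
      show "(\<integral>+y'. ennreal (A y * A (y - y') * gauss ((1 / d) *\<^sub>R y'))) = ?dd * (\<integral>+s. ennreal (A y * A (y - d *\<^sub>R s) * gauss s))"
        using d nn_integral_lborel_scale[of "\<lambda>y'. ennreal (A y * A (y - y') * gauss ((1 / d) *\<^sub>R y'))" d] by simp
    qed
    also have "\<dots> = ?dd * Q d" unfolding Q_def by (simp add: nn_integral_cmult)
    also have "ennreal m * (?dd * Q d) = ?dd * (ennreal m * Q d)" by (simp add: mult_ac)
    finally have "ennreal m * Q d = (\<integral>+v. ennreal (gauss (d *\<^sub>R v) * (cmod (ft ?F v))\<^sup>2))"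
      using d by (subst (asm) ennreal_mult_cancel_left) auto
    also have "\<dots> \<le> (\<integral>+v. ennreal ((cmod (ft ?F v))\<^sup>2))"
      by (intro nn_integral_mono ennreal_leI mult_left_le_one_le) (auto simp: gauss_bounds)
    finally have "ennreal m * Q d \<le> (\<integral>+v. ennreal ((cmod (ft ?F v))\<^sup>2))" .
    moreover have "1 * Q d \<le> ennreal m * Q d" using m by (intro mult_right_mono) auto
    ultimately show ?thesis by simp
  qed
  have lim: "(\<lambda>k. A w * A (w - (1 / real (Suc k)) *\<^sub>R s) * gauss s) \<longlonglongrightarrow> A w * A w * gauss s" for w s
  proof -
    have "(\<lambda>k. 1 / real (Suc k)) \<longlonglongrightarrow> 0"
      using LIMSEQ_inverse_real_of_nat by (simp add: inverse_eq_divide)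
    then have "(\<lambda>k. w - (1 / real (Suc k)) *\<^sub>R s) \<longlonglongrightarrow> w - 0 *\<^sub>R s" by (intro tendsto_intros)
    then have "(\<lambda>k. A (w - (1 / real (Suc k)) *\<^sub>R s)) \<longlonglongrightarrow> A w"
      using A(2) by (auto intro!: continuous_on_tendsto_compose[of UNIV A])
    then show ?thesis by (intro tendsto_intros)
  qed
  have "(\<integral>+w. ennreal ((A w)\<^sup>2)) \<le> ennreal m * (\<integral>+w. ennreal ((A w)\<^sup>2))"
    using mult_right_mono[of 1 "ennreal m"] m by simp
  also have "\<dots> = (\<integral>+w. ennreal ((A w)\<^sup>2)) * ennreal m" by (rule mult.commute)
  also have "\<dots> = (\<integral>+w. \<integral>+s. ennreal (A w * A w * gauss (s::'a)))"
    unfolding m_def by (simp add: ennreal_mult A(3) gauss_bounds nn_integral_cmult nn_integral_gauss nn_integral_multc power2_eq_square)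
  also have "\<dots> = (\<integral>+w. \<integral>+s. liminf (\<lambda>k. ennreal (A w * A (w - (1 / real (Suc k)) *\<^sub>R s) * gauss s)))"
    by (intro nn_integral_cong lim_imp_Liminf[symmetric] tendsto_ennrealI lim) simp
  also have "\<dots> \<le> (\<integral>+w. liminf (\<lambda>k. \<integral>+s. ennreal (A w * A (w - (1 / real (Suc k)) *\<^sub>R s) * gauss s)))"
    by (intro nn_integral_mono nn_integral_liminf) measurable
  also have "\<dots> \<le> liminf (\<lambda>k. Q (1 / real (Suc k)))"
    unfolding Q_def by (intro nn_integral_liminf) measurable
  also have "\<dots> \<le> liminf (\<lambda>k. (\<integral>+v. ennreal ((cmod (ft ?F v))\<^sup>2)))"
    by (intro Liminf_mono always_eventually allI le) simp
  also have "\<dots> = (\<integral>+v. ennreal ((cmod (ft ?F v))\<^sup>2))" by (simp add: Liminf_const)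
  finally show ?thesis .
qed

lemma integrable_bounded_support:
  fixes f :: "'a::euclidean_space \<Rightarrow> 'b::{banach, second_countable_topology}"
  assumes [measurable]: "f \<in> borel_measurable borel" and "\<And>x. norm (f x) \<le> B" "\<And>x. R < norm x \<Longrightarrow> f x = 0"
  shows "integrable lborel f"
proof (rule integrableI_bounded_set[where A="cball 0 R" and B=B])
  show "emeasure lborel (cball (0::'a) R) < \<infinity>" by (rule emeasure_lborel_cball_finite)
qed (use assms in auto)

text \<open>The transform of an autocorrelation is the squared modulus of the transform of
  \<open>h\<close>, so the lower half of Plancherel turns an L^2 norm into an L^4 norm. Continuity
  and bounded support of \<open>h\<close> make the autocorrelation continuous and integrable. The
  reflection \<open>- y\<close> matches the sign convention of \<open>wave\<close>.\<close>

lemma nn_integral_autocorrelation_square_le: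
  fixes h :: "'a::euclidean_space \<Rightarrow> real"
  assumes h: "continuous_on UNIV h" "\<And>v. 0 \<le> h v" "\<And>v. h v \<le> B" "\<And>v. R < norm v \<Longrightarrow> h v = 0"
  shows "(\<integral>+w. (\<integral>+v. ennreal (h v) * ennreal (h (v + w)))\<^sup>2)
    \<le> (\<integral>+y. ennreal (cmod (ft (\<lambda>v. complex_of_real (h v)) (- y)) ^ 4))"
proof -
  have [measurable]: "h \<in> borel_measurable borel" using h(1) by (rule borel_measurable_continuous_onI)
  have int_h: "integrable lborel h" by (rule integrable_bounded_support[where B=B and R=R]) (use h in auto)
  have B: "0 \<le> B" using h(2)[of 0] h(3)[of 0] by simp
  define A where "A = (\<lambda>w. \<integral>v. h v * h (v + w) \<partial>lborel)"
  have int_A: "integrable lborel (\<lambda>v. h v * h (v + w))" for w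
    by (rule Bochner_Integration.integrable_bound[OF integrable_mult_right[of B, OF int_h]])
      (use h B in \<open>auto simp: abs_mult mult.commute[of B] intro!: mult_left_mono\<close>)
  have [measurable]: "A \<in> borel_measurable borel" unfolding A_def by measurable
  have A0: "0 \<le> A w" for w unfolding A_def by (intro Bochner_Integration.integral_nonneg) (simp add: h)
  have A_eq: "(\<integral>+v. ennreal (h v) * ennreal (h (v + w))) = ennreal (A w)" for w
    unfolding A_def ennreal_mult[symmetric, OF h(2) h(2)]
    by (rule nn_integral_eq_integral[OF int_A]) (simp add: h)
  have cont: "continuous_on UNIV A"
  proof (rule continuous_on_sequentiallyI)
    fix x :: "nat \<Rightarrow> 'a" and a assume x: "x \<longlonglongrightarrow> a"
    show "(\<lambda>k. A (x k)) \<longlonglongrightarrow> A a"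
      unfolding A_def
    proof (rule integral_dominated_convergence[where w="\<lambda>v. B * h v"])
      show "integrable lborel (\<lambda>v. B * h v)" using int_h by simp
      show "AE v in lborel. (\<lambda>k. h v * h (v + x k)) \<longlonglongrightarrow> h v * h (v + a)"
        using x h(1) by (auto intro!: AE_I2 tendsto_intros continuous_on_tendsto_compose[of UNIV h])
    qed (use h B in \<open>auto simp: abs_mult mult.commute[of B] intro!: mult_left_mono\<close>)
  qed
  have pair: "integrable (lborel \<Otimes>\<^sub>M lborel) (\<lambda>(w, v). complex_of_real (h v * h (v + w)) * cis (y \<bullet> w))" for y
  proof -
    have "integrable (lborel \<Otimes>\<^sub>M lborel) (\<lambda>(w::'a, v). h v * h (v + w))"
    proof (rule integrableI_bounded)
      have "(\<integral>\<^sup>+p. ennreal (norm ((\<lambda>(w::'a, v). h v * h (v + w)) p)) \<partial>(lborel \<Otimes>\<^sub>M lborel))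
         = (\<integral>+w. \<integral>+v. ennreal (h v) * ennreal (h (v + w)))"
        by (subst lborel.nn_integral_fst[symmetric]) (auto simp: abs_mult h ennreal_mult)
      also have "\<dots> = (\<integral>+v. \<integral>+w. ennreal (h v) * ennreal (h (v + w)))"
        by (rule lborel_pair.Fubini') measurable
      also have "\<dots> = (\<integral>+v. ennreal (h v) * (\<integral>+w. ennreal (h w)))"
        by (simp add: nn_integral_cmult nn_integral_lborel_translate[of "\<lambda>w. ennreal (h w)"])
      also have "\<dots> = (\<integral>+w. ennreal (h w)) * (\<integral>+w. ennreal (h w))"
        by (simp add: nn_integral_multc)
      also have "\<dots> < \<infinity>"
        using int_h h by (subst (1 2) nn_integral_eq_integral) (auto simp: ennreal_mult_less_top)
      finally show "(\<integral>\<^sup>+p. ennreal (norm ((\<lambda>(w::'a, v). h v * h (v + w)) p)) \<partial>(lborel \<Otimes>\<^sub>M lborel)) < \<infinity>" .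
    qed measurable
    then show ?thesis
      by (rule Bochner_Integration.integrable_bound) (auto simp: norm_mult)
  qed
  have int_Ac: "integrable lborel A"
  proof -
    have "integrable lborel (\<lambda>w. \<integral>v. complex_of_real (h v * h (v + w)) * cis (0 \<bullet> w) \<partial>lborel)"
      using lborel_pair.integrable_fst'[OF pair[of 0]] by simp
    then have "integrable lborel (\<lambda>w. complex_of_real (A w))"
      unfolding A_def by (simp del: of_real_mult)
    from integrable_Re[OF this] show ?thesis by simp
  qed
  have ft_A: "cmod (ft (\<lambda>w. complex_of_real (A w)) y) = (cmod (ft (\<lambda>v. complex_of_real (h v)) (- y)))\<^sup>2" for y
  proof -
    let ?u = "ft (\<lambda>v. complex_of_real (h v))"
    have "ft (\<lambda>w. complex_of_real (A w)) y = (\<integral>w. \<integral>v. complex_of_real (h v * h (v + w)) * cis (y \<bullet> w) \<partial>lborel \<partial>lborel)"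
      unfolding ft_def A_def by (simp add: mult.commute del: of_real_mult)
    also have "\<dots> = (\<integral>v. \<integral>w. complex_of_real (h v * h (v + w)) * cis (y \<bullet> w) \<partial>lborel \<partial>lborel)"
      using lborel_pair.Fubini_integral[OF pair[of y]] by simp
    also have "\<dots> = (\<integral>v. (cis ((- y) \<bullet> v) * complex_of_real (h v)) * ?u y \<partial>lborel)"
    proof (rule Bochner_Integration.integral_cong[OF refl])
      fix v :: 'a
      have "(\<integral>w. complex_of_real (h v * h (v + w)) * cis (y \<bullet> w) \<partial>lborel)
        = (\<integral>w. (cis ((- y) \<bullet> v) * complex_of_real (h v)) * (cis (y \<bullet> (v + w)) * complex_of_real (h (v + w))) \<partial>lborel)"
      proof (rule Bochner_Integration.integral_cong[OF refl])
        fix w :: 'a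
        have "cis (y \<bullet> w) = cis ((- y) \<bullet> v) * cis (y \<bullet> (v + w))"
          by (simp add: cis_mult inner_add_right)
        then show "complex_of_real (h v * h (v + w)) * cis (y \<bullet> w) = (cis ((- y) \<bullet> v) * complex_of_real (h v)) * (cis (y \<bullet> (v + w)) * complex_of_real (h (v + w)))"
          by (simp only: of_real_mult mult_ac)
      qed
      also have "\<dots> = (cis ((- y) \<bullet> v) * complex_of_real (h v)) * (\<integral>w. cis (y \<bullet> (v + w)) * complex_of_real (h (v + w)) \<partial>lborel)"
        by simp
      also have "(\<integral>w. cis (y \<bullet> (v + w)) * complex_of_real (h (v + w)) \<partial>lborel) = ?u y"
      proof -
        have "?u y = (\<integral>x. cis (y \<bullet> x) * complex_of_real (h x) \<partial>distr lborel borel ((+) v))"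
          unfolding ft_def by (simp add: lborel_distr_plus)
        also have "\<dots> = (\<integral>w. cis (y \<bullet> (v + w)) * complex_of_real (h (v + w)) \<partial>lborel)"
          by (subst integral_distr) auto
        finally show ?thesis by simp
      qed
      finally show "(\<integral>w. complex_of_real (h v * h (v + w)) * cis (y \<bullet> w) \<partial>lborel) = (cis ((- y) \<bullet> v) * complex_of_real (h v)) * ?u y" .
    qed
    also have "\<dots> = ?u (- y) * ?u y"
      unfolding ft_def by simp
    \<comment> \<open>Here \<open>h\<close> is real, so reflecting the frequency is complex
      conjugation.\<close>
    also have "?u y = cnj (?u (- y))"
      using Bochner_Integration.integral_cnj[of lborel "\<lambda>v. cis ((- y) \<bullet> v) * complex_of_real (h v)"]
      unfolding ft_def by (simp add: cis_cnj)
    finally show ?thesis by (simp add: norm_mult power2_eq_square)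
  qed
  have "(\<integral>+w. (\<integral>+v. ennreal (h v) * ennreal (h (v + w)))\<^sup>2) = (\<integral>+w. ennreal ((A w)\<^sup>2))"
    unfolding A_eq by (simp add: ennreal_power A0)
  also have "\<dots> \<le> (\<integral>+v. ennreal ((cmod (ft (\<lambda>w. complex_of_real (A w)) v))\<^sup>2))"
    by (rule nn_integral_square_le_ft[OF int_Ac cont A0])
  finally show ?thesis unfolding ft_A by simp
qed

section \<open>The endpoint Strichartz estimate for the Wigner-transformed density\<close>

type_synonym plane = "real^2"

lemma nn_integral_lborel_pair:
  fixes f :: "'a::euclidean_space \<times> 'b::euclidean_space \<Rightarrow> ennreal"
  assumes [measurable]: "f \<in> borel_measurable borel"
  shows "(\<integral>+z. f z) = (\<integral>+x. \<integral>+y. f (x, y))"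
    and "(\<integral>+z. f z) = (\<integral>+y. \<integral>+x. f (x, y))"
proof -
  have m: "f \<in> borel_measurable (lborel \<Otimes>\<^sub>M lborel)" by (simp add: lborel_prod)
  show "(\<integral>+z. f z) = (\<integral>+x. \<integral>+y. f (x, y))"
    by (subst lborel_prod[symmetric], subst lborel.nn_integral_fst[OF m, symmetric]) simp
  then show "(\<integral>+z. f z) = (\<integral>+y. \<integral>+x. f (x, y))"
    by (simp add: lborel_pair.Fubini')
qed

lemma nn_integral_shear:
  fixes f :: "'a::euclidean_space \<times> 'a \<Rightarrow> ennreal"
  assumes [measurable]: "f \<in> borel_measurable borel"
  shows "(\<integral>+z. f (fst z + t *\<^sub>R snd z, snd z)) = (\<integral>+z. f z)"
proof -
  have "(\<integral>+x. f (x + t *\<^sub>R v, v)) = (\<integral>+x. f (x, v))" for v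
    using nn_integral_lborel_translate[of "\<lambda>x. f (x, v)" "t *\<^sub>R v"] by (simp add: add.commute)
  then show ?thesis by (simp add: nn_integral_lborel_pair(2))
qed

text \<open>Substitute \<open>a = x + t v\<close> and then \<open>b = a + (s - t) v\<close>; the
  second step has Jacobian \<open>(t - s)^2\<close> in the plane. This is the whole dispersive
  estimate, with equality.\<close>

lemma nn_integral_dispersive:
  fixes G H :: "plane \<Rightarrow> ennreal"
  assumes [measurable]: "G \<in> borel_measurable borel" "H \<in> borel_measurable borel" and "t \<noteq> s"
  shows "(\<integral>+z. G (fst z + t *\<^sub>R snd z) * H (fst z + s *\<^sub>R snd z))
    = (\<integral>+x. G x) * (\<integral>+x. H x) * ennreal (1 / (t - s)\<^sup>2)"
proof -
  define d where "d = s - t"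
  have d: "d \<noteq> 0" using assms by (simp add: d_def)
  have H: "(\<integral>+v. H (a + d *\<^sub>R v)) = ennreal (1 / (t - s)\<^sup>2) * (\<integral>+x. H x)" for a
  proof -
    have "(\<integral>+x. H x) = (\<integral>+x. H (a + x))"
      by (simp add: nn_integral_lborel_translate)
    also have "\<dots> = ennreal (d\<^sup>2) * (\<integral>+v. H (a + d *\<^sub>R v))"
      using d by (subst nn_integral_lborel_scale[of _ d]) auto
    finally have "ennreal (1 / d\<^sup>2) * (\<integral>+x. H x) = (ennreal (1 / d\<^sup>2) * ennreal (d\<^sup>2)) * (\<integral>+v. H (a + d *\<^sub>R v))"
      by (simp add: mult.assoc)
    also have "ennreal (1 / d\<^sup>2) * ennreal (d\<^sup>2) = 1"
      using d by (subst ennreal_mult[symmetric]) auto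
    finally show ?thesis by (simp add: d_def power2_commute)
  qed
  have "(\<integral>+z. G (fst z + t *\<^sub>R snd z) * H (fst z + s *\<^sub>R snd z))
     = (\<integral>+z. (\<lambda>z. G (fst z) * H (fst z + d *\<^sub>R snd z)) (fst z + t *\<^sub>R snd z, snd z))"
    by (simp add: d_def algebra_simps)
  also have "\<dots> = (\<integral>+z. G (fst z) * H (fst z + d *\<^sub>R snd z))"
    by (rule nn_integral_shear) measurable
  also have "\<dots> = (\<integral>+a. \<integral>+v. G a * H (a + d *\<^sub>R v))"
    by (subst nn_integral_lborel_pair(1)) auto
  also have "\<dots> = (\<integral>+a. G a * (ennreal (1 / (t - s)\<^sup>2) * (\<integral>+x. H x)))"
    by (simp add: nn_integral_cmult H)
  also have "\<dots> = (\<integral>+x. G x) * (ennreal (1 / (t - s)\<^sup>2) * (\<integral>+x. H x))"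
    by (simp add: nn_integral_multc)
  finally show ?thesis by (simp only: mult_ac)
qed

text \<open>The transform in the velocity of the transported density, with kernel exp(-i y.v).
  Formally it solves i u_t = nabla_x . nabla_y u, the Schroedinger equation with a mixed
  second-order operator.\<close>

definition wave :: "(plane \<times> plane \<Rightarrow> real) \<Rightarrow> real \<times> plane \<times> plane \<Rightarrow> complex" where
  "wave f = (\<lambda>(t, x, y). ft (\<lambda>v. complex_of_real (f (x - t *\<^sub>R v, v))) (- y))"

lemma measurable_wave [measurable]:
  assumes [measurable]: "f \<in> borel_measurable borel"
  shows "wave f \<in> borel_measurable borel"
proof -
  have "wave f = (\<lambda>p. \<integral>v. cis ((- snd (snd p)) \<bullet> v) * complex_of_real (f (fst (snd p) - fst p *\<^sub>R v, v)) \<partial>lborel)"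
    by (auto simp: wave_def ft_def fun_eq_iff)
  also have "\<dots> \<in> borel_measurable borel"
    by (rule lborel.borel_measurable_lebesgue_integral) measurable
  finally show ?thesis .
qed

section \<open>Octaves of the wave and the truncated Strichartz estimate\<close>

lemma octave_exists:
  fixes a b :: real
  assumes "0 < a" "0 < b"
  shows "\<exists>n::int. b < 8 * (2 powi n) ^ 3 * a \<and> (2 powi n) ^ 3 * a \<le> b"
proof -
  define n where "n = \<lfloor>log 8 (b / a)\<rfloor>"
  have q: "(2 powi n) ^ 3 = (8::real) powr n"
  proof -
    have "(2 powi n) ^ 3 = (2::real) powr n * 2 powr n * 2 powr n"
      by (simp add: powr_real_of_int' power3_eq_cube)
    also have "\<dots> = (2 * 2 * 2) powr n"
      by (simp only: powr_mult)
    finally show ?thesis by simp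
  qed
  have r: "b / a = 8 powr (log 8 (b / a))" using assms by simp
  have "8 powr n \<le> b / a"
    using r by (metis n_def of_int_floor_le powr_le_cancel_iff one_less_numeral_iff semiring_norm(76))
  moreover have "b / a < 8 powr (n + 1)"
    using r by (metis n_def floor_correct of_int_1 of_int_add powr_less_cancel_iff one_less_numeral_iff semiring_norm(76))
  ultimately show ?thesis
    using assms by (intro exI[of _ n]) (auto simp: q powr_add field_simps)
qed

lemma octave_unique:
  fixes a b :: real
  assumes "b < 8 * (2 powi n) ^ 3 * a" "(2 powi n) ^ 3 * a \<le> b" "b < 8 * (2 powi m) ^ 3 * a" "(2 powi m) ^ 3 * a \<le> b"
  shows "n = (m::int)"
proof -
  have a: "0 < a"
  proof (rule ccontr)
    assume "\<not> 0 < a"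
    then have "7 * ((2 powi n) ^ 3 * a) \<le> 0" by (intro mult_nonneg_nonpos) auto
    with assms show False by linarith
  qed
  have *: False if "i < j" "(2 powi j) ^ 3 * a \<le> b" "b < 8 * (2 powi i) ^ 3 * a" for i j :: int
  proof -
    have "2 * 2 powi i = (2::real) powi (i + 1)" by (simp add: power_int_add)
    also have "\<dots> \<le> 2 powi j" using that by (intro power_int_increasing) auto
    finally have "(2 * 2 powi i) ^ 3 \<le> ((2::real) powi j) ^ 3" by (intro power_mono) auto
    then have "8 * (2 powi i) ^ 3 * a \<le> (2 powi j) ^ 3 * a"
      using a by (intro mult_right_mono) (auto simp: power_mult_distrib)
    with that show False by linarith
  qed
  show ?thesis using *[of n m] *[of m n] assms by (meson linorder_neqE)
qed

text \<open>
  The dual function \<open>\<bar>w\<bar>\<^sup>2 w / N\<^sup>2\<close> is cut into the octaves of \<open>\<bar>w\<bar>\<close>. Truncating to \<open>\<bar>t\<bar>, \<bar>y\<bar> \<le> T\<close> makes \<open>D = \<integral> N\<^sup>2 dt\<close> finite, so that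
  \<open>D / 2\<close> can be absorbed. In the constant, 224 comes from \<open>bilinear_sum_le\<close>, and \<open>4096 = 8\<^sup>4\<close> bounds the sum of the octave weights \<open>c\<close>.
\<close>

lemma strichartz_wave_truncated:
  fixes f :: "plane \<times> plane \<Rightarrow> real" and T :: real
  assumes f [measurable]: "f \<in> borel_measurable borel" and f_bounds: "\<And>z. 0 \<le> f z" "\<And>z. f z \<le> B" "\<And>z. R < norm z \<Longrightarrow> f z = 0"
    and T: "0 < T"
  defines "w \<equiv> (\<lambda>p. if \<bar>fst p\<bar> \<le> T \<and> norm (snd (snd p)) \<le> T then wave f p else 0)"
  shows "(\<integral>+t. esqrt (\<integral>+p. ennreal (cmod (w (t, p)) ^ 4))) \<le> ennreal (896 * 4096\<^sup>2) * (\<integral>+z. ennreal ((f z)\<^sup>2))"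
proof -
  define q :: "int \<Rightarrow> real" where "q = (\<lambda>n. (2 powi n) ^ 3)"
  have q: "0 < q n" for n by (simp add: q_def)
  have [measurable]: "w \<in> borel_measurable borel" unfolding w_def by measurable
  have B: "0 \<le> B" using f_bounds(1)[of 0] f_bounds(2)[of 0] by simp
  define V where "V = measure lborel (cball (0::plane) R)"
  have f_zero: "f (x, v) = 0" if "R < norm x \<or> R < norm v" for x v
    using that norm_fst_le[of x v] norm_snd_le[of v x] by (intro f_bounds(3)) (auto simp: norm_Pair intro: order.strict_trans2)
  have w_le: "cmod (w p) \<le> B * V" for p
  proof (cases p)
    case (fields t x y)
    have "cmod (wave f p) \<le> (\<integral>v. cmod (cis ((- y) \<bullet> v) * complex_of_real (f (x - t *\<^sub>R v, v))) \<partial>lborel)"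
      unfolding fields wave_def ft_def by simp
    also have "\<dots> \<le> (\<integral>v. indicator (cball 0 R) (v::plane) * B \<partial>lborel)"
    proof (rule Bochner_Integration.integral_mono)
      show "integrable lborel (\<lambda>v. cmod (cis ((- y) \<bullet> v) * complex_of_real (f (x - t *\<^sub>R v, v))))"
        by (rule integrable_bounded_support[where B=B and R=R]) (use f_bounds f_zero in \<open>auto simp: norm_mult\<close>)
      show "integrable lborel (\<lambda>v::plane. indicator (cball 0 R) v * B)"
        by (rule integrable_bounded_support[where B=B and R=R]) (use B in \<open>auto split: split_indicator intro!: borel_measurable_times borel_measurable_indicator borel_closed\<close>)
    qed (use f_bounds f_zero in \<open>auto simp: norm_mult split: split_indicator\<close>)
    also have "\<dots> = B * V" by (simp add: V_def)
    finally show ?thesis unfolding w_def using B by (auto simp: V_def)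
  qed
  \<comment> \<open>Velocities in the support are at most \<open>R\<close> and times at most
    \<open>T\<close>, so positions spread by at most \<open>T * |R|\<close>.\<close>
  define S where "S = R + T * \<bar>R\<bar>"
  have w_zero: "w (t, x, y) = 0" if "T < \<bar>t\<bar> \<or> S < norm x \<or> T < norm y" for t x y
  proof (cases "T < \<bar>t\<bar> \<or> T < norm y")
    case False
    then have x: "S < norm x" and t: "\<bar>t\<bar> \<le> T" using that by auto
    have "f (x - t *\<^sub>R v, v) = 0" for v
    proof (cases "R < norm v")
      case False
      have "\<bar>t\<bar> * norm v \<le> T * \<bar>R\<bar>" using False t by (intro mult_mono) auto
      moreover have "norm x \<le> norm (x - t *\<^sub>R v) + \<bar>t\<bar> * norm v"
        using norm_triangle_sub[of x "t *\<^sub>R v"] by simp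
      ultimately have "R < norm (x - t *\<^sub>R v)" using x by (simp add: S_def)
      then show ?thesis by (rule f_zero[OF disjI1])
    qed (simp add: f_zero)
    then show ?thesis by (simp add: w_def wave_def ft_def)
  qed (auto simp: w_def)
  define N4 where "N4 = (\<lambda>t. \<integral>+p. ennreal (cmod (w (t, p)) ^ 4))"
  have [measurable]: "N4 \<in> borel_measurable borel" unfolding N4_def by measurable
  define K where "K = ennreal ((B * V) ^ 4) * emeasure lborel (cball (0::plane) S \<times> cball (0::plane) T)"
  have K: "K < top"
  proof -
    have "compact (cball (0::plane) S \<times> cball (0::plane) T)" by (intro compact_Times compact_cball)
    then have "emeasure lborel (cball (0::plane) S \<times> cball (0::plane) T) < \<infinity>" by (rule emeasure_compact_finite)
    then show ?thesis unfolding K_def by (simp add: ennreal_mult_less_top)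
  qed
  have N4_le: "N4 t \<le> K * indicator {-T..T} t" for t
  proof -
    have "N4 t \<le> (\<integral>+p. (ennreal ((B * V) ^ 4) * indicator {-T..T} t) * indicator (cball (0::plane) S \<times> cball (0::plane) T) p)"
      unfolding N4_def
    proof (rule nn_integral_mono)
      fix p :: "plane \<times> plane"
      obtain x y where p: "p = (x, y)" by (cases p)
      show "ennreal (cmod (w (t, p)) ^ 4) \<le> (ennreal ((B * V) ^ 4) * indicator {-T..T} t) * indicator (cball (0::plane) S \<times> cball (0::plane) T) p"
      proof (cases "T < \<bar>t\<bar> \<or> S < norm x \<or> T < norm y")
        case True
        then show ?thesis using w_zero[of t x y] by (simp add: p)
      next
        case False
        then have "t \<in> {-T..T}" by auto
        then show ?thesis using False power_mono[OF w_le[of "(t, p)"], of 4] by (auto simp: p intro!: ennreal_leI)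
      qed
    qed
    also have "\<dots> = (ennreal ((B * V) ^ 4) * indicator {-T..T} t) * emeasure lborel (cball (0::plane) S \<times> cball (0::plane) T)"
      by (intro nn_integral_cmult_indicator) (simp add: borel_closed closed_Times)
    finally show ?thesis by (simp add: K_def mult_ac)
  qed
  have N4_fin: "N4 t < top" for t
    using N4_le[of t] K by (auto split: split_indicator intro: le_less_trans)
  \<comment> \<open>The L^4 norm of the truncated wave at time \<open>t\<close>; \<open>N4\<close>
    is finite, so the passage to reals loses nothing.\<close>
  define N where "N = (\<lambda>t. sqrt (sqrt (enn2real (N4 t))))"
  have [measurable]: "N \<in> borel_measurable borel" unfolding N_def by measurable
  have N0: "0 \<le> N t" for t by (simp add: N_def)
  have N2: "(N t)\<^sup>2 = sqrt (enn2real (N4 t))" for t by (simp add: N_def)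
  have N4_eq: "ennreal (N t ^ 4) = N4 t" for t
  proof -
    have "N t ^ 4 = ((N t)\<^sup>2)\<^sup>2" by simp
    also have "\<dots> = enn2real (N4 t)" unfolding N2 by simp
    finally show ?thesis using N4_fin[of t] by simp
  qed
  have esqrt_N4: "esqrt (N4 t) = ennreal ((N t)\<^sup>2)" for t
    unfolding N4_eq[symmetric] by (subst esqrt_ennreal) (auto simp: real_sqrt_unique N0)
  define D where "D = (\<integral>+t. ennreal ((N t)\<^sup>2))"
  have D_fin: "D < top"
  proof -
    have "D \<le> (\<integral>+t. esqrt K * indicator {-T..T} t)"
      unfolding D_def
    proof (rule nn_integral_mono)
      fix t
      show "ennreal ((N t)\<^sup>2) \<le> esqrt K * indicator {-T..T} t"
        using esqrt_mono[OF N4_le[of t]] unfolding esqrt_N4 by (auto split: split_indicator simp: esqrt_def)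
    qed
    also have "\<dots> = esqrt K * ennreal (2 * T)"
      using T by (simp add: nn_integral_cmult_indicator)
    also have "\<dots> < top" using K by (auto simp: ennreal_mult_less_top esqrt_def)
    finally show ?thesis .
  qed
  \<comment> \<open>The indicator of \<open>N / (8 * q) < |w| <= N / q\<close>. It vanishes
    identically where \<open>N t = 0\<close>.\<close>
  define lev where "lev = (\<lambda>n t p. if N t < 8 * q n * cmod (w (t, p)) \<and> q n * cmod (w (t, p)) \<le> N t then 1 else 0 :: real)"
  have [measurable]: "(\<lambda>x. lev n (g x) (h x)) \<in> borel_measurable M" if [measurable]: "g \<in> borel_measurable M" "h \<in> borel_measurable M"
    for n g h and M :: "'m measure"
    unfolding lev_def by measurable
  have lev01: "0 \<le> lev n t p" "lev n t p \<le> 1" "(lev n t p)\<^sup>2 = lev n t p" for n t p by (auto simp: lev_def)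
  have lev_sum: "(\<Sum>n\<in>I. lev n t p) \<le> 1" if "finite I" for I t p
  proof (cases "\<exists>n\<in>I. lev n t p \<noteq> 0")
    case True
    then obtain n where n: "n \<in> I" "lev n t p \<noteq> 0" by blast
    have "lev m t p = (if m = n then 1 else 0)" for m
      using n octave_unique[of "N t" n "cmod (w (t, p))" m] by (auto simp: lev_def q_def split: if_splits)
    then show ?thesis using that n by simp
  qed (simp add: sum.neutral)
  define F where "F = (\<lambda>n t p. complex_of_real ((cmod (w (t, p)))\<^sup>2 / (N t)\<^sup>2 * lev n t p) * w (t, p))"
  have [measurable]: "(\<lambda>x. F n (g x) (h x)) \<in> borel_measurable M" if [measurable]: "g \<in> borel_measurable M" "h \<in> borel_measurable M"
    for n g h and M :: "'m measure"
    unfolding F_def by measurable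
  have F_le: "cmod (F n t p) \<le> N t / (q n) ^ 3 * lev n t p" for n t p
  proof (cases "lev n t p = 0 \<or> N t = 0")
    case True
    then show ?thesis using lev01[of n t p] by (auto simp: F_def)
  next
    case False
    then have w: "q n * cmod (w (t, p)) \<le> N t" "lev n t p = 1" by (auto simp: lev_def split: if_splits)
    have N: "0 < N t" using False N0[of t] by simp
    have "cmod (F n t p) = cmod (w (t, p)) ^ 3 / (N t)\<^sup>2"
      using w by (simp add: F_def norm_mult norm_divide norm_power power2_eq_square power3_eq_cube)
    also have "\<dots> \<le> (N t / q n) ^ 3 / (N t)\<^sup>2"
      using w q[of n] by (intro divide_right_mono power_mono) (auto simp: field_simps)
    also have "\<dots> = N t / (q n) ^ 3"
      using N by (simp add: power_divide power2_eq_square power3_eq_cube)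
    finally show ?thesis using w by simp
  qed
  have F_zero: "F n t (x, y) = 0" if "T < norm y" for n t x y
    using w_zero[of t x y] that by (simp add: F_def)
  have int_F: "integrable lborel (\<lambda>y. F n t (x, y))" for n t x
  proof (rule integrable_bounded_support[where B="N t / (q n) ^ 3" and R=T])
    show "norm (F n t (x, y)) \<le> N t / (q n) ^ 3" for y
    proof -
      have "N t / (q n) ^ 3 * lev n t (x, y) \<le> N t / (q n) ^ 3 * 1"
        using lev01 N0 q[of n] by (intro mult_left_mono) (auto intro!: divide_nonneg_nonneg)
      then show ?thesis using F_le[of n t "(x, y)"] by simp
    qed
  qed (auto simp: F_zero)
  \<comment> \<open>The powers of \<open>q\<close> are those of L^{4/3}: a function of height
    \<open>N / q^3\<close> on a set of mass \<open>q^4 * c\<close> has norm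
    \<open>N * c^(3/4)\<close>, free of \<open>q\<close>.\<close>
  define c where "c = (\<lambda>n t. (\<integral>+p. ennreal (lev n t p)) * ennreal (1 / (q n) ^ 4))"
  have [measurable]: "c n \<in> borel_measurable borel" for n unfolding c_def by measurable
  have lev_mass: "(\<integral>+p. ennreal (lev n t p)) = ennreal ((q n) ^ 4) * c n t" for n t
  proof -
    have "ennreal ((q n) ^ 4) * c n t = (ennreal ((q n) ^ 4) * ennreal (1 / (q n) ^ 4)) * (\<integral>+p. ennreal (lev n t p))"
      unfolding c_def by (simp only: mult_ac)
    also have "ennreal ((q n) ^ 4) * ennreal (1 / (q n) ^ 4) = 1"
      using q[of n] by (subst ennreal_mult[symmetric]) auto
    finally show ?thesis by simp
  qed
  have c_sum: "(\<Sum>n\<in>I. c n t) \<le> ennreal 4096" if I: "finite I" for I t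
  proof (cases "N t = 0")
    case True
    have "lev n t p = 0" for n p
      using True q[of n] by (auto simp: lev_def mult_le_0_iff)
    then show ?thesis by (simp add: c_def)
  next
    case False
    then have N: "0 < N t" using N0[of t] by simp
    have pt: "(\<Sum>n\<in>I. lev n t p / (q n) ^ 4) \<le> 4096 / N t ^ 4 * cmod (w (t, p)) ^ 4" for p
    proof -
      have "lev n t p / (q n) ^ 4 \<le> lev n t p * (4096 / N t ^ 4 * cmod (w (t, p)) ^ 4)" for n
      proof (cases "lev n t p = 0")
        case False
        then have "N t < 8 * q n * cmod (w (t, p))" "lev n t p = 1" by (auto simp: lev_def split: if_splits)
        then have "N t ^ 4 \<le> (8 * q n * cmod (w (t, p))) ^ 4" using N by (intro power_mono) auto
        then show ?thesis using \<open>lev n t p = 1\<close> N q[of n] by (simp add: power_mult_distrib field_simps)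
      qed simp
      then have "(\<Sum>n\<in>I. lev n t p / (q n) ^ 4) \<le> (\<Sum>n\<in>I. lev n t p) * (4096 / N t ^ 4 * cmod (w (t, p)) ^ 4)"
        unfolding sum_distrib_right by (rule sum_mono)
      also have "\<dots> \<le> 1 * (4096 / N t ^ 4 * cmod (w (t, p)) ^ 4)"
        using lev_sum[OF I] by (intro mult_right_mono) auto
      finally show ?thesis by simp
    qed
    have "(\<Sum>n\<in>I. c n t) = (\<Sum>n\<in>I. \<integral>+p. ennreal (lev n t p / (q n) ^ 4))"
      unfolding c_def using lev01 q
      by (intro sum.cong refl) (simp add: nn_integral_multc[symmetric] ennreal_mult[symmetric] less_imp_le)
    also have "\<dots> = (\<integral>+p. ennreal (\<Sum>n\<in>I. lev n t p / (q n) ^ 4))"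
      using lev01 q by (subst nn_integral_sum[symmetric]) (auto simp: sum_ennreal less_imp_le)
    also have "\<dots> \<le> (\<integral>+p. ennreal (4096 / N t ^ 4) * ennreal (cmod (w (t, p)) ^ 4))"
    proof (rule nn_integral_mono)
      fix p
      have "ennreal (4096 / N t ^ 4) * ennreal (cmod (w (t, p)) ^ 4) = ennreal (4096 / N t ^ 4 * cmod (w (t, p)) ^ 4)"
        by (rule ennreal_mult[symmetric]) (use N in auto)
      then show "ennreal (\<Sum>n\<in>I. lev n t p / (q n) ^ 4) \<le> ennreal (4096 / N t ^ 4) * ennreal (cmod (w (t, p)) ^ 4)"
        using ennreal_leI[OF pt[of p]] by (simp only:)
    qed
    also have "\<dots> = ennreal (4096 / N t ^ 4) * ennreal (N t ^ 4)"
      unfolding N4_eq N4_def by (rule nn_integral_cmult) measurable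
    also have "\<dots> = ennreal 4096" using N by (subst ennreal_mult[symmetric]) auto
    finally show ?thesis .
  qed
  \<comment> \<open>The L^1 bound for a level produces \<open>c\<close>, the L^2 bound only its
    square root. Since \<open>c <= 4096 = 64^2\<close>, both can be stated with the square root, as
    a common factor in the near and far bounds requires.\<close>
  have c_le: "c n t \<le> ennreal 64 * esqrt (c n t)" for n t
  proof -
    have "esqrt (c n t) \<le> esqrt (ennreal 4096)" using c_sum[of "{n}" t] by (intro esqrt_mono) simp
    also have "\<dots> = ennreal 64" by (subst esqrt_ennreal) (auto simp: real_sqrt_unique)
    finally have "esqrt (c n t) * esqrt (c n t) \<le> ennreal 64 * esqrt (c n t)" by (rule mult_right_mono) simp
    then show ?thesis by (simp only: power2_eq_square[symmetric] esqrt_power2)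
  qed
  \<comment> \<open>The 64 comes from \<open>c_le\<close>; its square also covers the Bessel
    constant, \<open>2 * (2 * pi)^2 <= 4096\<close>.\<close>
  define M where "M = (\<lambda>n t. ennreal 64 * ennreal (N t) * esqrt (c n t))"
  have [measurable]: "M n \<in> borel_measurable borel" for n unfolding M_def by measurable
  define e where "e = (\<lambda>n t x. ft (\<lambda>y. F n t (x, y)))"
  have [measurable]: "(\<lambda>x. e n (g x) (h x) (k x)) \<in> borel_measurable L"
    if [measurable]: "g \<in> borel_measurable L" "h \<in> borel_measurable L" "k \<in> borel_measurable L"
    for n g h k and L :: "'m measure"
    unfolding e_def ft_def by measurable
  \<comment> \<open>The modulus of the adjoint applied to \<open>F n t\<close>: transform back from
    \<open>y\<close> to the velocity, then undo the transport, so that all times are compared on the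
    same phase space of initial data.\<close>
  define E where "E = (\<lambda>n (p :: real \<times> plane \<times> plane). ennreal (cmod (e n (fst p) (fst (snd p) + fst p *\<^sub>R snd (snd p)) (snd (snd p)))))"
  have [measurable]: "E n \<in> borel_measurable borel" for n unfolding E_def by measurable
  have E_L2: "(\<integral>+z. (E n (t, z))\<^sup>2) \<le> (M n t * ennreal (1 / q n))\<^sup>2" for n t
  proof -
    have "(\<integral>+z. (E n (t, z))\<^sup>2) = (\<integral>+z. (\<lambda>z. ennreal ((cmod (e n t (fst z) (snd z)))\<^sup>2)) (fst z + t *\<^sub>R snd z, snd z))"
      by (simp add: E_def ennreal_power)
    also have "\<dots> = (\<integral>+z. ennreal ((cmod (e n t (fst z) (snd z)))\<^sup>2))"
      by (rule nn_integral_shear) measurable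
    also have "\<dots> = (\<integral>+x. \<integral>+v. ennreal ((cmod (e n t x v))\<^sup>2))"
      by (subst nn_integral_lborel_pair(1)) auto
    also have "\<dots> \<le> (\<integral>+x. ennreal (2 * (gauss_mass TYPE(plane))\<^sup>2) * (\<integral>+y. ennreal ((cmod (F n t (x, y)))\<^sup>2)))"
      unfolding e_def by (intro nn_integral_mono ft_bessel int_F)
    also have "\<dots> = ennreal (2 * (gauss_mass TYPE(plane))\<^sup>2) * (\<integral>+x. \<integral>+y. ennreal ((cmod (F n t (x, y)))\<^sup>2))"
      by (rule nn_integral_cmult) measurable
    also have "\<dots> = ennreal (2 * (gauss_mass TYPE(plane))\<^sup>2) * (\<integral>+p. ennreal ((cmod (F n t p))\<^sup>2))"
      by (subst nn_integral_lborel_pair(1)) auto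
    \<comment> \<open>\<open>(cmod (F n t p))^2\<close> is at most \<open>N^2 / q^6\<close> on a set
      of mass \<open>q^4 * c\<close>, which leaves \<open>N^2 * c / q^2\<close>.\<close>
    also have "\<dots> \<le> ennreal 4096 * (\<integral>+p. ennreal ((N t)\<^sup>2 / (q n) ^ 6) * ennreal (lev n t p))"
    proof (intro mult_mono nn_integral_mono)
      have "gauss_mass TYPE(plane) = 2 * pi" by (simp add: gauss_mass_def)
      also have "\<dots> \<le> 8" using pi_less_4 by simp
      finally have "(gauss_mass TYPE(plane))\<^sup>2 \<le> 8\<^sup>2" using gauss_mass_ge_1[where 'a=plane] by (intro power_mono) auto
      then show "ennreal (2 * (gauss_mass TYPE(plane))\<^sup>2) \<le> ennreal 4096" by (intro ennreal_leI) simp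
      fix p
      have "(cmod (F n t p))\<^sup>2 \<le> (N t / (q n) ^ 3 * lev n t p)\<^sup>2"
        by (intro power_mono F_le) simp
      also have "\<dots> = (N t)\<^sup>2 / (q n) ^ 6 * lev n t p"
        by (simp add: power_mult_distrib power_divide lev01)
      finally show "ennreal ((cmod (F n t p))\<^sup>2) \<le> ennreal ((N t)\<^sup>2 / (q n) ^ 6) * ennreal (lev n t p)"
        using q[of n] lev01 by (subst ennreal_mult[symmetric]) (auto intro!: ennreal_leI)
    qed auto
    also have "\<dots> = ennreal 4096 * (ennreal ((N t)\<^sup>2 / (q n) ^ 6) * (ennreal ((q n) ^ 4) * c n t))"
      unfolding lev_mass[symmetric] by (subst nn_integral_cmult) auto
    also have "\<dots> = (ennreal 4096 * (ennreal ((N t)\<^sup>2 / (q n) ^ 6) * ennreal ((q n) ^ 4))) * c n t"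
      by (simp only: mult_ac)
    also have "ennreal 4096 * (ennreal ((N t)\<^sup>2 / (q n) ^ 6) * ennreal ((q n) ^ 4)) = ennreal ((64 * N t * (1 / q n))\<^sup>2)"
    proof -
      have "4096 * ((N t)\<^sup>2 / (q n) ^ 6 * (q n) ^ 4) = (64 * N t * (1 / q n))\<^sup>2"
        using q[of n] by (simp add: field_simps power_numeral_reduce)
      then show ?thesis by (subst ennreal_mult[symmetric], simp, simp)+ (rule arg_cong)
    qed
    also have "\<dots> = (ennreal 64 * ennreal (N t) * ennreal (1 / q n))\<^sup>2"
    proof -
      have "ennreal (64 * N t * (1 / q n)) = ennreal 64 * ennreal (N t) * ennreal (1 / q n)"
        using q[of n] N0[of t] by (subst ennreal_mult, simp, simp)+ (rule refl)
      moreover have "ennreal ((64 * N t * (1 / q n))\<^sup>2) = (ennreal (64 * N t * (1 / q n)))\<^sup>2"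
        using q[of n] N0[of t] by (intro ennreal_power[symmetric]) simp
      ultimately show ?thesis by simp
    qed
    also have "\<dots> * c n t = (ennreal 64 * ennreal (N t) * ennreal (1 / q n))\<^sup>2 * (esqrt (c n t))\<^sup>2"
      by simp
    also have "\<dots> = (M n t * ennreal (1 / q n))\<^sup>2"
      by (simp only: M_def power_mult_distrib mult_ac)
    finally show ?thesis .
  qed
  have near: "(\<integral>+z. E n (t, z) * E m (s, z)) \<le> M n t * M m s * ennreal (1 / (q n * q m))" for n m t s
  proof -
    have "(\<integral>+z. E n (t, z) * E m (s, z))\<^sup>2 \<le> (\<integral>+z. (E n (t, z))\<^sup>2) * (\<integral>+z. (E m (s, z))\<^sup>2)"
      by (rule Cauchy_Schwarz_nn_integral) measurable
    also have "\<dots> \<le> (M n t * ennreal (1 / q n))\<^sup>2 * (M m s * ennreal (1 / q m))\<^sup>2"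
      by (intro mult_mono E_L2) auto
    also have "\<dots> = (M n t * M m s * (ennreal (1 / q n) * ennreal (1 / q m)))\<^sup>2"
      by (simp only: power_mult_distrib mult_ac)
    also have "ennreal (1 / q n) * ennreal (1 / q m) = ennreal (1 / (q n * q m))"
      using q[of n] q[of m] by (subst ennreal_mult[symmetric]) auto
    finally show ?thesis by (simp only: power2_le_ennreal_iff)
  qed
  define G where "G = (\<lambda>n t x. \<integral>+y. ennreal (cmod (F n t (x, y))))"
  have [measurable]: "G n t \<in> borel_measurable borel" for n t unfolding G_def by measurable
  \<comment> \<open>Oscillation in \<open>y\<close> is thrown away. What remains depends on
    \<open>(x, v)\<close> only through \<open>x + t v\<close>, which is the form that dispersion can
    use.\<close>
  have E_G: "E n (t, z) \<le> G n t (fst z + t *\<^sub>R snd z)" for n t z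
  proof -
    have "E n (t, z) \<le> (\<integral>+y. ennreal (cmod (cis (snd z \<bullet> y) * F n t (fst z + t *\<^sub>R snd z, y))))"
      unfolding E_def e_def ft_def fst_conv snd_conv by (rule norm_integral_le_nn_integral)
    then show ?thesis by (simp add: G_def norm_mult)
  qed
  have G_mass: "(\<integral>+x. G n t x) \<le> M n t * ennreal (q n)" for n t
  proof -
    have "(\<integral>+x. G n t x) = (\<integral>+p. ennreal (cmod (F n t p)))"
      unfolding G_def by (subst nn_integral_lborel_pair(1)) auto
    also have "\<dots> \<le> (\<integral>+p. ennreal (N t / (q n) ^ 3) * ennreal (lev n t p))"
    proof (rule nn_integral_mono)
      fix p
      have "ennreal (N t / (q n) ^ 3) * ennreal (lev n t p) = ennreal (N t / (q n) ^ 3 * lev n t p)"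
        by (rule ennreal_mult[symmetric]) (use q[of n] N0[of t] lev01 in auto)
      then show "ennreal (cmod (F n t p)) \<le> ennreal (N t / (q n) ^ 3) * ennreal (lev n t p)"
        using ennreal_leI[OF F_le[of n t p]] by (simp only:)
    qed
    also have "\<dots> = ennreal (N t / (q n) ^ 3) * (ennreal ((q n) ^ 4) * c n t)"
      unfolding lev_mass[symmetric] by (rule nn_integral_cmult) measurable
    also have "\<dots> = (ennreal (N t / (q n) ^ 3) * ennreal ((q n) ^ 4)) * c n t" by (simp only: mult_ac)
    also have "ennreal (N t / (q n) ^ 3) * ennreal ((q n) ^ 4) = ennreal (N t) * ennreal (q n)"
      using q[of n] N0[of t] by (subst (1 2) ennreal_mult[symmetric]) (auto simp: power_numeral_reduce)
    also have "ennreal (N t) * ennreal (q n) * c n t \<le> ennreal (N t) * ennreal (q n) * (ennreal 64 * esqrt (c n t))"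
      by (intro mult_left_mono c_le) auto
    also have "\<dots> = M n t * ennreal (q n)" by (simp only: M_def mult_ac)
    finally show ?thesis .
  qed
  have far: "(\<integral>+z. E n (t, z) * E m (s, z)) \<le> M n t * M m s * ennreal (q n * q m / (t - s)\<^sup>2)" if ts: "t \<noteq> s" for n m t s
  proof -
    have "(\<integral>+z. E n (t, z) * E m (s, z)) \<le> (\<integral>+z. G n t (fst z + t *\<^sub>R snd z) * G m s (fst z + s *\<^sub>R snd z))"
      by (intro nn_integral_mono mult_mono E_G) auto
    also have "\<dots> = (\<integral>+x. G n t x) * (\<integral>+x. G m s x) * ennreal (1 / (t - s)\<^sup>2)"
      by (rule nn_integral_dispersive[OF _ _ ts]) measurable
    also have "\<dots> \<le> (M n t * ennreal (q n)) * (M m s * ennreal (q m)) * ennreal (1 / (t - s)\<^sup>2)"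
      by (intro mult_right_mono mult_mono G_mass) auto
    also have "\<dots> = M n t * M m s * (ennreal (q n) * ennreal (q m) * ennreal (1 / (t - s)\<^sup>2))"
      by (simp only: mult_ac)
    also have "ennreal (q n) * ennreal (q m) * ennreal (1 / (t - s)\<^sup>2) = ennreal (q n * q m / (t - s)\<^sup>2)"
      using q[of n] q[of m] by (simp add: ennreal_mult[symmetric])
    finally show ?thesis .
  qed
  \<comment> \<open>Duality: \<open>|w|^4 / N^2\<close> on a level is \<open>w\<close> times the
    conjugate of \<open>F n\<close>. Fubini moves the transform from \<open>f\<close> to
    \<open>F n\<close>, and the shear moves the transport, so the modulus of the adjoint appears.
    \<open>w\<close> may be replaced by \<open>wave f\<close> because \<open>F n\<close> vanishes
    wherever the two differ.\<close>
  have pairing: "(\<integral>+p. ennreal (cmod (w (t, p)) ^ 4 / (N t)\<^sup>2 * lev n t p)) \<le> (\<integral>+z. ennreal (f z) * E n (t, z))" for n t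
  proof -
    have inner: "(\<integral>+y. ennreal (cmod (w (t, x, y)) ^ 4 / (N t)\<^sup>2 * lev n t (x, y)))
      \<le> (\<integral>+v. ennreal (f (x - t *\<^sub>R v, v)) * ennreal (cmod (e n t x v)))" for x
    proof -
      let ?h = "\<lambda>v. complex_of_real (f (x - t *\<^sub>R v, v))"
      have int_h: "integrable lborel ?h"
        by (rule integrable_bounded_support[where B=B and R=R]) (use f_bounds f_zero in auto)
      have pt: "complex_of_real (cmod (w (t, x, y)) ^ 4 / (N t)\<^sup>2 * lev n t (x, y)) = (\<integral>v. cnj (F n t (x, y)) * (cis ((- y) \<bullet> v) * ?h v) \<partial>lborel)" for y
      proof -
        have "complex_of_real (cmod (w (t, x, y)) ^ 4 / (N t)\<^sup>2 * lev n t (x, y)) = complex_of_real ((cmod (w (t, x, y)))\<^sup>2 / (N t)\<^sup>2 * lev n t (x, y)) * complex_of_real ((cmod (w (t, x, y)))\<^sup>2)"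
          by (simp add: power_numeral_reduce)
        also have "\<dots> = cnj (F n t (x, y)) * w (t, x, y)"
          unfolding F_def complex_norm_square by (simp add: mult_ac)
        also have "\<dots> = cnj (F n t (x, y)) * wave f (t, x, y)"
          by (auto simp: F_def w_def)
        also have "\<dots> = (\<integral>v. cnj (F n t (x, y)) * (cis ((- y) \<bullet> v) * ?h v) \<partial>lborel)"
          unfolding wave_def ft_def by simp
        finally show ?thesis .
      qed
      have pair: "integrable (lborel \<Otimes>\<^sub>M lborel) (\<lambda>(y, v). cnj (F n t (x, y)) * (cis ((- y) \<bullet> v) * ?h v))"
        by (rule Bochner_Integration.integrable_bound[OF integrable_prod_mult[OF int_F[of n t x] int_h]]) (auto simp: norm_mult)
      have int_c: "integrable lborel (\<lambda>y. complex_of_real (cmod (w (t, x, y)) ^ 4 / (N t)\<^sup>2 * lev n t (x, y)))"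
        unfolding pt using lborel_pair.integrable_fst'[OF pair] by simp
      have int_r: "integrable lborel (\<lambda>y. cmod (w (t, x, y)) ^ 4 / (N t)\<^sup>2 * lev n t (x, y))"
        using integrable_Re[OF int_c] by simp
      have "(\<integral>+y. ennreal (cmod (w (t, x, y)) ^ 4 / (N t)\<^sup>2 * lev n t (x, y))) = ennreal (\<integral>y. cmod (w (t, x, y)) ^ 4 / (N t)\<^sup>2 * lev n t (x, y) \<partial>lborel)"
        using lev01 by (intro nn_integral_eq_integral int_r) auto
      also have "\<dots> \<le> ennreal (cmod (complex_of_real (\<integral>y. cmod (w (t, x, y)) ^ 4 / (N t)\<^sup>2 * lev n t (x, y) \<partial>lborel)))"
        by (intro ennreal_leI) (simp only: norm_of_real abs_ge_self)
      also have "complex_of_real (\<integral>y. cmod (w (t, x, y)) ^ 4 / (N t)\<^sup>2 * lev n t (x, y) \<partial>lborel) = (\<integral>y. \<integral>v. cnj (F n t (x, y)) * (cis ((- y) \<bullet> v) * ?h v) \<partial>lborel \<partial>lborel)"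
        unfolding integral_complex_of_real[symmetric] pt ..
      also have "\<dots> = (\<integral>v. \<integral>y. cnj (F n t (x, y)) * (cis ((- y) \<bullet> v) * ?h v) \<partial>lborel \<partial>lborel)"
        using lborel_pair.Fubini_integral[OF pair] by simp
      also have "\<dots> = (\<integral>v. ?h v * cnj (e n t x v) \<partial>lborel)"
      proof (rule Bochner_Integration.integral_cong[OF refl])
        fix v :: plane
        have "(\<integral>y. cnj (F n t (x, y)) * (cis ((- y) \<bullet> v) * ?h v) \<partial>lborel) = (\<integral>y. ?h v * cnj (cis (v \<bullet> y) * F n t (x, y)) \<partial>lborel)"
          by (intro Bochner_Integration.integral_cong) (auto simp: cis_cnj inner_commute mult_ac)
        also have "\<dots> = ?h v * (\<integral>y. cnj (cis (v \<bullet> y) * F n t (x, y)) \<partial>lborel)"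
          by (rule integral_mult_right_zero)
        also have "(\<integral>y. cnj (cis (v \<bullet> y) * F n t (x, y)) \<partial>lborel) = cnj (e n t x v)"
          unfolding e_def ft_def by (rule Bochner_Integration.integral_cnj)
        finally show "(\<integral>y. cnj (F n t (x, y)) * (cis ((- y) \<bullet> v) * ?h v) \<partial>lborel) = ?h v * cnj (e n t x v)" .
      qed
      also have "ennreal (cmod \<dots>) \<le> (\<integral>+v. ennreal (cmod (?h v * cnj (e n t x v))))"
        by (rule norm_integral_le_nn_integral)
      also have "\<dots> = (\<integral>+v. ennreal (f (x - t *\<^sub>R v, v)) * ennreal (cmod (e n t x v)))"
        using f_bounds by (simp add: norm_mult ennreal_mult)
      finally show ?thesis .
    qed
    have "(\<integral>+p. ennreal (cmod (w (t, p)) ^ 4 / (N t)\<^sup>2 * lev n t p)) = (\<integral>+x. \<integral>+y. ennreal (cmod (w (t, x, y)) ^ 4 / (N t)\<^sup>2 * lev n t (x, y)))"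
      by (subst nn_integral_lborel_pair(1)) auto
    also have "\<dots> \<le> (\<integral>+x. \<integral>+v. ennreal (f (x - t *\<^sub>R v, v)) * ennreal (cmod (e n t x v)))"
      by (intro nn_integral_mono inner)
    also have "\<dots> = (\<integral>+z. ennreal (f (fst z - t *\<^sub>R snd z, snd z)) * ennreal (cmod (e n t (fst z) (snd z))))"
      by (subst nn_integral_lborel_pair(1)) auto
    also have "\<dots> = (\<integral>+z. (\<lambda>z. ennreal (f (fst z - t *\<^sub>R snd z, snd z)) * ennreal (cmod (e n t (fst z) (snd z)))) (fst z + t *\<^sub>R snd z, snd z))"
      by (rule nn_integral_shear[symmetric]) measurable
    also have "\<dots> = (\<integral>+z. ennreal (f z) * E n (t, z))"
      by (simp add: E_def)
    finally show ?thesis .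
  qed
  define L2 where "L2 = (\<integral>+z. ennreal ((f z)\<^sup>2))"
  have finite_levels: "(\<integral>+t. \<integral>+p. ennreal (cmod (w (t, p)) ^ 4 / (N t)\<^sup>2 * (\<Sum>n\<in>I. lev n t p))) \<le> ennreal (448 * 4096\<^sup>2) * L2 + ennreal (1 / 2) * D"
    if I: "finite I" for I
  proof -
    define X where "X = (\<lambda>z. \<Sum>n\<in>I. \<integral>+t. E n (t, z))"
    have [measurable]: "X \<in> borel_measurable borel" unfolding X_def by measurable
    have "(\<integral>+t. \<integral>+p. ennreal (cmod (w (t, p)) ^ 4 / (N t)\<^sup>2 * (\<Sum>n\<in>I. lev n t p)))
       = (\<integral>+t. (\<Sum>n\<in>I. \<integral>+p. ennreal (cmod (w (t, p)) ^ 4 / (N t)\<^sup>2 * lev n t p)))"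
      unfolding sum_distrib_left using lev01 by (subst nn_integral_sum[symmetric]) (auto simp: sum_ennreal intro!: nn_integral_cong)
    also have "\<dots> \<le> (\<integral>+t. (\<Sum>n\<in>I. \<integral>+z. ennreal (f z) * E n (t, z)))"
      by (intro nn_integral_mono sum_mono pairing)
    also have "\<dots> = (\<Sum>n\<in>I. \<integral>+t. \<integral>+z. ennreal (f z) * E n (t, z))"
      by (rule nn_integral_sum) measurable
    also have "\<dots> = (\<Sum>n\<in>I. \<integral>+z. \<integral>+t. ennreal (f z) * E n (t, z))"
      by (intro sum.cong refl lborel_pair.Fubini') measurable
    also have "\<dots> = (\<integral>+z. ennreal (f z) * X z)"
      unfolding X_def by (simp add: nn_integral_sum sum_distrib_left nn_integral_cmult)
    \<comment> \<open>The sum of squares of the \<open>M n\<close> integrates to at most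
      \<open>4096 * 4096 * D\<close>, one factor from \<open>64^2\<close> and one from the sum of
      the \<open>c n\<close>. With the 224 of the bilinear bound, a weight of twice
      \<open>224 * 4096^2\<close> leaves exactly \<open>D / 2\<close>.\<close>
    also have "\<dots> \<le> (\<integral>+z. ennreal (448 * 4096\<^sup>2) * (ennreal (f z))\<^sup>2 + ennreal (1 / (448 * 4096\<^sup>2)) * (X z)\<^sup>2)"
      by (intro nn_integral_mono ennreal_mult_le_weighted) simp
    also have "\<dots> = ennreal (448 * 4096\<^sup>2) * L2 + ennreal (1 / (448 * 4096\<^sup>2)) * (\<integral>+z. (X z)\<^sup>2)"
      unfolding L2_def using f_bounds(1) by (subst nn_integral_add) (auto simp: nn_integral_cmult ennreal_power)
    also have "(\<integral>+z. (X z)\<^sup>2) \<le> 224 * (\<Sum>n\<in>I. \<integral>+t. (M n t)\<^sup>2)"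
      unfolding X_def by (rule bilinear_sum_le[where w=q, OF _ _ I _ near far]) (auto simp: q_def)
    also have "(\<Sum>n\<in>I. \<integral>+t. (M n t)\<^sup>2) = (\<integral>+t. ennreal 4096 * ennreal ((N t)\<^sup>2) * (\<Sum>n\<in>I. c n t))"
      by (subst nn_integral_sum[symmetric]) (auto simp: M_def power_mult_distrib ennreal_power N0 sum_distrib_left intro!: nn_integral_cong)
    also have "\<dots> \<le> (\<integral>+t. ennreal 4096 * ennreal ((N t)\<^sup>2) * ennreal 4096)"
      by (intro nn_integral_mono mult_left_mono c_sum I) auto
    also have "\<dots> = (\<integral>+t. ennreal (4096\<^sup>2) * ennreal ((N t)\<^sup>2))"
      by (intro nn_integral_cong) (simp add: mult_ac ennreal_mult[symmetric] ennreal_numeral[symmetric] del: ennreal_numeral)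
    also have "\<dots> = ennreal (4096\<^sup>2) * D"
      unfolding D_def by (rule nn_integral_cmult) measurable
    finally have *: "(\<integral>+t. \<integral>+p. ennreal (cmod (w (t, p)) ^ 4 / (N t)\<^sup>2 * (\<Sum>n\<in>I. lev n t p)))
       \<le> ennreal (448 * 4096\<^sup>2) * L2 + ennreal (1 / (448 * 4096\<^sup>2)) * (224 * (ennreal (4096\<^sup>2) * D))"
      by (auto simp: add_left_mono mult_left_mono)
    have "ennreal (1 / (448 * 4096\<^sup>2)) * (224 * (ennreal (4096\<^sup>2) * D)) = (ennreal (1 / (448 * 4096\<^sup>2)) * (ennreal 224 * ennreal (4096\<^sup>2))) * D"
      by (simp add: mult.assoc)
    also have "ennreal (1 / (448 * 4096\<^sup>2)) * (ennreal 224 * ennreal (4096\<^sup>2)) = ennreal (1 / 2)"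
      by (subst ennreal_mult[symmetric], simp, simp)+ simp
    finally show ?thesis using * by simp
  qed
  \<comment> \<open>Where \<open>N t = 0\<close> both sides are 0, since division by zero gives
    0.\<close>
  have D_eq: "D = (\<integral>+t. \<integral>+p. ennreal (cmod (w (t, p)) ^ 4 / (N t)\<^sup>2))"
    unfolding D_def
  proof (rule nn_integral_cong)
    fix t
    have "(\<integral>+p. ennreal (cmod (w (t, p)) ^ 4 / (N t)\<^sup>2)) = (\<integral>+p. ennreal (cmod (w (t, p)) ^ 4) * ennreal (1 / (N t)\<^sup>2))"
      by (simp add: ennreal_mult[symmetric])
    also have "\<dots> = N4 t * ennreal (1 / (N t)\<^sup>2)"
      unfolding N4_def by (rule nn_integral_multc) measurable
    also have "\<dots> = ennreal ((N t)\<^sup>2)"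
      unfolding N4_eq[symmetric] by (subst ennreal_mult[symmetric]) (auto simp: power_numeral_reduce N0)
    finally show "ennreal ((N t)\<^sup>2) = (\<integral>+p. ennreal (cmod (w (t, p)) ^ 4 / (N t)\<^sup>2))" by simp
  qed
  \<comment> \<open>Where neither \<open>w\<close> nor \<open>N t\<close> is zero, some octave
    contains the point, so the symmetric partial sums eventually reach 1.\<close>
  have lim: "ennreal (cmod (w (t, p)) ^ 4 / (N t)\<^sup>2) \<le> liminf (\<lambda>k. ennreal (cmod (w (t, p)) ^ 4 / (N t)\<^sup>2 * (\<Sum>n\<in>{- int k..int k}. lev n t p)))" for t p
  proof (cases "w (t, p) = 0 \<or> N t = 0")
    case False
    then have pos: "0 < cmod (w (t, p))" "0 < N t" using N0[of t] by auto
    obtain n where n: "lev n t p = 1" using octave_exists[OF pos] by (auto simp: lev_def q_def)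
    have "eventually (\<lambda>k. ennreal (cmod (w (t, p)) ^ 4 / (N t)\<^sup>2) \<le> ennreal (cmod (w (t, p)) ^ 4 / (N t)\<^sup>2 * (\<Sum>n\<in>{- int k..int k}. lev n t p))) sequentially"
    proof (rule eventually_sequentiallyI[of "nat \<bar>n\<bar>"])
      fix k assume "nat \<bar>n\<bar> \<le> k"
      then have "n \<in> {- int k..int k}" by auto
      then have "lev n t p \<le> (\<Sum>n\<in>{- int k..int k}. lev n t p)"
        by (intro member_le_sum) (auto simp: lev01)
      then have "cmod (w (t, p)) ^ 4 / (N t)\<^sup>2 * 1 \<le> cmod (w (t, p)) ^ 4 / (N t)\<^sup>2 * (\<Sum>n\<in>{- int k..int k}. lev n t p)"
        using n by (intro mult_left_mono) auto
      then show "ennreal (cmod (w (t, p)) ^ 4 / (N t)\<^sup>2) \<le> ennreal (cmod (w (t, p)) ^ 4 / (N t)\<^sup>2 * (\<Sum>n\<in>{- int k..int k}. lev n t p))"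
        by (intro ennreal_leI) simp
    qed
    then show ?thesis by (rule Liminf_bounded)
  qed auto
  have "D \<le> (\<integral>+t. \<integral>+p. liminf (\<lambda>k. ennreal (cmod (w (t, p)) ^ 4 / (N t)\<^sup>2 * (\<Sum>n\<in>{- int k..int k}. lev n t p))))"
    unfolding D_eq by (intro nn_integral_mono lim)
  also have "\<dots> \<le> (\<integral>+t. liminf (\<lambda>k. \<integral>+p. ennreal (cmod (w (t, p)) ^ 4 / (N t)\<^sup>2 * (\<Sum>n\<in>{- int k..int k}. lev n t p))))"
    by (intro nn_integral_mono nn_integral_liminf) measurable
  also have "\<dots> \<le> liminf (\<lambda>k. \<integral>+t. \<integral>+p. ennreal (cmod (w (t, p)) ^ 4 / (N t)\<^sup>2 * (\<Sum>n\<in>{- int k..int k}. lev n t p)))"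
    by (intro nn_integral_liminf) measurable
  also have "\<dots> \<le> liminf (\<lambda>k. ennreal (448 * 4096\<^sup>2) * L2 + ennreal (1 / 2) * D)"
    by (intro Liminf_mono always_eventually allI finite_levels) simp
  also have "\<dots> = ennreal (448 * 4096\<^sup>2) * L2 + ennreal (1 / 2) * D" by (simp add: Liminf_const)
  finally have main: "D \<le> ennreal (448 * 4096\<^sup>2) * L2 + ennreal (1 / 2) * D" .
  \<comment> \<open>Subtracting \<open>D / 2\<close> is legitimate because \<open>D\<close> is
    finite; it doubles 448 to 896.\<close>
  have "D \<le> ennreal (896 * 4096\<^sup>2) * L2"
  proof (cases L2)
    case top
    then show ?thesis by (simp add: ennreal_mult_top)
  next
    case (real l)
    from D_fin obtain d where d: "D = ennreal d" "0 \<le> d" by (cases D) auto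
    have "ennreal (448 * 4096\<^sup>2 * l + 1 / 2 * d) = ennreal (448 * 4096\<^sup>2 * l) + ennreal (1 / 2 * d)"
      by (rule ennreal_plus) (use d real in auto)
    also have "ennreal (448 * 4096\<^sup>2 * l) = ennreal (448 * 4096\<^sup>2) * ennreal l"
      by (rule ennreal_mult) (use real in auto)
    also have "ennreal (1 / 2 * d) = ennreal (1 / 2) * ennreal d"
      by (rule ennreal_mult) (use d in auto)
    finally have "ennreal d \<le> ennreal (448 * 4096\<^sup>2 * l + 1 / 2 * d)" using main unfolding d real by simp
    then have "d \<le> 448 * 4096\<^sup>2 * l + 1 / 2 * d"
      using d real by (subst (asm) ennreal_le_iff) auto
    then have "ennreal d \<le> ennreal (896 * 4096\<^sup>2 * l)" by (intro ennreal_leI) simp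
    then show ?thesis unfolding d real using real by (subst ennreal_mult[symmetric]) auto
  qed
  then show ?thesis unfolding D_def esqrt_N4[symmetric] L2_def N4_def .
qed

text \<open>The truncated bound does not depend on \<open>T\<close>, so Fatou in phase space and
  then in time removes the truncation.\<close>

lemma strichartz_wave:
  fixes f :: "plane \<times> plane \<Rightarrow> real"
  assumes f [measurable]: "f \<in> borel_measurable borel" and f_bounds: "\<And>z. 0 \<le> f z" "\<And>z. f z \<le> B" "\<And>z. R < norm z \<Longrightarrow> f z = 0"
  shows "(\<integral>+t. esqrt (\<integral>+p. ennreal (cmod (wave f (t, p)) ^ 4))) \<le> ennreal (896 * 4096\<^sup>2) * (\<integral>+z. ennreal ((f z)\<^sup>2))"
proof -
  define w where "w = (\<lambda>k p. if \<bar>fst p\<bar> \<le> real (Suc k) \<and> norm (snd (snd p)) \<le> real (Suc k) then wave f p else 0)"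
  have [measurable]: "w k \<in> borel_measurable borel" for k unfolding w_def by measurable
  have lim: "ennreal (cmod (wave f p) ^ 4) = liminf (\<lambda>k. ennreal (cmod (w k p) ^ 4))" for p
  proof -
    obtain k0 where k0: "max \<bar>fst p\<bar> (norm (snd (snd p))) \<le> real k0" using real_arch_simple by blast
    have "\<forall>\<^sub>F k in sequentially. ennreal (cmod (w k p) ^ 4) = ennreal (cmod (wave f p) ^ 4)"
      by (rule eventually_sequentiallyI[of k0]) (use k0 in \<open>auto simp: w_def\<close>)
    then have "(\<lambda>k. ennreal (cmod (w k p) ^ 4)) \<longlonglongrightarrow> ennreal (cmod (wave f p) ^ 4)" by (rule tendsto_eventually)
    from lim_imp_Liminf[OF sequentially_bot this] show ?thesis by simp
  qed
  have "(\<integral>+t. esqrt (\<integral>+p. ennreal (cmod (wave f (t, p)) ^ 4)))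
     \<le> (\<integral>+t. esqrt (liminf (\<lambda>k. \<integral>+p. ennreal (cmod (w k (t, p)) ^ 4))))"
    unfolding lim by (intro nn_integral_mono esqrt_mono nn_integral_liminf) measurable
  also have "\<dots> \<le> liminf (\<lambda>k. \<integral>+t. esqrt (\<integral>+p. ennreal (cmod (w k (t, p)) ^ 4)))"
    unfolding esqrt_liminf by (rule nn_integral_liminf) measurable
  also have "\<dots> \<le> liminf (\<lambda>k. ennreal (896 * 4096\<^sup>2) * (\<integral>+z. ennreal ((f z)\<^sup>2)))"
  proof (intro Liminf_mono always_eventually allI)
    fix k
    show "(\<integral>+t. esqrt (\<integral>+p. ennreal (cmod (w k (t, p)) ^ 4))) \<le> ennreal (896 * 4096\<^sup>2) * (\<integral>+z. ennreal ((f z)\<^sup>2))"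
      unfolding w_def by (rule strichartz_wave_truncated[OF f f_bounds]) auto
  qed
  finally show ?thesis by (simp add: Liminf_const)
qed

section \<open>Autocorrelation energy and passage to general densities\<close>

definition autocorr :: "(plane \<times> plane \<Rightarrow> real) \<Rightarrow> real \<Rightarrow> plane \<Rightarrow> plane \<Rightarrow> ennreal" where
  "autocorr f t x w = (\<integral>+v. ennreal (f (x - t *\<^sub>R v, v)) * ennreal (f (x - t *\<^sub>R (v + w), v + w)))"

definition autocorr_energy :: "(plane \<times> plane \<Rightarrow> real) \<Rightarrow> real \<Rightarrow> ennreal" where
  "autocorr_energy f t = (\<integral>+x. \<integral>+w. (autocorr f t x w)\<^sup>2)"

lemma measurable_autocorr [measurable (raw)]:
  assumes [measurable]: "f \<in> borel_measurable borel" "a \<in> borel_measurable M" "b \<in> borel_measurable M" "c \<in> borel_measurable M"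
  shows "(\<lambda>p. autocorr f (a p) (b p) (c p)) \<in> borel_measurable M"
  unfolding autocorr_def by measurable

lemma measurable_autocorr_energy [measurable]:
  assumes [measurable]: "f \<in> borel_measurable borel"
  shows "autocorr_energy f \<in> borel_measurable borel"
  unfolding autocorr_energy_def[abs_def] by measurable

text \<open>On each spatial slice the autocorrelation is compared with the fourth power of the wave;
  continuity of \<open>f\<close> is what the lower half of Plancherel asks for there.\<close>

lemma strichartz_continuous:
  fixes f :: "plane \<times> plane \<Rightarrow> real"
  assumes f: "continuous_on UNIV f" and f_bounds: "\<And>z. 0 \<le> f z" "\<And>z. f z \<le> B" "\<And>z. R < norm z \<Longrightarrow> f z = 0"
  shows "(\<integral>+t. esqrt (autocorr_energy f t)) \<le> ennreal (896 * 4096\<^sup>2) * (\<integral>+z. ennreal ((f z)\<^sup>2))"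
proof -
  have [measurable]: "f \<in> borel_measurable borel" using f by (rule borel_measurable_continuous_onI)
  have "autocorr_energy f t \<le> (\<integral>+p. ennreal (cmod (wave f (t, p)) ^ 4))" for t
  proof -
    have *: "(\<integral>+w. (autocorr f t x w)\<^sup>2) \<le> (\<integral>+y. ennreal (cmod (wave f (t, x, y)) ^ 4))" for x
      unfolding autocorr_def wave_def split
    proof (rule nn_integral_autocorrelation_square_le[where h="\<lambda>v. f (x - t *\<^sub>R v, v)" and B=B and R=R])
      show "continuous_on UNIV (\<lambda>v. f (x - t *\<^sub>R v, v))"
        by (rule continuous_on_compose2[OF f]) (auto intro!: continuous_intros)
      show "f (x - t *\<^sub>R v, v) = 0" if "R < norm v" for v
        using that norm_snd_le[of v "x - t *\<^sub>R v"] by (intro f_bounds(3)) auto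
    qed (use f_bounds in auto)
    have "autocorr_energy f t \<le> (\<integral>+x. \<integral>+y. ennreal (cmod (wave f (t, x, y)) ^ 4))"
      unfolding autocorr_energy_def by (rule nn_integral_mono) (rule *)
    also have "\<dots> = (\<integral>+p. ennreal (cmod (wave f (t, p)) ^ 4))"
      by (subst nn_integral_lborel_pair(1)) auto
    finally show ?thesis .
  qed
  then have "(\<integral>+t. esqrt (autocorr_energy f t)) \<le> (\<integral>+t. esqrt (\<integral>+p. ennreal (cmod (wave f (t, p)) ^ 4)))"
    by (intro nn_integral_mono esqrt_mono)
  also have "\<dots> \<le> ennreal (896 * 4096\<^sup>2) * (\<integral>+z. ennreal ((f z)\<^sup>2))"
    by (rule strichartz_wave[OF _ f_bounds]) measurable
  finally show ?thesis .
qed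

lemma AE_lborel_null_cover:
  assumes "AE z in (lborel :: 'a::euclidean_space measure). P z"
  obtains N where "N \<in> sets borel" "emeasure lborel N = 0" "\<And>z. z \<notin> N \<Longrightarrow> P z"
  using assms by (elim AE_E) auto

lemma nn_integral_indicator_zero_iff:
  fixes g :: "'a::euclidean_space \<Rightarrow> 'b::euclidean_space"
  assumes [measurable]: "g \<in> borel_measurable borel" "N \<in> sets borel"
  shows "(\<integral>+v. indicator N (g v)) = 0 \<longleftrightarrow> (AE v in lborel. g v \<notin> N)"
  by (subst nn_integral_0_iff_AE) (auto simp: indicator_def of_bool_def)

text \<open>Lower semicontinuity, by Fatou at every level of integration. The delicate point is that
  almost everywhere convergence on the phase space must be restricted to slices.\<close>

lemma strichartz_liminf:
  fixes f :: "plane \<times> plane \<Rightarrow> real" and F :: "nat \<Rightarrow> plane \<times> plane \<Rightarrow> real"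
  assumes [measurable]: "f \<in> borel_measurable borel" "\<And>k. F k \<in> borel_measurable borel"
    and lim: "AE z in lborel. (\<lambda>k. F k z) \<longlonglongrightarrow> f z"
  shows "(\<integral>+t. esqrt (autocorr_energy f t)) \<le> liminf (\<lambda>k. \<integral>+t. esqrt (autocorr_energy (F k) t))"
proof -
  obtain N where N [measurable]: "N \<in> sets borel" and N0: "emeasure lborel N = 0" and limN: "\<And>z. z \<notin> N \<Longrightarrow> (\<lambda>k. F k z) \<longlonglongrightarrow> f z"
    by (rule AE_lborel_null_cover[OF lim]) blast
  have energy: "autocorr_energy f t \<le> liminf (\<lambda>k. autocorr_energy (F k) t)" for t
  proof -
    have "(\<integral>+z. indicator N (fst z + (- t) *\<^sub>R snd z, snd z)) = (\<integral>+z. indicator N z)"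
      by (rule nn_integral_shear) measurable
    then have "(\<integral>+z. indicator N (fst z - t *\<^sub>R snd z, snd z)) = 0"
      using N0 by simp
    then have "(\<integral>+x. \<integral>+v. indicator N (x - t *\<^sub>R v, v)) = 0"
      by (subst (asm) nn_integral_lborel_pair(1)) auto
    \<comment> \<open>Transport preserves measure, so the moved exceptional set is null and almost
      every position has a null velocity section. Translating that section by \<open>w\<close> keeps
      it null, which handles the second factor of the autocorrelation for every
      \<open>w\<close>.\<close>
    then have ae: "AE x in lborel. (\<integral>+v. indicator N (x - t *\<^sub>R v, v)) = 0"
      by (subst (asm) nn_integral_0_iff_AE) auto
    have pt: "autocorr f t x w \<le> liminf (\<lambda>k. autocorr (F k) t x w)"
      if x: "(\<integral>+v. indicator N (x - t *\<^sub>R v, v)) = 0" for x w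
    proof -
      have x': "(\<integral>+v. indicator N (x - t *\<^sub>R (v + w), v + w)) = 0"
        using nn_integral_lborel_translate[of "\<lambda>v. indicator N (x - t *\<^sub>R v, v)" w] x by (simp add: add.commute)
      have "AE v in lborel. (x - t *\<^sub>R v, v) \<notin> N"
        using x by (subst (asm) nn_integral_indicator_zero_iff) auto
      moreover have "AE v in lborel. (x - t *\<^sub>R (v + w), v + w) \<notin> N"
        using x' by (subst (asm) nn_integral_indicator_zero_iff) auto
      ultimately have "AE v in lborel. ennreal (f (x - t *\<^sub>R v, v)) * ennreal (f (x - t *\<^sub>R (v + w), v + w))
         = liminf (\<lambda>k. ennreal (F k (x - t *\<^sub>R v, v)) * ennreal (F k (x - t *\<^sub>R (v + w), v + w)))"
      proof eventually_elim
        case (elim v)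
        then show ?case
          by (intro lim_imp_Liminf[symmetric] tendsto_mult_ennreal tendsto_ennrealI limN) auto
      qed
      then have "autocorr f t x w = (\<integral>+v. liminf (\<lambda>k. ennreal (F k (x - t *\<^sub>R v, v)) * ennreal (F k (x - t *\<^sub>R (v + w), v + w))))"
        unfolding autocorr_def by (rule nn_integral_cong_AE)
      also have "\<dots> \<le> liminf (\<lambda>k. autocorr (F k) t x w)"
        unfolding autocorr_def by (rule nn_integral_liminf) measurable
      finally show ?thesis .
    qed
    have "autocorr_energy f t \<le> (\<integral>+x. \<integral>+w. liminf (\<lambda>k. (autocorr (F k) t x w)\<^sup>2))"
      unfolding autocorr_energy_def Liminf_power2_ennreal
      by (intro nn_integral_mono_AE) (use ae in \<open>eventually_elim, auto intro!: nn_integral_mono power_mono pt\<close>)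
    also have "\<dots> \<le> (\<integral>+x. liminf (\<lambda>k. \<integral>+w. (autocorr (F k) t x w)\<^sup>2))"
      by (intro nn_integral_mono nn_integral_liminf) measurable
    also have "\<dots> \<le> liminf (\<lambda>k. autocorr_energy (F k) t)"
      unfolding autocorr_energy_def by (rule nn_integral_liminf) measurable
    finally show ?thesis .
  qed
  have "(\<integral>+t. esqrt (autocorr_energy f t)) \<le> (\<integral>+t. liminf (\<lambda>k. esqrt (autocorr_energy (F k) t)))"
    unfolding esqrt_liminf[symmetric] by (intro nn_integral_mono esqrt_mono energy)
  also have "\<dots> \<le> liminf (\<lambda>k. \<integral>+t. esqrt (autocorr_energy (F k) t))"
    by (rule nn_integral_liminf) measurable
  finally show ?thesis .
qed

lemma measurable_cball_borel [measurable]: "cball c r \<in> sets borel"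
  by (simp add: borel_closed)

text \<open>A measurable function is an almost everywhere limit of continuous ones. Clipping these
  to \<open>[0, B]\<close> and multiplying by a cutoff preserves the limit and supplies the
  domination needed for convergence of the L^2 norms.\<close>

lemma strichartz_bounded_support:
  fixes f :: "plane \<times> plane \<Rightarrow> real"
  assumes f [measurable]: "f \<in> borel_measurable borel" and f_bounds: "\<And>z. 0 \<le> f z" "\<And>z. f z \<le> B" "\<And>z. R < norm z \<Longrightarrow> f z = 0"
  shows "(\<integral>+t. esqrt (autocorr_energy f t)) \<le> ennreal (896 * 4096\<^sup>2) * (\<integral>+z. ennreal ((f z)\<^sup>2))"
proof -
  have B: "0 \<le> B" using f_bounds(1)[of 0] f_bounds(2)[of 0] by simp
  have "f measurable_on UNIV"
    by (rule lebesgue_measurable_imp_measurable_on) (auto intro!: measurable_completion)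
  then obtain N g where N: "negligible N" and g: "\<And>n. continuous_on UNIV (g n)"
    and gf: "\<And>z. z \<notin> N \<Longrightarrow> (\<lambda>n. g n z) \<longlonglongrightarrow> f z"
    unfolding measurable_on_def by auto
  \<comment> \<open>Equal to 1 on the ball of radius \<open>R\<close>, which carries
    \<open>f\<close>, and 0 beyond radius \<open>R + 1\<close>.\<close>
  define cut where "cut = (\<lambda>z :: plane \<times> plane. max 0 (min 1 (R + 1 - norm z)))"
  define F where "F = (\<lambda>n z. min B (max 0 (g n z)) * cut z)"
  have contF: "continuous_on UNIV (F n)" for n
    unfolding F_def cut_def by (intro continuous_intros g)
  have [measurable]: "F n \<in> borel_measurable borel" for n
    using contF by (rule borel_measurable_continuous_onI)
  have F0: "0 \<le> F n z" for n z using B by (simp add: F_def cut_def)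
  have FB: "F n z \<le> B" for n z
  proof -
    have "F n z \<le> B * 1" unfolding F_def using B by (intro mult_mono) (auto simp: cut_def)
    then show ?thesis by simp
  qed
  have FR: "F n z = 0" if "R + 1 < norm z" for n z using that by (simp add: F_def cut_def)
  have Flim: "(\<lambda>n. F n z) \<longlonglongrightarrow> f z" if "z \<notin> N" for z
  proof -
    have "(\<lambda>n. F n z) \<longlonglongrightarrow> min B (max 0 (f z)) * cut z"
      unfolding F_def by (intro tendsto_intros gf that)
    also have "min B (max 0 (f z)) = f z" using f_bounds(1,2)[of z] by simp
    also have "f z * cut z = f z"
      using f_bounds(3)[of z] by (cases "R < norm z") (auto simp: cut_def)
    finally show ?thesis .
  qed
  have ae: "AE z in lborel. (\<lambda>n. F n z) \<longlonglongrightarrow> f z"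
  proof -
    have "AE z in lebesgue. z \<notin> N" using N by (simp add: negligible_iff_null_sets AE_not_in)
    then have "AE z in lebesgue. (\<lambda>n. F n z) \<longlonglongrightarrow> f z" by eventually_elim (rule Flim)
    then show ?thesis by (simp add: AE_completion_iff)
  qed
  have "(\<lambda>n. \<integral>+z. ennreal ((F n z)\<^sup>2)) \<longlonglongrightarrow> (\<integral>+z. ennreal ((f z)\<^sup>2))"
  proof (rule nn_integral_dominated_convergence[where w="\<lambda>z. ennreal (B\<^sup>2) * indicator (cball 0 (R + 1)) z"])
    show "(\<integral>+z. ennreal (B\<^sup>2) * indicator (cball 0 (R + 1)) (z :: plane \<times> plane)) < \<infinity>"
      using emeasure_lborel_cball_finite[of "0 :: plane \<times> plane" "R + 1"]
      by (subst nn_integral_cmult_indicator) (auto simp: ennreal_mult_less_top)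
    show "AE z in lborel. ennreal ((F n z)\<^sup>2) \<le> ennreal (B\<^sup>2) * indicator (cball 0 (R + 1)) z" for n
    proof (rule AE_I2)
      fix z
      show "ennreal ((F n z)\<^sup>2) \<le> ennreal (B\<^sup>2) * indicator (cball 0 (R + 1)) z"
        using FR[of z n] power_mono[OF FB[of n z] F0[of n z], of 2]
        by (cases "R + 1 < norm z") (auto intro!: ennreal_leI)
    qed
    show "AE z in lborel. (\<lambda>n. ennreal ((F n z)\<^sup>2)) \<longlonglongrightarrow> ennreal ((f z)\<^sup>2)"
      using ae by eventually_elim (intro tendsto_intros tendsto_ennrealI)
  qed measurable
  have "(\<lambda>n. ennreal (896 * 4096\<^sup>2) * (\<integral>+z. ennreal ((F n z)\<^sup>2))) \<longlonglongrightarrow> ennreal (896 * 4096\<^sup>2) * (\<integral>+z. ennreal ((f z)\<^sup>2))"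
    by (intro tendsto_mult_ennreal tendsto_const) (use \<open>(\<lambda>n. \<integral>+z. ennreal ((F n z)\<^sup>2)) \<longlonglongrightarrow> _\<close> in auto)
  then have lim: "liminf (\<lambda>n. ennreal (896 * 4096\<^sup>2) * (\<integral>+z. ennreal ((F n z)\<^sup>2))) = ennreal (896 * 4096\<^sup>2) * (\<integral>+z. ennreal ((f z)\<^sup>2))"
    by (intro lim_imp_Liminf) auto
  have "(\<integral>+t. esqrt (autocorr_energy f t)) \<le> liminf (\<lambda>n. \<integral>+t. esqrt (autocorr_energy (F n) t))"
    by (rule strichartz_liminf[OF _ _ ae]) measurable
  also have "\<dots> \<le> liminf (\<lambda>n. ennreal (896 * 4096\<^sup>2) * (\<integral>+z. ennreal ((F n z)\<^sup>2)))"
    by (intro Liminf_mono always_eventually allI strichartz_continuous[OF contF F0 FB FR])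
  finally show ?thesis unfolding lim .
qed

lemma strichartz_endpoint:
  fixes f :: "plane \<times> plane \<Rightarrow> real"
  assumes f [measurable]: "f \<in> borel_measurable borel" and f0: "\<And>z. 0 \<le> f z"
  shows "(\<integral>+t. esqrt (autocorr_energy f t)) \<le> ennreal (896 * 4096\<^sup>2) * (\<integral>+z. ennreal ((f z)\<^sup>2))"
proof -
  define F where "F = (\<lambda>k z. if norm z \<le> real k then min (f z) (real k) else 0)"
  have [measurable]: "F k \<in> borel_measurable borel" for k unfolding F_def by measurable
  have lim: "(\<lambda>k. F k z) \<longlonglongrightarrow> f z" for z
  proof -
    obtain k0 where k0: "max (f z) (norm z) \<le> real k0" using real_arch_simple by blast
    have "\<forall>\<^sub>F k in sequentially. F k z = f z"
      by (rule eventually_sequentiallyI[of k0]) (use k0 in \<open>auto simp: F_def\<close>)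
    then show ?thesis by (rule tendsto_eventually)
  qed
  have F_le: "F k z \<le> f z" and F0: "0 \<le> F k z" for k z using f0[of z] by (auto simp: F_def)
  have "(\<integral>+t. esqrt (autocorr_energy f t)) \<le> liminf (\<lambda>k. \<integral>+t. esqrt (autocorr_energy (F k) t))"
    by (rule strichartz_liminf) (auto simp: lim)
  also have "\<dots> \<le> liminf (\<lambda>k. ennreal (896 * 4096\<^sup>2) * (\<integral>+z. ennreal ((f z)\<^sup>2)))"
  proof (intro Liminf_mono always_eventually allI)
    fix k
    have "(\<integral>+t. esqrt (autocorr_energy (F k) t)) \<le> ennreal (896 * 4096\<^sup>2) * (\<integral>+z. ennreal ((F k z)\<^sup>2))"
      by (rule strichartz_bounded_support[where B="real k" and R="real k"]) (auto simp: F_def f0)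
    also have "\<dots> \<le> ennreal (896 * 4096\<^sup>2) * (\<integral>+z. ennreal ((f z)\<^sup>2))"
      by (intro mult_left_mono nn_integral_mono ennreal_leI power_mono F_le F0) auto
    finally show "(\<integral>+t. esqrt (autocorr_energy (F k) t)) \<le> ennreal (896 * 4096\<^sup>2) * (\<integral>+z. ennreal ((f z)\<^sup>2))" .
  qed
  finally show ?thesis by (simp add: Liminf_const)
qed

section \<open>The gain operator at a fixed time\<close>

definition quarter_turn :: "plane \<Rightarrow> plane" where
  "quarter_turn w = vector [- (w $ 2), w $ 1]"

text \<open>Rotation by \<open>\<theta>\<close>, that is, multiplication by \<open>cis \<theta>\<close> under the identification of the plane with the complex numbers.\<close>

definition rot :: "real \<Rightarrow> plane \<Rightarrow> plane" where
  "rot \<theta> w = cos \<theta> *\<^sub>R w + sin \<theta> *\<^sub>R quarter_turn w"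

lemma rot_nth: "rot \<theta> w $ 1 = cos \<theta> * w $ 1 - sin \<theta> * w $ 2" "rot \<theta> w $ 2 = cos \<theta> * w $ 2 + sin \<theta> * w $ 1"
  by (simp_all add: rot_def quarter_turn_def)

lemma linear_rot: "linear (rot \<theta>)"
  by (rule linearI) (simp_all add: vec_eq_iff forall_2 rot_nth algebra_simps)

lemma norm_rot: "norm (rot \<theta> w) = norm w"
proof -
  have "(cos \<theta> * a - sin \<theta> * b)\<^sup>2 + (cos \<theta> * b + sin \<theta> * a)\<^sup>2 = ((sin \<theta>)\<^sup>2 + (cos \<theta>)\<^sup>2) * (a\<^sup>2 + b\<^sup>2)" for a b
    by algebra
  then show ?thesis
    by (simp add: norm_vec_def L2_set_def sum_2 rot_nth)
qed

lemma rot_rot: "rot \<alpha> (rot \<beta> w) = rot (\<alpha> + \<beta>) w"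
  by (simp add: vec_eq_iff forall_2 rot_nth cos_add sin_add algebra_simps)

lemma rot_0 [simp]: "rot 0 w = w"
  by (simp add: rot_def)

lemma continuous_quarter_turn: "continuous_on UNIV quarter_turn"
  by (rule linear_continuous_on, rule linear_conv_bounded_linear[THEN iffD1], rule linearI)
    (simp_all add: vec_eq_iff forall_2 quarter_turn_def)

lemma measurable_quarter_turn [measurable]: "quarter_turn \<in> borel_measurable borel"
  by (rule borel_measurable_continuous_onI[OF continuous_quarter_turn])

lemma measurable_rot [measurable (raw)]:
  assumes [measurable]: "a \<in> borel_measurable M" "b \<in> borel_measurable M"
  shows "(\<lambda>x. rot (a x) (b x)) \<in> borel_measurable M"
  unfolding rot_def by measurable

lemma nn_integral_rot:
  fixes f :: "plane \<Rightarrow> ennreal"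
  assumes [measurable]: "f \<in> borel_measurable borel"
  shows "(\<integral>+w. f (rot \<theta> w)) = (\<integral>+w. f w)"
proof -
  have "lborel = distr lborel borel (rot \<theta>)"
  proof (rule lborel_eqI)
    fix l u :: plane assume lu: "\<And>b. b \<in> Basis \<Longrightarrow> l \<bullet> b \<le> u \<bullet> b"
    have o: "orthogonal_transformation (rot (- \<theta>))"
      by (simp add: orthogonal_transformation linear_rot norm_rot)
    have pre: "rot \<theta> -` box l u = rot (- \<theta>) ` box l u"
    proof -
      have "rot \<theta> (rot (- \<theta>) w) = w" "rot (- \<theta>) (rot \<theta> w) = w" for w by (simp_all add: rot_rot)
      then show ?thesis by (auto simp: image_iff) metis
    qed
    have box: "box l u \<in> lmeasurable" by simp
    have [measurable]: "rot \<theta> -` box l u \<in> sets borel"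
      using measurable_sets[of "rot \<theta>" borel borel "box l u"] by simp
    have "emeasure (distr lborel borel (rot \<theta>)) (box l u) = emeasure lborel (rot \<theta> -` box l u)"
      by (subst emeasure_distr) auto
    also have "\<dots> = emeasure lebesgue (rot (- \<theta>) ` box l u)"
      using pre \<open>rot \<theta> -` box l u \<in> sets borel\<close> by simp
    also have "\<dots> = ennreal (measure lebesgue (rot (- \<theta>) ` box l u))"
      by (rule emeasure_eq_measure2[OF measurable_orthogonal_image[OF o box]])
    also have "\<dots> = emeasure lborel (box l u)"
      using emeasure_eq_measure2[OF box] by (simp add: measure_orthogonal_image[OF o box])
    also have "\<dots> = (\<Prod>b\<in>Basis. (u - l) \<bullet> b)" using lu by (rule emeasure_lborel_box)
    finally show "emeasure (distr lborel borel (rot \<theta>)) (box l u) = (\<Prod>b\<in>Basis. (u - l) \<bullet> b)" .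
  qed simp
  then have "(\<integral>+w. f w) = (\<integral>\<^sup>+w. f w \<partial>distr lborel borel (rot \<theta>))" by simp
  also have "\<dots> = (\<integral>+w. f (rot \<theta> w))" by (subst nn_integral_distr) auto
  finally show ?thesis by simp
qed

lemma nn_integral_scaled_rot:
  fixes f :: "plane \<Rightarrow> ennreal"
  assumes [measurable]: "f \<in> borel_measurable borel" and "c \<noteq> 0"
  shows "(\<integral>+w. f (c *\<^sub>R rot \<theta> w)) = ennreal (1 / c\<^sup>2) * (\<integral>+w. f w)"
proof -
  have "(\<integral>+w. f (c *\<^sub>R rot \<theta> w)) = (\<integral>+w. f (c *\<^sub>R w))"
    using nn_integral_rot[of "\<lambda>w. f (c *\<^sub>R w)" \<theta>] by simp
  also have "\<dots> = (ennreal (1 / c\<^sup>2) * ennreal (c\<^sup>2)) * (\<integral>+w. f (c *\<^sub>R w))"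
    using assms(2) by (subst ennreal_mult[symmetric]) auto
  also have "\<dots> = ennreal (1 / c\<^sup>2) * (ennreal (\<bar>c\<bar> ^ DIM(plane)) * (\<integral>+w. f (c *\<^sub>R w)))"
    by (simp add: mult.assoc)
  finally show ?thesis by (subst nn_integral_lborel_scale[OF assms]) simp
qed

lemma circle_point_nth [simp]: "circle_point \<theta> $ 1 = cos \<theta>" "circle_point \<theta> $ 2 = sin \<theta>"
  by (simp_all add: circle_point_def)

lemma measurable_circle_point [measurable]: "circle_point \<in> borel_measurable borel"
proof -
  have *: "circle_point = (\<lambda>\<theta>. rot \<theta> (vector [1, 0]))"
    by (auto simp: fun_eq_iff vec_eq_iff forall_2 rot_nth)
  show ?thesis unfolding * by measurable
qed

lemma plane_polar:
  fixes w :: plane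
  obtains \<phi> where "0 \<le> \<phi>" "\<phi> \<le> 2 * pi" "w = norm w *\<^sub>R circle_point \<phi>"
proof (cases "w = 0")
  case True
  then show ?thesis using that[of 0] by simp
next
  case False
  have eq: "(norm w)\<^sup>2 = (w $ 1)\<^sup>2 + (w $ 2)\<^sup>2"
    by (simp add: norm_vec_def L2_set_def sum_2 sum_nonneg)
  have "(w $ 1 / norm w)\<^sup>2 + (w $ 2 / norm w)\<^sup>2 = ((w $ 1)\<^sup>2 + (w $ 2)\<^sup>2) / (norm w)\<^sup>2"
    by (simp add: power_divide add_divide_distrib)
  also have "\<dots> = 1" unfolding eq[symmetric] using False by simp
  finally have "(w $ 1 / norm w)\<^sup>2 + (w $ 2 / norm w)\<^sup>2 = 1" .
  then obtain t where t: "0 \<le> t" "t < 2 * pi" "w $ 1 / norm w = cos t" "w $ 2 / norm w = sin t"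
    by (rule sincos_total_2pi)
  have "w $ 1 = norm w * cos t" "w $ 2 = norm w * sin t"
    unfolding t(3,4)[symmetric] using False by simp_all
  then have "w = norm w *\<^sub>R circle_point t"
    unfolding vec_eq_iff forall_2 by simp
  then show ?thesis using that[of t] t by simp
qed

text \<open>In complex notation, projecting \<open>r e^(i phi)\<close> onto direction
  \<open>theta + phi\<close> gives \<open>r cos(theta) e^(i (theta + phi))\<close>. Relative to the
  vector itself this is multiplication by a fixed complex number, hence linear.\<close>

lemma circle_point_projection:
  "(circle_point (\<theta> + \<phi>) \<bullet> (r *\<^sub>R circle_point \<phi>)) *\<^sub>R circle_point (\<theta> + \<phi>) = cos \<theta> *\<^sub>R rot \<theta> (r *\<^sub>R circle_point \<phi>)"
proof -
  have "circle_point (\<theta> + \<phi>) \<bullet> circle_point \<phi> = cos (\<theta> + \<phi>) * cos \<phi> + sin (\<theta> + \<phi>) * sin \<phi>"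
    by (simp add: inner_vec_def sum_2)
  also have "\<dots> = cos \<theta>" using cos_diff[of "\<theta> + \<phi>" \<phi>] by simp
  finally have *: "circle_point (\<theta> + \<phi>) \<bullet> (r *\<^sub>R circle_point \<phi>) = r * cos \<theta>" by simp
  show ?thesis
    unfolding * by (simp add: vec_eq_iff forall_2 rot_nth cos_add sin_add algebra_simps)
qed

lemma nn_integral_periodic_shift:
  fixes h :: "real \<Rightarrow> ennreal"
  assumes [measurable]: "h \<in> borel_measurable borel" and per: "\<And>s. h (s + 2 * pi) = h s" and \<phi>: "0 \<le> \<phi>" "\<phi> \<le> 2 * pi"
  shows "(\<integral>+\<theta>. indicator {0..2 * pi} \<theta> * h (\<theta> + \<phi>)) = (\<integral>+\<theta>. indicator {0..2 * pi} \<theta> * h \<theta>)"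
proof -
  \<comment> \<open>Half-open intervals can be cut and shifted without overlapping
    endpoints.\<close>
  have half_open: "(\<integral>+\<theta>. indicator {0..2 * pi} \<theta> * k \<theta>) = (\<integral>+\<theta>. indicator {0<..2 * pi} \<theta> * k \<theta>)" for k :: "real \<Rightarrow> ennreal"
    by (rule nn_integral_cong_AE, rule eventually_mono[OF AE_lborel_singleton[of 0]]) (auto split: split_indicator)
  have "(\<integral>+\<theta>. indicator {0<..2 * pi} \<theta> * h (\<theta> + \<phi>)) = (\<integral>+\<theta>. (\<lambda>s. indicator {\<phi><..\<phi> + 2 * pi} s * h s) (\<phi> + \<theta>))"
    by (intro nn_integral_cong) (auto simp: add.commute split: split_indicator)
  also have "\<dots> = (\<integral>+s. indicator {\<phi><..\<phi> + 2 * pi} s * h s)"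
    by (rule nn_integral_lborel_translate) measurable
  also have "\<dots> = (\<integral>+s. indicator {\<phi><..2 * pi} s * h s + indicator {2 * pi<..\<phi> + 2 * pi} s * h s)"
    using \<phi> by (intro nn_integral_cong) (auto split: split_indicator)
  also have "\<dots> = (\<integral>+s. indicator {\<phi><..2 * pi} s * h s) + (\<integral>+s. indicator {2 * pi<..\<phi> + 2 * pi} s * h s)"
    by (rule nn_integral_add) measurable
  also have "(\<integral>+s. indicator {2 * pi<..\<phi> + 2 * pi} s * h s) = (\<integral>+s. (\<lambda>s. indicator {2 * pi<..\<phi> + 2 * pi} s * h s) (2 * pi + s))"
    by (rule nn_integral_lborel_translate[symmetric]) measurable
  also have "\<dots> = (\<integral>+s. indicator {0<..\<phi>} s * h s)"
    using per by (intro nn_integral_cong) (auto simp: add.commute split: split_indicator)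
  also have "(\<integral>+s. indicator {\<phi><..2 * pi} s * h s) + (\<integral>+s. indicator {0<..\<phi>} s * h s) = (\<integral>+s. indicator {\<phi><..2 * pi} s * h s + indicator {0<..\<phi>} s * h s)"
    by (rule nn_integral_add[symmetric]) measurable
  also have "\<dots> = (\<integral>+s. indicator {0<..2 * pi} s * h s)"
    using \<phi> by (intro nn_integral_cong) (auto split: split_indicator)
  finally show ?thesis unfolding half_open .
qed

section \<open>Slices of the gain operator at a fixed relative angle\<close>

abbreviation (input) circle_integral :: "(real \<Rightarrow> ennreal) \<Rightarrow> ennreal" (binder \<open>\<integral>o\<close> 10)
  where "circle_integral h \<equiv> (\<integral>+\<theta>. indicator {0..2 * pi} \<theta> * h \<theta>)"

text \<open>The variable \<open>w\<close> is the relative velocity \<open>v - u\<close>; the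
  arguments of \<open>a\<close> and \<open>b\<close> are the pre-collisional velocities
  \<open>v_star\<close> and \<open>u_star\<close> written in terms of \<open>w\<close>.\<close>

definition gain_slice :: "(plane \<Rightarrow> ennreal) \<Rightarrow> (plane \<Rightarrow> ennreal) \<Rightarrow> real \<Rightarrow> plane \<Rightarrow> ennreal" where
  "gain_slice a b \<theta> v = (\<integral>+w. a (v - cos \<theta> *\<^sub>R rot \<theta> w) * b (v - (w - cos \<theta> *\<^sub>R rot \<theta> w)))"

lemma measurable_gain_slice [measurable (raw)]:
  assumes [measurable]: "a \<in> borel_measurable borel" "b \<in> borel_measurable borel" "k \<in> borel_measurable M" "l \<in> borel_measurable M"
  shows "(\<lambda>x. gain_slice a b (k x) (l x)) \<in> borel_measurable M"
  unfolding gain_slice_def by measurable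

text \<open>The angle is measured from the relative velocity, which makes the collision map linear in it.\<close>

lemma gain_eq_slices:
  fixes a b :: "plane \<Rightarrow> ennreal"
  assumes [measurable]: "a \<in> borel_measurable borel" "b \<in> borel_measurable borel"
  shows "(\<integral>o\<theta>. (\<integral>+u. a (v_star (circle_point \<theta>) v u) * b (u_star (circle_point \<theta>) v u)))
    = (\<integral>o\<theta>. gain_slice a b \<theta> v)"
proof -
  define P where "P = (\<lambda>\<theta> w. (circle_point \<theta> \<bullet> w) *\<^sub>R circle_point \<theta>)"
  define H where "H = (\<lambda>\<theta> w. a (v - P \<theta> w) * b (v - (w - P \<theta> w)))"
  define K where "K = (\<lambda>\<theta> w. a (v - cos \<theta> *\<^sub>R rot \<theta> w) * b (v - (w - cos \<theta> *\<^sub>R rot \<theta> w)))"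
  have [measurable]: "(\<lambda>x. H (k x) (l x)) \<in> borel_measurable M" "(\<lambda>x. K (k x) (l x)) \<in> borel_measurable M"
    if [measurable]: "k \<in> borel_measurable M" "l \<in> borel_measurable M" for k l and M :: "'m measure"
    unfolding H_def K_def P_def by measurable
  have refl: "(\<integral>+u. a (v_star (circle_point \<theta>) v u) * b (u_star (circle_point \<theta>) v u)) = (\<integral>+w. H \<theta> w)" for \<theta>
  proof -
    have "(\<integral>+u. a (v_star (circle_point \<theta>) v u) * b (u_star (circle_point \<theta>) v u)) = (\<integral>+u. H \<theta> (v - u))"
      by (intro nn_integral_cong) (simp add: H_def P_def v_star_def u_star_def)
    also have "\<dots> = (\<integral>+w. H \<theta> w)" by (rule nn_integral_lborel_reflect) measurable
    finally show ?thesis .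
  qed
  \<comment> \<open>The polar angle depends on \<open>w\<close>, so the rotation of the collision
    angle is made for fixed \<open>w\<close>, with the order of integration exchanged before and
    after.\<close>
  have turn: "(\<integral>o\<theta>. H \<theta> w) = (\<integral>o\<theta>. K \<theta> w)" for w
  proof -
    obtain \<phi> where \<phi>: "0 \<le> \<phi>" "\<phi> \<le> 2 * pi" and w: "w = norm w *\<^sub>R circle_point \<phi>" by (rule plane_polar)
    have "P (\<theta> + \<phi>) w = cos \<theta> *\<^sub>R rot \<theta> w" for \<theta>
      unfolding P_def using circle_point_projection[of \<theta> \<phi> "norm w"] w[symmetric] by simp
    then have HK: "H (\<theta> + \<phi>) w = K \<theta> w" for \<theta> by (simp add: H_def K_def)
    have "circle_point (\<theta> + 2 * pi) = circle_point \<theta>" for \<theta> by (simp add: circle_point_def)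
    then have "H (\<theta> + 2 * pi) w = H \<theta> w" for \<theta> by (simp add: H_def P_def)
    from nn_integral_periodic_shift[where h="\<lambda>\<theta>. H \<theta> w", OF _ this \<phi>] show ?thesis by (simp add: HK)
  qed
  have "(\<integral>o\<theta>. (\<integral>+w. H \<theta> w)) = (\<integral>+\<theta>. \<integral>+w. indicator {0..2 * pi} \<theta> * H \<theta> w)"
    by (simp add: nn_integral_cmult)
  also have "\<dots> = (\<integral>+w. \<integral>o\<theta>. H \<theta> w)"
    by (rule lborel_pair.Fubini') measurable
  also have "\<dots> = (\<integral>+w. \<integral>o\<theta>. K \<theta> w)"
    unfolding turn ..
  also have "\<dots> = (\<integral>+\<theta>. \<integral>+w. indicator {0..2 * pi} \<theta> * K \<theta> w)"
    by (rule lborel_pair.Fubini') measurable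
  also have "\<dots> = (\<integral>o\<theta>. gain_slice a b \<theta> v)"
    by (simp add: nn_integral_cmult gain_slice_def K_def)
  finally show ?thesis unfolding refl .
qed

text \<open>After squaring and setting the second relative velocity to \<open>w + s\<close>, the
  integral over \<open>(v, w)\<close> factorises for each fixed \<open>s\<close>, because
  \<open>(v - c w, v - d w)\<close> is a measure-preserving change of variables. Cauchy-Schwarz in
  \<open>s\<close> then gives the scalings \<open>1 / cos^2\<close> and \<open>1 / sin^2\<close>
  under square roots.\<close>

lemma gain_slice_L2:
  fixes a b :: "plane \<Rightarrow> ennreal"
  assumes [measurable]: "a \<in> borel_measurable borel" "b \<in> borel_measurable borel" and nz: "cos \<theta> \<noteq> 0" "sin \<theta> \<noteq> 0"
  shows "(\<integral>+v. (gain_slice a b \<theta> v)\<^sup>2) \<le> ennreal (1 / \<bar>cos \<theta> * sin \<theta>\<bar>)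
    * (esqrt (\<integral>+w. (\<integral>+v. a v * a (v + w))\<^sup>2) * esqrt (\<integral>+w. (\<integral>+v. b v * b (v + w))\<^sup>2))"
proof -
  define A B where "A = (\<lambda>w. \<integral>+v. a v * a (v + w))" and "B = (\<lambda>w. \<integral>+v. b v * b (v + w))"
  have [measurable]: "A \<in> borel_measurable borel" "B \<in> borel_measurable borel" unfolding A_def B_def by measurable
  define c d where "c = (\<lambda>w. cos \<theta> *\<^sub>R rot \<theta> w)" and "d = (\<lambda>w. w - cos \<theta> *\<^sub>R rot \<theta> w)"
  have [measurable]: "c \<in> borel_measurable borel" "d \<in> borel_measurable borel" unfolding c_def d_def by measurable
  have c_add: "c (w + s) = c w + c s" and d_add: "d (w + s) = d w + d s" for w s
    by (simp_all add: c_def d_def linear_add[OF linear_rot] algebra_simps)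
  have sc: "cos \<theta> * (cos \<theta> * r) + sin \<theta> * (sin \<theta> * r) = r" for r
  proof -
    have "cos \<theta> * (cos \<theta> * r) + sin \<theta> * (sin \<theta> * r) = ((sin \<theta>)\<^sup>2 + (cos \<theta>)\<^sup>2) * r" by algebra
    then show ?thesis by simp
  qed
  have cd: "c w - d w = rot (2 * \<theta>) w" for w
    by (simp add: c_def d_def vec_eq_iff forall_2 rot_nth cos_double_cos sin_double) (simp add: power2_eq_square algebra_simps)
  \<comment> \<open>The identity \<open>1 - cos(t) e^(i t) = - i sin(t) e^(i t)\<close>, with
    \<open>i\<close> absorbed as a quarter turn.\<close>
  have d_eq: "d w = (- sin \<theta>) *\<^sub>R rot (\<theta> + pi / 2) w" for w
    by (simp add: d_def vec_eq_iff forall_2 rot_nth cos_add sin_add algebra_simps) (simp add: sc)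
  have S: "gain_slice a b \<theta> v = (\<integral>+w. a (v - c w) * b (v - d w))" for v
    unfolding gain_slice_def c_def d_def ..
  have sq: "(gain_slice a b \<theta> v)\<^sup>2 = (\<integral>+w. \<integral>+s. (a (v - c w) * a (v - c w - c s)) * (b (v - d w) * b (v - d w - d s)))" for v
  proof -
    let ?k = "\<lambda>w. a (v - c w) * b (v - d w)"
    have "(gain_slice a b \<theta> v)\<^sup>2 = (\<integral>+w. \<integral>+s. ?k w * ?k s)"
      unfolding S power2_eq_square by (rule nn_integral_mult_nn_integral) measurable
    also have "\<dots> = (\<integral>+w. \<integral>+s. ?k w * ?k (w + s))"
    proof (rule nn_integral_cong)
      fix w :: plane
      show "(\<integral>+s. ?k w * ?k s) = (\<integral>+s. ?k w * ?k (w + s))"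
        using nn_integral_lborel_translate[of "\<lambda>s. ?k w * ?k s" w] by simp
    qed
    also have "\<dots> = (\<integral>+w. \<integral>+s. (a (v - c w) * a (v - c w - c s)) * (b (v - d w) * b (v - d w - d s)))"
      by (simp add: c_add d_add diff_diff_eq mult_ac)
    finally show ?thesis .
  qed
  \<comment> \<open>Shifting \<open>v\<close> by \<open>c w\<close> leaves \<open>w\<close> only
    inside \<open>q\<close>, through the rotation \<open>c - d\<close>, so both variables
    decouple.\<close>
  have AB: "(\<integral>+v. \<integral>+w. (a (v - c w) * a (v - c w - c s)) * (b (v - d w) * b (v - d w - d s))) = A (- c s) * B (- d s)" for s
  proof -
    define p q where "p = (\<lambda>v. a v * a (v - c s))" and "q = (\<lambda>v. b v * b (v - d s))"
    have [measurable]: "p \<in> borel_measurable borel" "q \<in> borel_measurable borel" unfolding p_def q_def by measurable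
    have "(\<integral>+v. \<integral>+w. (a (v - c w) * a (v - c w - c s)) * (b (v - d w) * b (v - d w - d s))) = (\<integral>+v. \<integral>+w. p (v - c w) * q (v - d w))"
      by (simp add: p_def q_def)
    also have "\<dots> = (\<integral>+w. \<integral>+v. p (v - c w) * q (v - d w))"
      by (rule lborel_pair.Fubini') measurable
    also have "\<dots> = (\<integral>+w. \<integral>+v. p v * q (v + rot (2 * \<theta>) w))"
    proof (rule nn_integral_cong)
      fix w :: plane
      have shift: "(c w + v) - c w = v" "(c w + v) - d w = v + rot (2 * \<theta>) w" for v
        by (simp_all add: cd[symmetric])
      show "(\<integral>+v. p (v - c w) * q (v - d w)) = (\<integral>+v. p v * q (v + rot (2 * \<theta>) w))"
        using nn_integral_lborel_translate[of "\<lambda>v. p (v - c w) * q (v - d w)" "c w", symmetric]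
        by (simp only: shift) simp
    qed
    also have "\<dots> = (\<integral>+v. \<integral>+w. p v * q (v + rot (2 * \<theta>) w))"
      by (rule lborel_pair.Fubini') measurable
    also have "\<dots> = (\<integral>+v. p v * (\<integral>+w. q w))"
    proof (rule nn_integral_cong)
      fix v :: plane
      have "(\<integral>+w. q (v + rot (2 * \<theta>) w)) = (\<integral>+w. q w)"
        using nn_integral_rot[of "\<lambda>w. q (v + w)" "2 * \<theta>"] nn_integral_lborel_translate[of q v] by simp
      then show "(\<integral>+w. p v * q (v + rot (2 * \<theta>) w)) = p v * (\<integral>+w. q w)"
        by (simp add: nn_integral_cmult)
    qed
    also have "\<dots> = (\<integral>+v. p v) * (\<integral>+w. q w)" by (rule nn_integral_multc) measurable
    finally show ?thesis by (simp add: p_def q_def A_def B_def)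
  qed
  have "(\<integral>+v. (gain_slice a b \<theta> v)\<^sup>2) = (\<integral>+s. \<integral>+v. \<integral>+w. (a (v - c w) * a (v - c w - c s)) * (b (v - d w) * b (v - d w - d s)))"
    unfolding sq
    by (rule nn_integral_rotate[where G="\<lambda>(s, v, w). (a (v - c w) * a (v - c w - c s)) * (b (v - d w) * b (v - d w - d s))", simplified, symmetric]) measurable
  also have "\<dots> = (\<integral>+s. A (- c s) * B (- d s))" unfolding AB ..
  also have "\<dots> \<le> esqrt (\<integral>+s. (A (- c s))\<^sup>2) * esqrt (\<integral>+s. (B (- d s))\<^sup>2)"
    unfolding power2_le_ennreal_iff[symmetric, of "\<integral>+s. A (- c s) * B (- d s)"] power_mult_distrib esqrt_power2
    by (rule Cauchy_Schwarz_nn_integral) measurable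
  also have "(\<integral>+s. (A (- c s))\<^sup>2) = ennreal (1 / (cos \<theta>)\<^sup>2) * (\<integral>+w. (A w)\<^sup>2)"
    using nn_integral_scaled_rot[of "\<lambda>w. (A w)\<^sup>2" "- cos \<theta>" \<theta>] nz by (simp add: c_def)
  also have "(\<integral>+s. (B (- d s))\<^sup>2) = ennreal (1 / (sin \<theta>)\<^sup>2) * (\<integral>+w. (B w)\<^sup>2)"
    using nn_integral_scaled_rot[of "\<lambda>w. (B w)\<^sup>2" "sin \<theta>" "\<theta> + pi / 2"] nz by (simp add: d_eq)
  also have "esqrt (ennreal (1 / (cos \<theta>)\<^sup>2) * (\<integral>+w. (A w)\<^sup>2)) * esqrt (ennreal (1 / (sin \<theta>)\<^sup>2) * (\<integral>+w. (B w)\<^sup>2))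
     = (ennreal (1 / \<bar>cos \<theta>\<bar>) * ennreal (1 / \<bar>sin \<theta>\<bar>)) * (esqrt (\<integral>+w. (A w)\<^sup>2) * esqrt (\<integral>+w. (B w)\<^sup>2))"
    by (simp add: esqrt_mult esqrt_ennreal real_sqrt_divide mult_ac)
  also have "ennreal (1 / \<bar>cos \<theta>\<bar>) * ennreal (1 / \<bar>sin \<theta>\<bar>) = ennreal (1 / \<bar>cos \<theta> * sin \<theta>\<bar>)"
    by (simp add: ennreal_mult[symmetric] abs_mult)
  finally show ?thesis unfolding A_def B_def .
qed

section \<open>The singular weight in the collision angle\<close>

definition angle_weight :: "real \<Rightarrow> real" where
  "angle_weight \<theta> = sqrt \<bar>cos \<theta> * sin \<theta>\<bar>"

definition angle_mass :: ennreal where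
  "angle_mass = (\<integral>o\<theta>. ennreal (1 / angle_weight \<theta>))"

lemma measurable_angle_weight [measurable]: "angle_weight \<in> borel_measurable borel"
  unfolding angle_weight_def[abs_def] by measurable

text \<open>Up to \<open>pi / 3\<close> the derivative \<open>cos\<close> is at least 1/2. Beyond it
  monotonicity suffices, since \<open>sqrt 3 / 2 >= 4/5 >= pi / 4\<close>.\<close>

lemma half_le_abs_sin:
  assumes "\<bar>y\<bar> \<le> pi / 2"
  shows "\<bar>y\<bar> / 2 \<le> \<bar>sin y\<bar>"
proof -
  have main: "y / 2 \<le> sin y" if y: "0 \<le> y" "y \<le> pi / 2" for y :: real
  proof (cases "y \<le> pi / 3")
    case True
    have "(\<lambda>x. sin x - x / 2) 0 \<le> (\<lambda>x. sin x - x / 2) y"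
    proof (rule DERIV_nonneg_imp_nondecreasing[OF y(1)])
      fix x assume x: "0 \<le> x" "x \<le> y"
      have "cos (pi / 3) \<le> cos x" using x True by (intro cos_monotone_0_pi_le) auto
      then show "\<exists>d. ((\<lambda>x. sin x - x / 2) has_real_derivative d) (at x) \<and> 0 \<le> d"
        by (intro exI[of _ "cos x - 1 / 2"] conjI) (auto intro!: derivative_eq_intros simp: cos_60)
    qed
    then show ?thesis by simp
  next
    case False
    have "sin (pi / 3) \<le> sin y" using y False by (intro sin_monotone_2pi_le) auto
    moreover have "(8 / 5 :: real) \<le> sqrt 3" by (rule real_le_rsqrt) (simp add: power2_eq_square)
    moreover have "pi \<le> 32 / 10" using pi_approx by simp
    ultimately show ?thesis using y by (simp add: sin_60)
  qed
  show ?thesis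
  proof (cases "0 \<le> y")
    case True
    then show ?thesis using main[of y] assms by simp
  next
    case False
    then have "- y / 2 \<le> sin (- y)" using assms by (intro main) auto
    then show ?thesis using False by simp
  qed
qed

text \<open>\<open>cos * sin\<close> is half of \<open>sin (2 theta)\<close>, whose zeros in the
  interval are the five points \<open>k * pi / 2\<close>. The nearest one controls the weight, and
  the sum over all five removes the dependence of \<open>k\<close> on the angle.\<close>

lemma inverse_angle_weight_le:
  assumes "0 \<le> \<theta>" "\<theta> \<le> 2 * pi"
  shows "1 / angle_weight \<theta> \<le> (\<Sum>k\<le>4. 2 / sqrt \<bar>\<theta> - real k * (pi / 2)\<bar>)"
proof -
  define k where "k = nat (round (2 * \<theta> / pi))"
  have nonneg: "0 \<le> 2 * \<theta> / pi" using assms by simp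
  have "0 \<le> round (2 * \<theta> / pi)" using nonneg by (simp add: round_def)
  then have k: "real k = of_int (round (2 * \<theta> / pi))" by (simp add: k_def)
  have "\<bar>real k - 2 * \<theta> / pi\<bar> \<le> 1 / 2" unfolding k by (rule of_int_round_abs_le)
  then have dist: "\<bar>2 * \<theta> - real k * pi\<bar> \<le> pi / 2"
    by (subst abs_minus_commute) (simp add: field_simps)
  have "2 * \<theta> / pi \<le> 4" using assms by (simp add: field_simps)
  then have k4: "k \<le> 4" using \<open>\<bar>real k - 2 * \<theta> / pi\<bar> \<le> 1 / 2\<close> by linarith
  have "\<bar>sin (2 * \<theta> - real k * pi)\<bar> = \<bar>2 * (cos \<theta> * sin \<theta>)\<bar>"
    by (simp add: sin_diff abs_mult sin_double)
  then have "\<bar>2 * \<theta> - real k * pi\<bar> / 2 \<le> \<bar>2 * (cos \<theta> * sin \<theta>)\<bar>"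
    using half_le_abs_sin[OF dist] by (simp only:)
  moreover have "\<bar>2 * \<theta> - real k * pi\<bar> = 2 * \<bar>\<theta> - real k * (pi / 2)\<bar>"
    by (simp add: abs_if algebra_simps)
  \<comment> \<open>Division by 2 would also hold; division by 4 has an exact square root.\<close>
  ultimately have low: "\<bar>\<theta> - real k * (pi / 2)\<bar> / 4 \<le> \<bar>cos \<theta> * sin \<theta>\<bar>"
    by (simp add: abs_mult)
  have "1 / angle_weight \<theta> \<le> 2 / sqrt \<bar>\<theta> - real k * (pi / 2)\<bar>"
  proof (cases "\<theta> = real k * (pi / 2)")
    case True
    then have "2 * \<theta> = real k * pi" by simp
    then have "sin (2 * \<theta>) = 0" by (simp only: sin_npi)
    then have "cos \<theta> * sin \<theta> = 0" by (auto simp: sin_double)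
    then have "angle_weight \<theta> = 0" unfolding angle_weight_def by (simp only: abs_zero real_sqrt_zero)
    then show ?thesis by (simp only: div_by_0) simp
  next
    case False
    have "sqrt (\<bar>\<theta> - real k * (pi / 2)\<bar> / 4) \<le> angle_weight \<theta>"
      unfolding angle_weight_def by (rule real_sqrt_le_mono[OF low])
    then have "sqrt \<bar>\<theta> - real k * (pi / 2)\<bar> / 2 \<le> angle_weight \<theta>"
      by (simp add: real_sqrt_divide)
    moreover have "0 < sqrt \<bar>\<theta> - real k * (pi / 2)\<bar> / 2" using False by simp
    ultimately have "1 / angle_weight \<theta> \<le> 1 / (sqrt \<bar>\<theta> - real k * (pi / 2)\<bar> / 2)"
      by (rule frac_le[OF zero_le_one order_refl, rotated])
    then show ?thesis by simp
  qed
  also have "\<dots> \<le> (\<Sum>k\<le>4. 2 / sqrt \<bar>\<theta> - real k * (pi / 2)\<bar>)"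
    using k4 by (intro member_le_sum) auto
  finally show ?thesis .
qed

lemma angle_mass_finite: "angle_mass < top"
proof -
  define J where "J = (\<integral>+s. indicator {0..2 * pi} s * ennreal (s powr (- 1 / 2)))"
  have "J = ennreal ((2 * pi) powr (- 1 / 2 + 1) / (- 1 / 2 + 1))"
    unfolding J_def using nn_integral_has_integral_lebesgue'[OF _ has_integral_powr_from_0[of "- 1 / 2" "2 * pi"]]
    by (simp add: mult.commute)
  then have J: "J < top" by simp
  have one: "(\<integral>o\<theta>. ennreal (2 / sqrt \<bar>\<theta> - a\<bar>)) < top" if a: "0 \<le> a" "a \<le> 2 * pi" for a
  proof -
    let ?j = "\<lambda>s. indicator {0..2 * pi} s * ennreal (s powr (- 1 / 2))"
    have pw: "1 / sqrt s = s powr (- 1 / 2)" if "0 \<le> s" for s :: real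
      using that by (simp add: powr_minus_divide powr_half_sqrt)
    have "(\<integral>o\<theta>. ennreal (2 / sqrt \<bar>\<theta> - a\<bar>)) \<le> (\<integral>+\<theta>. 2 * (?j (- a + \<theta>) + ?j (a - \<theta>)))"
    proof (rule nn_integral_mono)
      fix \<theta> :: real
      have two: "ennreal (2 / sqrt r) = 2 * ennreal (r powr (- 1 / 2))" if "0 \<le> r" for r
      proof -
        have "2 / sqrt r = 2 * (r powr (- 1 / 2))" using pw[OF that] by simp
        then show ?thesis by (simp add: ennreal_mult)
      qed
      show "indicator {0..2 * pi} \<theta> * ennreal (2 / sqrt \<bar>\<theta> - a\<bar>) \<le> 2 * (?j (- a + \<theta>) + ?j (a - \<theta>))"
      proof (cases "\<theta> \<in> {0..2 * pi}")
        case True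
        show ?thesis
        proof (cases "a \<le> \<theta>")
          case le: True
          have "- a + \<theta> \<in> {0..2 * pi}" using le True a by auto
          then have "2 * ?j (- a + \<theta>) = ennreal (2 / sqrt \<bar>\<theta> - a\<bar>)" using le two[of "\<theta> - a"] by simp
          then show ?thesis using True by (simp add: distrib_left)
        next
          case gt: False
          have "a - \<theta> \<in> {0..2 * pi}" using gt True a by auto
          then have "2 * ?j (a - \<theta>) = ennreal (2 / sqrt \<bar>\<theta> - a\<bar>)" using gt two[of "a - \<theta>"] by simp
          then show ?thesis using True by (simp add: distrib_left)
        qed
      qed simp
    qed
    also have "\<dots> = 2 * ((\<integral>+\<theta>. ?j (- a + \<theta>)) + (\<integral>+\<theta>. ?j (a - \<theta>)))"
      by (subst nn_integral_cmult, measurable, subst nn_integral_add, measurable)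
    also have "\<dots> = 2 * (J + J)"
      using nn_integral_lborel_translate[of ?j "- a"] nn_integral_lborel_reflect[of ?j a] by (simp add: J_def)
    also have "\<dots> < top" using J by (simp add: ennreal_mult_less_top)
    finally show ?thesis .
  qed
  have "angle_mass \<le> (\<integral>+\<theta>. (\<Sum>k\<le>4. indicator {0..2 * pi} \<theta> * ennreal (2 / sqrt \<bar>\<theta> - real k * (pi / 2)\<bar>)))"
    unfolding angle_mass_def
  proof (rule nn_integral_mono)
    fix \<theta> :: real
    show "indicator {0..2 * pi} \<theta> * ennreal (1 / angle_weight \<theta>) \<le> (\<Sum>k\<le>4. indicator {0..2 * pi} \<theta> * ennreal (2 / sqrt \<bar>\<theta> - real k * (pi / 2)\<bar>))"
    proof (cases "\<theta> \<in> {0..2 * pi}")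
      case True
      then have "ennreal (1 / angle_weight \<theta>) \<le> ennreal (\<Sum>k\<le>4. 2 / sqrt \<bar>\<theta> - real k * (pi / 2)\<bar>)"
        by (intro ennreal_leI inverse_angle_weight_le) auto
      also have "\<dots> = (\<Sum>k\<le>4. ennreal (2 / sqrt \<bar>\<theta> - real k * (pi / 2)\<bar>))"
        by (rule sum_ennreal[symmetric]) simp
      finally show ?thesis using True by (simp only: indicator_simps mult_1)
    qed simp
  qed
  also have "\<dots> = (\<Sum>k\<le>4. \<integral>o\<theta>. ennreal (2 / sqrt \<bar>\<theta> - real k * (pi / 2)\<bar>))"
    by (rule nn_integral_sum) measurable
  also have "\<dots> < top"
  proof -
    have "(\<integral>o\<theta>. ennreal (2 / sqrt \<bar>\<theta> - real k * (pi / 2)\<bar>)) < top" if "k \<le> 4" for k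
    proof (rule one)
      have "real k * (pi / 2) \<le> 4 * (pi / 2)" using that by (intro mult_right_mono) auto
      then show "real k * (pi / 2) \<le> 2 * pi" by simp
    qed simp
    then show ?thesis by (auto simp: less_top)
  qed
  finally show ?thesis .
qed

text \<open>Cauchy-Schwarz in the angle with weight \<open>angle_weight\<close> plays the part of
  Minkowski's inequality. The slice bound is \<open>1 / angle_weight^2\<close>; one power cancels
  against the weight and the rest integrates to the second \<open>angle_mass\<close>.\<close>

lemma gain_plane_L2:
  fixes a b :: "plane \<Rightarrow> ennreal"
  assumes [measurable]: "a \<in> borel_measurable borel" "b \<in> borel_measurable borel"
  shows "(\<integral>+v. (\<integral>o\<theta>. gain_slice a b \<theta> v)\<^sup>2) \<le> angle_mass\<^sup>2
    * (esqrt (\<integral>+w. (\<integral>+v. a v * a (v + w))\<^sup>2) * esqrt (\<integral>+w. (\<integral>+v. b v * b (v + w))\<^sup>2))"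
    (is "_ \<le> _ * ?L")
proof -
  let ?I = "\<lambda>\<theta>. indicator {0..2 * pi} \<theta> :: ennreal"
  define r s where "r = (\<lambda>\<theta>. ?I \<theta> * ennreal (1 / angle_weight \<theta>))" and "s = (\<lambda>\<theta>. ?I \<theta> * ennreal (angle_weight \<theta>))"
  have [measurable]: "r \<in> borel_measurable borel" "s \<in> borel_measurable borel" unfolding r_def s_def by measurable
  have nz: "AE \<theta> in lborel. \<theta> \<in> {0..2 * pi} \<longrightarrow> cos \<theta> \<noteq> 0 \<and> sin \<theta> \<noteq> 0"
  proof -
    have "countable {\<theta>::real. sin (2 * \<theta>) = 0}"
    proof -
      have "{\<theta>. sin (2 * \<theta>) = 0} = (\<lambda>i. real_of_int i * pi / 2) ` UNIV"
        by (auto simp: sin_zero_iff_int2 image_iff field_simps)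
      then show ?thesis by simp
    qed
    then have "AE \<theta> in lborel. \<theta> \<notin> {\<theta>::real. sin (2 * \<theta>) = 0}"
      by (intro AE_not_in countable_imp_null_set_lborel)
    then show ?thesis by eventually_elim (auto simp: sin_double)
  qed
  \<comment> \<open>Only almost everywhere: at the zeros of the weight both factors are 0, as
    \<open>1 / 0 = 0\<close>.\<close>
  have rs: "AE \<theta> in lborel. r \<theta> * s \<theta> = ?I \<theta>"
    using nz
  proof eventually_elim
    case (elim \<theta>)
    show ?case
    proof (cases "\<theta> \<in> {0..2 * pi}")
      case True
      with elim have "angle_weight \<theta> > 0" by (simp add: angle_weight_def)
      then show ?thesis using True by (simp add: r_def s_def ennreal_mult[symmetric])
    qed (simp add: r_def)
  qed
  have I_eq: "?I \<theta> * x = esqrt (r \<theta>) * (esqrt (s \<theta>) * x)" if "r \<theta> * s \<theta> = ?I \<theta>" for \<theta> x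
  proof -
    have "esqrt (?I \<theta>) = ?I \<theta>" by (auto split: split_indicator simp: esqrt_def)
    then have "?I \<theta> = esqrt (r \<theta>) * esqrt (s \<theta>)" using that by (simp add: esqrt_mult[symmetric])
    then show ?thesis by (simp only: mult.assoc)
  qed
  have cs: "(\<integral>+\<theta>. ?I \<theta> * gain_slice a b \<theta> v)\<^sup>2 \<le> angle_mass * (\<integral>+\<theta>. s \<theta> * (gain_slice a b \<theta> v)\<^sup>2)" for v
  proof -
    have "(\<integral>+\<theta>. ?I \<theta> * gain_slice a b \<theta> v) = (\<integral>+\<theta>. esqrt (r \<theta>) * (esqrt (s \<theta>) * gain_slice a b \<theta> v))"
    proof (rule nn_integral_cong_AE)
      show "AE \<theta> in lborel. ?I \<theta> * gain_slice a b \<theta> v = esqrt (r \<theta>) * (esqrt (s \<theta>) * gain_slice a b \<theta> v)"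
        using rs by eventually_elim (rule I_eq)
    qed
    then have "(\<integral>+\<theta>. ?I \<theta> * gain_slice a b \<theta> v)\<^sup>2 \<le> (\<integral>+\<theta>. (esqrt (r \<theta>))\<^sup>2) * (\<integral>+\<theta>. (esqrt (s \<theta>) * gain_slice a b \<theta> v)\<^sup>2)"
      by (simp only:) (rule Cauchy_Schwarz_nn_integral, measurable)
    then show ?thesis by (simp add: power_mult_distrib r_def angle_mass_def)
  qed
  have slice: "AE \<theta> in lborel. s \<theta> * (\<integral>+v. (gain_slice a b \<theta> v)\<^sup>2) \<le> r \<theta> * ?L"
    using nz
  proof eventually_elim
    case (elim \<theta>)
    show ?case
    proof (cases "\<theta> \<in> {0..2 * pi}")
      case True
      with elim have nz': "cos \<theta> \<noteq> 0" "sin \<theta> \<noteq> 0" by auto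
      have "s \<theta> * (\<integral>+v. (gain_slice a b \<theta> v)\<^sup>2) \<le> s \<theta> * (ennreal (1 / \<bar>cos \<theta> * sin \<theta>\<bar>) * ?L)"
        by (intro mult_left_mono gain_slice_L2 nz') auto
      also have "\<dots> = (ennreal (angle_weight \<theta>) * ennreal (1 / \<bar>cos \<theta> * sin \<theta>\<bar>)) * ?L"
        using True by (simp add: s_def mult.assoc)
      also have "ennreal (angle_weight \<theta>) * ennreal (1 / \<bar>cos \<theta> * sin \<theta>\<bar>) = ennreal (angle_weight \<theta> * (1 / \<bar>cos \<theta> * sin \<theta>\<bar>))"
        by (rule ennreal_mult[symmetric]) (auto simp: angle_weight_def)
      also have "angle_weight \<theta> * (1 / \<bar>cos \<theta> * sin \<theta>\<bar>) = 1 / angle_weight \<theta>"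
      proof -
        have "\<bar>cos \<theta> * sin \<theta>\<bar> = angle_weight \<theta> * angle_weight \<theta>" by (simp add: angle_weight_def)
        then show ?thesis by simp
      qed
      finally show ?thesis using True by (simp add: r_def)
    qed (simp add: s_def)
  qed
  have "(\<integral>+v. (\<integral>+\<theta>. ?I \<theta> * gain_slice a b \<theta> v)\<^sup>2) \<le> (\<integral>+v. angle_mass * (\<integral>+\<theta>. s \<theta> * (gain_slice a b \<theta> v)\<^sup>2))"
    by (rule nn_integral_mono) (rule cs)
  also have "\<dots> = angle_mass * (\<integral>+v. \<integral>+\<theta>. s \<theta> * (gain_slice a b \<theta> v)\<^sup>2)"
    by (rule nn_integral_cmult) measurable
  also have "(\<integral>+v. \<integral>+\<theta>. s \<theta> * (gain_slice a b \<theta> v)\<^sup>2) = (\<integral>+\<theta>. \<integral>+v. s \<theta> * (gain_slice a b \<theta> v)\<^sup>2)"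
    by (rule lborel_pair.Fubini') measurable
  also have "\<dots> = (\<integral>+\<theta>. s \<theta> * (\<integral>+v. (gain_slice a b \<theta> v)\<^sup>2))"
    by (simp add: nn_integral_cmult)
  also have "angle_mass * \<dots> \<le> angle_mass * (\<integral>+\<theta>. r \<theta> * ?L)"
    by (intro mult_left_mono nn_integral_mono_AE slice) simp
  also have "(\<integral>+\<theta>. r \<theta> * ?L) = angle_mass * ?L"
    by (subst nn_integral_multc) (auto simp: r_def angle_mass_def)
  finally show ?thesis by (simp only: power2_eq_square mult.assoc)
qed

section \<open>The space-time estimate for nonnegative densities\<close>

text \<open>The point of phase space at time 0 from which free transport reaches position
  \<open>fst z\<close> with velocity \<open>v_star\<close> at time \<open>t\<close>;
  \<open>pre_u\<close> is its partner for \<open>u_star\<close>.\<close>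

definition pre_v :: "real \<Rightarrow> plane \<times> plane \<Rightarrow> real \<Rightarrow> plane \<Rightarrow> plane \<times> plane" where
  "pre_v t z \<theta> u = (fst z - t *\<^sub>R v_star (circle_point \<theta>) (snd z) u, v_star (circle_point \<theta>) (snd z) u)"

definition pre_u :: "real \<Rightarrow> plane \<times> plane \<Rightarrow> real \<Rightarrow> plane \<Rightarrow> plane \<times> plane" where
  "pre_u t z \<theta> u = (fst z - t *\<^sub>R u_star (circle_point \<theta>) (snd z) u, u_star (circle_point \<theta>) (snd z) u)"

lemma measurable_pre [measurable (raw)]:
  assumes [measurable]: "a \<in> borel_measurable M" "b \<in> borel_measurable M" "c \<in> borel_measurable M" "d \<in> borel_measurable M"
  shows "(\<lambda>x. pre_v (a x) (b x) (c x) (d x)) \<in> borel_measurable M"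
    and "(\<lambda>x. pre_u (a x) (b x) (c x) (d x)) \<in> borel_measurable M"
  unfolding pre_v_def pre_u_def v_star_def u_star_def by measurable

definition gain_nn :: "(plane \<times> plane \<Rightarrow> real) \<Rightarrow> (plane \<times> plane \<Rightarrow> real) \<Rightarrow> real \<Rightarrow> plane \<times> plane \<Rightarrow> ennreal" where
  "gain_nn f g t z = (\<integral>o\<theta>. (\<integral>+u.
     ennreal (f (pre_v t z \<theta> u))
     * ennreal (g (pre_u t z \<theta> u))))"

lemma measurable_gain_nn [measurable (raw)]:
  assumes [measurable]: "f \<in> borel_measurable borel" "g \<in> borel_measurable borel" "a \<in> borel_measurable M" "b \<in> borel_measurable M"
  shows "(\<lambda>x. gain_nn f g (a x) (b x)) \<in> borel_measurable M"
  unfolding gain_nn_def by measurable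

lemma nn_integral_esqrt_mult_le:
  assumes [measurable]: "p \<in> borel_measurable M" "q \<in> borel_measurable M"
  shows "(\<integral>\<^sup>+x. esqrt (p x) * esqrt (q x) \<partial>M) \<le> esqrt (\<integral>\<^sup>+x. p x \<partial>M) * esqrt (\<integral>\<^sup>+x. q x \<partial>M)"
  using Cauchy_Schwarz_nn_integral[of "\<lambda>x. esqrt (p x)" M "\<lambda>x. esqrt (q x)"]
  unfolding power2_le_ennreal_iff[symmetric, of "\<integral>\<^sup>+x. esqrt (p x) * esqrt (q x) \<partial>M"] power_mult_distrib esqrt_power2
  by simp

lemma gain_nn_L2:
  assumes [measurable]: "f \<in> borel_measurable borel" "g \<in> borel_measurable borel"
  shows "(\<integral>+z. (gain_nn f g t z)\<^sup>2) \<le> angle_mass\<^sup>2 * (esqrt (autocorr_energy f t) * esqrt (autocorr_energy g t))"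
proof -
  let ?E = "\<lambda>f x. \<integral>+w. (autocorr f t x w)\<^sup>2"
  have slice: "(\<integral>+v. (gain_nn f g t (x, v))\<^sup>2) \<le> angle_mass\<^sup>2 * (esqrt (?E f x) * esqrt (?E g x))" for x
  proof -
    define a b where "a = (\<lambda>v. ennreal (f (x - t *\<^sub>R v, v)))" and "b = (\<lambda>v. ennreal (g (x - t *\<^sub>R v, v)))"
    have [measurable]: "a \<in> borel_measurable borel" "b \<in> borel_measurable borel" unfolding a_def b_def by measurable
    have "gain_nn f g t (x, v) = (\<integral>o\<theta>. gain_slice a b \<theta> v)" for v
      using gain_eq_slices[of a b v] by (simp add: gain_nn_def pre_v_def pre_u_def a_def b_def)
    then show ?thesis
      using gain_plane_L2[of a b] by (simp add: autocorr_def a_def b_def)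
  qed
  have "(\<integral>+z. (gain_nn f g t z)\<^sup>2) = (\<integral>+x. \<integral>+v. (gain_nn f g t (x, v))\<^sup>2)"
    by (rule nn_integral_lborel_pair(1)) measurable
  also have "\<dots> \<le> (\<integral>+x. angle_mass\<^sup>2 * (esqrt (?E f x) * esqrt (?E g x)))"
    by (rule nn_integral_mono) (rule slice)
  also have "\<dots> = angle_mass\<^sup>2 * (\<integral>+x. esqrt (?E f x) * esqrt (?E g x))"
    by (rule nn_integral_cmult) measurable
  also have "\<dots> \<le> angle_mass\<^sup>2 * (esqrt (\<integral>+x. ?E f x) * esqrt (\<integral>+x. ?E g x))"
    by (intro mult_left_mono nn_integral_esqrt_mult_le) auto
  finally show ?thesis unfolding autocorr_energy_def .
qed

text \<open>At a fixed time the norm is bounded by the geometric mean of the L^2 norms of the two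
  autocorrelations. Cauchy-Schwarz in time separates them, and the endpoint estimate is linear in
  each.\<close>

lemma gain_nn_L1L2:
  assumes [measurable]: "f \<in> borel_measurable borel" "g \<in> borel_measurable borel"
    and "\<And>z. 0 \<le> f z" "\<And>z. 0 \<le> g z"
  shows "(\<integral>+t. esqrt (\<integral>+z. (gain_nn f g t z)\<^sup>2))
    \<le> angle_mass * ennreal (896 * 4096\<^sup>2) * (esqrt (\<integral>+z. ennreal ((f z)\<^sup>2)) * esqrt (\<integral>+z. ennreal ((g z)\<^sup>2)))"
proof -
  let ?C = "ennreal (896 * 4096\<^sup>2)"
  let ?E = "\<lambda>f t. esqrt (autocorr_energy f t)"
  let ?N = "\<lambda>f. \<integral>+z. ennreal ((f z :: real)\<^sup>2)"
  have "(\<integral>+t. esqrt (\<integral>+z. (gain_nn f g t z)\<^sup>2)) \<le> (\<integral>+t. angle_mass * (esqrt (?E f t) * esqrt (?E g t)))"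
  proof (rule nn_integral_mono)
    fix t
    show "esqrt (\<integral>+z. (gain_nn f g t z)\<^sup>2) \<le> angle_mass * (esqrt (?E f t) * esqrt (?E g t))"
      unfolding esqrt_le_iff power_mult_distrib esqrt_power2 by (rule gain_nn_L2) measurable
  qed
  also have "\<dots> = angle_mass * (\<integral>+t. esqrt (?E f t) * esqrt (?E g t))"
    by (rule nn_integral_cmult) measurable
  also have "\<dots> \<le> angle_mass * (esqrt (\<integral>+t. ?E f t) * esqrt (\<integral>+t. ?E g t))"
    by (intro mult_left_mono nn_integral_esqrt_mult_le) auto
  also have "\<dots> \<le> angle_mass * (esqrt (?C * ?N f) * esqrt (?C * ?N g))"
    using assms by (intro mult_left_mono mult_mono esqrt_mono strichartz_endpoint) auto
  also have "\<dots> = angle_mass * (esqrt ?C)\<^sup>2 * (esqrt (?N f) * esqrt (?N g))"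
    by (simp only: esqrt_mult power2_eq_square mult_ac)
  finally show ?thesis by (simp only: esqrt_power2)
qed

section \<open>Transfer to Lebesgue measurable representatives\<close>

lemma lebesgue_ex_borel_complex:
  fixes f :: "'a::euclidean_space \<Rightarrow> complex"
  assumes "f \<in> borel_measurable lebesgue"
  obtains g where "g \<in> borel_measurable borel" "AE z in lborel. f z = g z"
proof -
  have "(\<lambda>z. Re (f z)) \<in> borel_measurable lebesgue" "(\<lambda>z. Im (f z)) \<in> borel_measurable lebesgue"
    using assms by measurable
  from this[THEN completion_ex_borel_measurable_real] obtain a b
    where [measurable]: "a \<in> borel_measurable lborel" "b \<in> borel_measurable lborel"
      and ab: "AE z in lborel. Re (f z) = a z" "AE z in lborel. Im (f z) = b z"
    by blast
  from ab have "AE z in lborel. f z = Complex (a z) (b z)"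
    by eventually_elim (simp add: complex_eq_iff)
  moreover have "(\<lambda>z. Complex (a z) (b z)) \<in> borel_measurable borel"
    unfolding Complex_eq by measurable
  ultimately show ?thesis by (rule that[rotated])
qed

lemma L2_norm_conv_nn_integral:
  assumes "in_L2 f"
  shows "(\<integral>+z. ennreal ((cmod (f z))\<^sup>2)) = ennreal ((L2_norm f)\<^sup>2)"
proof -
  have "(\<integral>+z. ennreal ((cmod (f z))\<^sup>2)) = (\<integral>\<^sup>+z. ennreal ((cmod (f z))\<^sup>2) \<partial>lebesgue)"
    by (simp add: nn_integral_completion)
  also have "\<dots> = ennreal (\<integral>z. (cmod (f z))\<^sup>2 \<partial>lebesgue)"
    using assms by (intro nn_integral_eq_integral) (auto simp: in_L2_def)
  finally show ?thesis by (simp add: L2_norm_def)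
qed

text \<open>Meant for \<open>f\<close> or \<open>g\<close> an indicator of a null set and the other
  function 1: then almost no collision parameter leads into that null set.\<close>

lemma gain_nn_zero_imp_AE:
  assumes [measurable]: "f \<in> borel_measurable borel" "g \<in> borel_measurable borel" and zero: "gain_nn f g t z = 0"
  shows "AE p in lborel. fst p \<in> {0..2 * pi} \<longrightarrow>
     f (pre_v t z (fst p) (snd p)) \<le> 0
   \<or> g (pre_u t z (fst p) (snd p)) \<le> 0"
proof -
  let ?k = "\<lambda>p. indicator {0..2 * pi} (fst p) * (ennreal (f (pre_v t z (fst p) (snd p)))
     * ennreal (g (pre_u t z (fst p) (snd p))))"
  have "(\<integral>+p. ?k p) = gain_nn f g t z"
    unfolding gain_nn_def by (subst nn_integral_lborel_pair(1)) (auto simp: nn_integral_cmult)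
  then have "(\<integral>+p. ?k p) = 0" using zero by (rule trans)
  then have "AE p in lborel. ?k p = 0"
    by (subst (asm) nn_integral_0_iff_AE) auto
  then show ?thesis
    by eventually_elim (auto simp: ennreal_eq_0_iff split: split_indicator_asm)
qed

lemma AE_lborel_pair:
  assumes "AE p in (lborel :: ('a::euclidean_space \<times> 'b::euclidean_space) measure). P p"
  shows "AE x in lborel. AE y in lborel. P (x, y)"
  using assms unfolding lborel_prod[symmetric] by (rule lborel_pair.AE_pair)

text \<open>The space-time estimate applied at a degenerate point. One norm may be infinite, and
  \<open>0 * top = 0\<close> still makes the bound vanish; so the estimate itself shows that the
  collision map does not see null sets.\<close>

lemma AE_gain_nn_zero:
  assumes [measurable]: "f \<in> borel_measurable borel" "g \<in> borel_measurable borel" and "\<And>z. 0 \<le> f z" "\<And>z. 0 \<le> g z"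
    and zero: "(\<integral>+z. ennreal ((f z)\<^sup>2)) = 0 \<or> (\<integral>+z. ennreal ((g z)\<^sup>2)) = 0"
  shows "AE p in lborel. gain_nn f g (fst p) (snd p) = 0"
proof -
  have e0: "esqrt 0 = 0" by (simp add: esqrt_def)
  have "(\<integral>+t. esqrt (\<integral>+z. (gain_nn f g t z)\<^sup>2)) = 0"
    using gain_nn_L1L2[OF assms(1-4)] zero by (auto simp: e0)
  then have "AE t in lborel. esqrt (\<integral>+z. (gain_nn f g t z)\<^sup>2) = 0"
    by (subst (asm) nn_integral_0_iff_AE) auto
  then have "AE t in lborel. (\<integral>+z. (gain_nn f g t z)\<^sup>2) = 0"
    by eventually_elim (metis esqrt_power2 zero_power2)
  then have "(\<integral>+t. \<integral>+z. (gain_nn f g t z)\<^sup>2) = 0"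
    by (subst nn_integral_0_iff_AE) auto
  then have "(\<integral>+p. (gain_nn f g (fst p) (snd p))\<^sup>2) = 0"
    by (subst nn_integral_lborel_pair(1)) auto
  then show ?thesis by (subst (asm) nn_integral_0_iff_AE) auto
qed

text \<open>All bounds are proved for Borel representatives. The given functions differ from these
  on a null set, \<open>good\<close> shows that the gain integrands then agree for almost every
  collision, and completeness of Lebesgue measure returns measurability to the original
  representatives.\<close>

lemma gain_transport_estimate:
  fixes f\<^sub>0 g\<^sub>0 :: "plane \<times> plane \<Rightarrow> complex"
  assumes f0: "in_L2 f\<^sub>0" and g0: "in_L2 g\<^sub>0"
  defines "F \<equiv> \<lambda>t. gain (transport t f\<^sub>0) (transport t g\<^sub>0)"
  shows "AE p in lebesgue. gain_converges (transport (fst p) f\<^sub>0) (transport (fst p) g\<^sub>0) (snd p)" (is ?conv)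
    and "in_L1L2 F" (is ?in)
    and "L1L2_norm F \<le> enn2real angle_mass * (896 * 4096\<^sup>2) * L2_norm f\<^sub>0 * L2_norm g\<^sub>0" (is ?bound)
proof -
  obtain f where f [measurable]: "f \<in> borel_measurable borel" and f_eq: "AE z in lborel. f\<^sub>0 z = f z"
    using f0 unfolding in_L2_def by (blast elim: lebesgue_ex_borel_complex)
  obtain g where g [measurable]: "g \<in> borel_measurable borel" and g_eq: "AE z in lborel. g\<^sub>0 z = g z"
    using g0 unfolding in_L2_def by (blast elim: lebesgue_ex_borel_complex)
  have "AE z in lborel. f\<^sub>0 z = f z \<and> g\<^sub>0 z = g z" using f_eq g_eq by eventually_elim simp
  then obtain N where N [measurable]: "N \<in> sets borel" and N0: "emeasure lborel N = 0"
    and eqN: "\<And>z. z \<notin> N \<Longrightarrow> f\<^sub>0 z = f z \<and> g\<^sub>0 z = g z"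
    by (rule AE_lborel_null_cover) blast
  define fa ga where "fa = (\<lambda>z. cmod (f z))" and "ga = (\<lambda>z. cmod (g z))"
  have [measurable]: "fa \<in> borel_measurable borel" "ga \<in> borel_measurable borel" unfolding fa_def ga_def by measurable
  have nf: "(\<integral>+z. ennreal ((fa z)\<^sup>2)) = ennreal ((L2_norm f\<^sub>0)\<^sup>2)"
    unfolding L2_norm_conv_nn_integral[OF f0, symmetric] fa_def
    by (rule nn_integral_cong_AE) (use f_eq in \<open>auto elim: eventually_mono\<close>)
  have ng: "(\<integral>+z. ennreal ((ga z)\<^sup>2)) = ennreal ((L2_norm g\<^sub>0)\<^sup>2)"
    unfolding L2_norm_conv_nn_integral[OF g0, symmetric] ga_def
    by (rule nn_integral_cong_AE) (use g_eq in \<open>auto elim: eventually_mono\<close>)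
  have norm0: "0 \<le> L2_norm h" for h :: "plane \<times> plane \<Rightarrow> complex"
    unfolding L2_norm_def by (intro real_sqrt_ge_zero Bochner_Integration.integral_nonneg) simp
  define K where "K = enn2real angle_mass * (896 * 4096\<^sup>2) * L2_norm f\<^sub>0 * L2_norm g\<^sub>0"
  have K0: "0 \<le> K" unfolding K_def using norm0 by (intro mult_nonneg_nonneg) auto
  define Q where "Q = (\<lambda>t. \<integral>+z. (gain_nn fa ga t z)\<^sup>2)"
  have [measurable]: "Q \<in> borel_measurable borel" unfolding Q_def by measurable
  have Q_le: "(\<integral>+t. esqrt (Q t)) \<le> ennreal K"
  proof -
    have "(\<integral>+t. esqrt (Q t)) \<le> angle_mass * ennreal (896 * 4096\<^sup>2) * (esqrt (ennreal ((L2_norm f\<^sub>0)\<^sup>2)) * esqrt (ennreal ((L2_norm g\<^sub>0)\<^sup>2)))"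
      unfolding Q_def nf[symmetric] ng[symmetric] by (rule gain_nn_L1L2) (auto simp: fa_def ga_def)
    also have "\<dots> = ennreal (enn2real angle_mass) * ennreal (896 * 4096\<^sup>2) * (ennreal (L2_norm f\<^sub>0) * ennreal (L2_norm g\<^sub>0))"
      using angle_mass_finite norm0 by (simp add: esqrt_ennreal)
    also have "\<dots> = ennreal K"
      unfolding K_def by (simp only: ennreal_mult[symmetric] norm0 enn2real_nonneg mult_nonneg_nonneg zero_le_numeral zero_le_power mult.assoc)
    finally show ?thesis .
  qed
  define H where "H = (\<lambda>(p, \<theta>, u). f (pre_v (fst p) (snd p) \<theta> u) * g (pre_u (fst p) (snd p) \<theta> u))"
  have [measurable]: "H \<in> borel_measurable borel" unfolding H_def case_prod_beta' by measurable
  \<comment> \<open>The gain operator of the Borel representatives, jointly Borel measurable in time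
    and phase space.\<close>
  define G where "G = (\<lambda>p. \<integral>\<theta>. indicator {0..2 * pi} \<theta> *\<^sub>R (\<integral>u. H (p, \<theta>, u) \<partial>lborel) \<partial>lborel)"
  have [measurable]: "G \<in> borel_measurable borel" unfolding G_def by measurable
  have gain_nn_H: "gain_nn fa ga (fst p) (snd p) = (\<integral>o\<theta>. (\<integral>+u. ennreal (cmod (H (p, \<theta>, u)))))" for p
    unfolding gain_nn_def H_def fa_def ga_def by (simp add: norm_mult ennreal_mult)
  have G_le: "ennreal (cmod (G p)) \<le> gain_nn fa ga (fst p) (snd p)" for p
  proof -
    have "ennreal (cmod (G p)) \<le> (\<integral>+\<theta>. ennreal (cmod (indicator {0..2 * pi} \<theta> *\<^sub>R (\<integral>u. H (p, \<theta>, u) \<partial>lborel))))"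
      unfolding G_def by (rule norm_integral_le_nn_integral)
    also have "\<dots> \<le> gain_nn fa ga (fst p) (snd p)"
      unfolding gain_nn_H by (intro nn_integral_mono) (auto split: split_indicator intro: norm_integral_le_nn_integral)
    finally show ?thesis .
  qed
  let ?g = "\<lambda>p \<theta> u. gain_integrand (transport (fst p) f\<^sub>0) (transport (fst p) g\<^sub>0) (snd p) (circle_point \<theta>) u"
  \<comment> \<open>\<open>N\<close> is tested in each slot separately, with the constant 1 in the
    other slot.\<close>
  have good: "AE p in lborel. (AE q in lborel. fst q \<in> {0..2 * pi} \<longrightarrow> ?g p (fst q) (snd q) = H (p, q))"
  proof -
    have iN: "(\<integral>+z. ennreal ((indicator N z)\<^sup>2)) = 0"
      using N0 by (simp add: power2_eq_square indicator_inter_arith[symmetric] ennreal_indicator)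
    have "AE p in lborel. gain_nn (indicator N) (\<lambda>_. 1) (fst p) (snd p) = 0"
      by (rule AE_gain_nn_zero) (use iN in auto)
    moreover have "AE p in lborel. gain_nn (\<lambda>_. 1) (indicator N) (fst p) (snd p) = 0"
      by (rule AE_gain_nn_zero) (use iN in auto)
    ultimately show ?thesis
    proof eventually_elim
      case (elim p)
      obtain t x v where p: "p = (t, x, v)" by (cases p)
      from gain_nn_zero_imp_AE[OF _ _ elim(1)] gain_nn_zero_imp_AE[OF _ _ elim(2)]
      have "AE q in lborel. fst q \<in> {0..2 * pi} \<longrightarrow> (indicator N (pre_v t (x, v) (fst q) (snd q)) :: real) \<le> 0 \<or> (1::real) \<le> 0"
        "AE q in lborel. fst q \<in> {0..2 * pi} \<longrightarrow> (1::real) \<le> 0 \<or> (indicator N (pre_u t (x, v) (fst q) (snd q)) :: real) \<le> 0"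
        by (simp_all add: p)
      then show ?case
      proof eventually_elim
        case (elim q)
        then show ?case
          using eqN[of "pre_v t (x, v) (fst q) (snd q)"]
            eqN[of "pre_u t (x, v) (fst q) (snd q)"]
          by (cases q) (auto simp: p H_def pre_v_def pre_u_def gain_integrand_def transport_def split: split_indicator_asm)
      qed
    qed
  qed
  have Qfin: "AE t in lborel. Q t < top"
  proof -
    have "(\<integral>+t. esqrt (Q t)) \<noteq> \<infinity>" using Q_le by (auto simp: top_unique)
    then have "AE t in lborel. esqrt (Q t) \<noteq> \<infinity>" by (intro nn_integral_PInf_AE) auto
    then show ?thesis by eventually_elim (auto simp: esqrt_def less_top split: if_splits)
  qed
  \<comment> \<open>An integrable norm in time makes almost every time slice square integrable,
    hence finite almost everywhere; this is absolute convergence of the gain integral.\<close>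
  have gfin: "AE p in lborel. gain_nn fa ga (fst p) (snd p) < top"
  proof -
    have "AE t in lborel. AE z in lborel. gain_nn fa ga t z < top"
      using Qfin
    proof eventually_elim
      case (elim t)
      then have "AE z in lborel. (gain_nn fa ga t z)\<^sup>2 \<noteq> \<infinity>" by (intro nn_integral_PInf_AE) (auto simp: Q_def)
      then show ?case by eventually_elim (auto simp: power2_eq_square less_top[symmetric])
    qed
    moreover have "{p \<in> space (lborel \<Otimes>\<^sub>M lborel). gain_nn fa ga (fst p) (snd p) < top} \<in> sets (lborel \<Otimes>\<^sub>M lborel)"
      by measurable
    ultimately have "AE p in lborel \<Otimes>\<^sub>M lborel. gain_nn fa ga (fst p) (snd p) < top"
      by (subst lborel_pair.AE_pair_iff[symmetric])
    then show ?thesis unfolding lborel_prod .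
  qed
  have pointwise: "AE p in lborel. gain_converges (transport (fst p) f\<^sub>0) (transport (fst p) g\<^sub>0) (snd p) \<and> F (fst p) (snd p) = G p"
    using good gfin
  proof eventually_elim
    case (elim p)
    define S where "S = {0..2 * pi} \<times> (UNIV :: plane set)"
    have S [measurable]: "S \<in> sets borel" unfolding S_def by (intro borel_closed closed_Times) auto
    have indS: "indicator S q = (indicator {0..2 * pi} (fst q) :: 'c::zero_neq_one)" for q by (cases q) (auto simp: S_def split: split_indicator)
    have S_leb: "S \<in> sets lebesgue" using S by simp
    have H_int: "integrable lborel (\<lambda>q. indicator S q *\<^sub>R H (p, q))"
    proof (rule integrableI_bounded)
      have "(\<integral>+q. ennreal (norm (indicator S q *\<^sub>R H (p, q)))) = (\<integral>+q. indicator {0..2 * pi} (fst q) * ennreal (cmod (H (p, q))))"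
        unfolding indS by (intro nn_integral_cong) (auto split: split_indicator)
      also have "\<dots> = gain_nn fa ga (fst p) (snd p)"
        unfolding gain_nn_H by (subst nn_integral_lborel_pair(1)) (auto simp: nn_integral_cmult)
      finally show "(\<integral>+q. ennreal (norm (indicator S q *\<^sub>R H (p, q)))) < \<infinity>" using elim(2) by simp
    qed measurable
    have ae: "AE q in lebesgue. indicator S q *\<^sub>R H (p, q) = indicator S q *\<^sub>R ?g p (fst q) (snd q)"
      using elim(1) unfolding AE_completion_iff by eventually_elim (auto simp: indS split: split_indicator)
    have H_leb: "(\<lambda>q. indicator S q *\<^sub>R H (p, q)) \<in> borel_measurable lebesgue"
      by (rule measurable_completion) measurable
    \<comment> \<open>The original integrand is measurable only as an almost everywhere modification
      of a measurable one.\<close>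
    have g_leb: "(\<lambda>q. indicator S q *\<^sub>R ?g p (fst q) (snd q)) \<in> borel_measurable lebesgue"
      by (rule borel_measurable_AE[OF H_leb ae])
    have "integrable lebesgue (\<lambda>q. indicator S q *\<^sub>R ?g p (fst q) (snd q))"
      by (rule integrable_cong_AE_imp[OF _ g_leb ae]) (use H_int in \<open>simp add: integrable_completion\<close>)
    then have conv: "gain_converges (transport (fst p) f\<^sub>0) (transport (fst p) g\<^sub>0) (snd p)"
      unfolding gain_converges_def S_def[symmetric]
      by (subst integrable_restrict_space) (use S_leb in \<open>auto simp: case_prod_beta'\<close>)
    have "AE \<theta> in lborel. AE u in lborel. \<theta> \<in> {0..2 * pi} \<longrightarrow> ?g p \<theta> u = H (p, \<theta>, u)"
      using AE_lborel_pair[OF elim(1)] by simp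
    then have inner: "AE \<theta> in lborel. indicator {0..2 * pi} \<theta> *\<^sub>R (\<integral>u. H (p, \<theta>, u) \<partial>lborel) = indicator {0..2 * pi} \<theta> *\<^sub>R (\<integral>u. ?g p \<theta> u \<partial>lebesgue)"
    proof eventually_elim
      case (elim \<theta>)
      show ?case
      proof (cases "\<theta> \<in> {0..2 * pi}")
        case True
        then have eq: "AE u in lebesgue. H (p, \<theta>, u) = ?g p \<theta> u"
          using elim unfolding AE_completion_iff by (auto elim: eventually_mono)
        have m: "(\<lambda>u. H (p, \<theta>, u)) \<in> borel_measurable lebesgue" by (rule measurable_completion) measurable
        have "(\<integral>u. H (p, \<theta>, u) \<partial>lborel) = (\<integral>u. H (p, \<theta>, u) \<partial>lebesgue)"
          by (rule integral_completion[symmetric]) measurable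
        also have "\<dots> = (\<integral>u. ?g p \<theta> u \<partial>lebesgue)"
          by (rule integral_cong_AE[OF m borel_measurable_AE[OF m eq] eq])
        finally show ?thesis by simp
      qed simp
    qed
    let ?L = "\<lambda>\<theta>. indicator {0..2 * pi} \<theta> *\<^sub>R (\<integral>u. H (p, \<theta>, u) \<partial>lborel)"
    have m: "?L \<in> borel_measurable lebesgue" by (rule measurable_completion) measurable
    have inner': "AE \<theta> in lebesgue. ?L \<theta> = indicator {0..2 * pi} \<theta> *\<^sub>R (\<integral>u. ?g p \<theta> u \<partial>lebesgue)"
      using inner by (simp only: AE_completion_iff)
    have "G p = integral\<^sup>L lebesgue ?L"
      unfolding G_def by (rule integral_completion[symmetric]) measurable
    also have "\<dots> = (\<integral>\<theta>. indicator {0..2 * pi} \<theta> *\<^sub>R (\<integral>u. ?g p \<theta> u \<partial>lebesgue) \<partial>lebesgue)"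
      by (rule integral_cong_AE[OF m borel_measurable_AE[OF m inner'] inner'])
    also have "\<dots> = F (fst p) (snd p)"
      unfolding F_def gain_def by (subst integral_restrict_space) auto
    finally show ?case using conv by simp
  qed
  then have Feq: "AE p in lborel. F (fst p) (snd p) = G p" by eventually_elim simp
  from pointwise show ?conv
    unfolding AE_completion_iff by eventually_elim simp
  have F_slice: "AE t in lborel. AE z in lborel. G (t, z) = F t z"
    using AE_lborel_pair[OF Feq] by (auto elim!: eventually_mono)
  define R where "R = (\<lambda>t. \<integral>+z. ennreal ((cmod (G (t, z)))\<^sup>2))"
  have [measurable]: "R \<in> borel_measurable borel" unfolding R_def by measurable
  have R_le: "R t \<le> Q t" for t
    unfolding R_def Q_def
  proof (rule nn_integral_mono)
    fix z
    show "ennreal ((cmod (G (t, z)))\<^sup>2) \<le> (gain_nn fa ga t z)\<^sup>2"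
      using power_mono[OF G_le[of "(t, z)"], of 2] by (simp add: ennreal_power)
  qed
  have slice: "AE t in lborel. in_L2 (F t) \<and> ennreal (L2_norm (F t)) = esqrt (R t)"
    using F_slice Qfin
  proof eventually_elim
    case (elim t)
    have eq: "AE z in lebesgue. G (t, z) = F t z" using elim(1) by (simp only: AE_completion_iff)
    have m: "(\<lambda>z. G (t, z)) \<in> borel_measurable lebesgue" by (rule measurable_completion) measurable
    have Fm [measurable]: "F t \<in> borel_measurable lebesgue" by (rule borel_measurable_AE[OF m eq])
    have nn: "(\<integral>\<^sup>+z. ennreal ((cmod (F t z))\<^sup>2) \<partial>lebesgue) = R t"
      unfolding R_def nn_integral_completion by (rule nn_integral_cong_AE) (use elim(1) in \<open>auto elim: eventually_mono\<close>)
    have fin: "R t < top" using R_le[of t] elim(2) by (rule le_less_trans)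
    have int: "integrable lebesgue (\<lambda>z. (cmod (F t z))\<^sup>2)"
    proof (rule integrableI_bounded)
      show "(\<lambda>z. (cmod (F t z))\<^sup>2) \<in> borel_measurable lebesgue" by measurable
      show "(\<integral>\<^sup>+z. ennreal (norm ((cmod (F t z))\<^sup>2)) \<partial>lebesgue) < \<infinity>" using nn fin by simp
    qed
    then have L2: "in_L2 (F t)" by (simp add: in_L2_def)
    have "R t = ennreal ((L2_norm (F t))\<^sup>2)"
      using L2_norm_conv_nn_integral[OF L2] nn by (simp add: nn_integral_completion)
    then show ?case using L2 norm0 by (simp add: esqrt_ennreal)
  qed
  then have L2s: "AE t in lebesgue. in_L2 (F t)"
    unfolding AE_completion_iff by eventually_elim simp
  have norms: "AE t in lebesgue. enn2real (esqrt (R t)) = L2_norm (F t)"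
    unfolding AE_completion_iff using slice
  proof eventually_elim
    case (elim t)
    then have "esqrt (R t) = ennreal (L2_norm (F t))" by simp
    then show ?case by (simp add: norm0)
  qed
  have m: "(\<lambda>t. enn2real (esqrt (R t))) \<in> borel_measurable lebesgue" by (rule measurable_completion) measurable
  have nm: "(\<lambda>t. L2_norm (F t)) \<in> borel_measurable lebesgue" by (rule borel_measurable_AE[OF m norms])
  have mass: "(\<integral>\<^sup>+t. ennreal (L2_norm (F t)) \<partial>lebesgue) \<le> ennreal K"
  proof -
    have "(\<integral>\<^sup>+t. ennreal (L2_norm (F t)) \<partial>lebesgue) = (\<integral>+t. esqrt (R t))"
      unfolding nn_integral_completion by (rule nn_integral_cong_AE) (use slice in \<open>auto elim: eventually_mono\<close>)
    also have "\<dots> \<le> (\<integral>+t. esqrt (Q t))" by (intro nn_integral_mono esqrt_mono R_le)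
    finally show ?thesis using Q_le by simp
  qed
  have int: "integrable lebesgue (\<lambda>t. L2_norm (F t))"
    by (rule integrableI_bounded[OF nm]) (use mass norm0 in \<open>auto intro: le_less_trans\<close>)
  have "(\<lambda>(t, z). F t z) \<in> borel_measurable lebesgue"
  proof -
    have "G \<in> borel_measurable lebesgue" by (rule measurable_completion) measurable
    moreover have "AE p in lebesgue. G p = (\<lambda>(t, z). F t z) p"
      unfolding AE_completion_iff using Feq by eventually_elim (auto simp: case_prod_beta')
    ultimately show ?thesis by (rule borel_measurable_AE)
  qed
  with L2s int show ?in by (simp add: in_L1L2_def)
  have "ennreal (L1L2_norm F) = (\<integral>\<^sup>+t. ennreal (L2_norm (F t)) \<partial>lebesgue)"
    unfolding L1L2_norm_def using norm0 by (intro nn_integral_eq_integral[symmetric] int) auto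
  with mass have "ennreal (L1L2_norm F) \<le> ennreal K" by simp
  then show ?bound using K0 unfolding K_def[symmetric] by (simp add: ennreal_le_iff)
qed

theorem proposition5p4:
  shows "\<exists>C::real. C > 0 \<and>
    (\<forall>f\<^sub>0 g\<^sub>0 :: (real^2) \<times> (real^2) \<Rightarrow> complex. in_L2 f\<^sub>0 \<longrightarrow> in_L2 g\<^sub>0 \<longrightarrow>
      (AE (t, z) in lebesgue. gain_converges (transport t f\<^sub>0) (transport t g\<^sub>0) z) \<and>
      in_L1L2 (\<lambda>t. gain (transport t f\<^sub>0) (transport t g\<^sub>0)) \<and>
      L1L2_norm (\<lambda>t. gain (transport t f\<^sub>0) (transport t g\<^sub>0)) \<le> C * L2_norm f\<^sub>0 * L2_norm g\<^sub>0)"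
\<comment> \<open>The added 1 yields a positive constant without a lower bound on
  \<open>angle_mass\<close>.\<close>
proof (intro exI[of _ "enn2real angle_mass * (896 * 4096\<^sup>2) + 1"] conjI allI impI)
  show "0 < enn2real angle_mass * (896 * 4096\<^sup>2) + 1"
    by (intro add_nonneg_pos mult_nonneg_nonneg) auto
  fix f\<^sub>0 g\<^sub>0 :: "(real^2) \<times> (real^2) \<Rightarrow> complex"
  assume f0: "in_L2 f\<^sub>0" and g0: "in_L2 g\<^sub>0"
  show "AE (t, z) in lebesgue. gain_converges (transport t f\<^sub>0) (transport t g\<^sub>0) z"
    using gain_transport_estimate(1)[OF f0 g0] by (simp add: case_prod_beta')
  show "in_L1L2 (\<lambda>t. gain (transport t f\<^sub>0) (transport t g\<^sub>0))"
    by (rule gain_transport_estimate(2)[OF f0 g0])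
  have "L1L2_norm (\<lambda>t. gain (transport t f\<^sub>0) (transport t g\<^sub>0)) \<le> enn2real angle_mass * (896 * 4096\<^sup>2) * L2_norm f\<^sub>0 * L2_norm g\<^sub>0"
    by (rule gain_transport_estimate(3)[OF f0 g0])
  also have "\<dots> \<le> (enn2real angle_mass * (896 * 4096\<^sup>2) + 1) * L2_norm f\<^sub>0 * L2_norm g\<^sub>0"
    by (intro mult_right_mono) (auto simp: L2_norm_def)
  finally show "L1L2_norm (\<lambda>t. gain (transport t f\<^sub>0) (transport t g\<^sub>0)) \<le> (enn2real angle_mass * (896 * 4096\<^sup>2) + 1) * L2_norm f\<^sub>0 * L2_norm g\<^sub>0" .
qed

end
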